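(* Expander graphs are not coarsely equidistributed in the space $\mathrm{Graph}(g)$ equipped with the metric $d_S$. In fact, $\mathrm{Graph}(g)$ contains a ball of radius $r$, where $r$ is on the order of the diameter of $\mathrm{Graph}(g)$, that contains no expander graph.
   Context: $\mathrm{Graph}(g)$ is the set of connected trivalent graphs (loops and multiple edges allowed) of rank $g$ (first Betti number $g$), up to isomorphism. A Whitehead move on an edge $e$ with distinct endpoints collapses $e$ to a valence-4 vertex and reopens it in one of the two other ways of splitting the four incident half-edges into two pairs. Two edges are disjoint if they share no vertex. A simultaneous Whitehead move is a composition of Whitehead moves on any number of pairwise disjoint edges. $d_S(\Gamma_1,\Gamma_2)$ is the minimal number of simultaneous Whitehead moves transforming $\Gamma_1$ into $\Gamma_2$; balls and the diameter are taken with respect to $d_S$. "$r$ is on the order of $b$" means $\frac1K b\le r\le K b$ for a uniform constant $K$ (independent of $g$). For a graph $\Gamma$ with $n$ edges and a subgraph $\Delta$, $|\Delta|$ is the number of edges of $\Delta$, and $\partial\Delta$ is the set of edges of $\Delta$ that share a vertex with an edge outside $\Delta$. The Cheeger constant is $\operatorname{ch}(\Gamma)=\min_{1\le|\Delta|\le n/2}|\partial\Delta|/|\Delta|$, over subgraphs $\Delta$ with at most $n/2$ edges. A $\delta$-expander family is an infinite family of $d$-regular graphs, each with Cheeger constant at least $\delta$; here $\delta>0$ is fixed, and expander graphs are the members of a fixed $\delta$-expander family of trivalent graphs. The phrase "coarsely equidistributed" is used informally, without a formal definition; the second sentence of the claim is the precise assertion that sharpens the first.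
   Formalization: The claim is proved for all sufficiently large g, with K independent of g; for every g it fails, since both graphs of rank 2 have Cheeger constant 1 and may both belong to the expander family, so every ball in Graph(2) would contain an expander. *)

theory Defs
  imports Complex_Main "HOL-Library.Extended_Real"
begin

text \<open>
  Finite undirected multigraphs, with loops and multiple edges, given by half-edges: \<open>flip\<close> is the
  fixed-point free involution exchanging the two halves of an edge and \<open>att\<close> maps a half-edge to
  the vertex it is attached to.  An edge is a two-element set \<open>{h, flip h}\<close>; it is a loop iff its
  two halves are attached to the same vertex.  The values of \<open>flip\<close> and \<open>att\<close> outside the set of
  half-edges are irrelevant.  Labels are natural numbers, which is enough to represent every finite
  graph up to isomorphism.
\<close>

record mgraph =
  verts :: "nat set"
  halves :: "nat set"
  flip :: "nat \<Rightarrow> nat"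
  att :: "nat \<Rightarrow> nat"

definition multigraph :: "mgraph \<Rightarrow> bool" where
  "multigraph \<Gamma> \<longleftrightarrow>
     finite (verts \<Gamma>) \<and> finite (halves \<Gamma>) \<and>
     (\<forall>h\<in>halves \<Gamma>. flip \<Gamma> h \<in> halves \<Gamma> \<and> flip \<Gamma> h \<noteq> h \<and> flip \<Gamma> (flip \<Gamma> h) = h \<and>
        att \<Gamma> h \<in> verts \<Gamma>)"

definition edges :: "mgraph \<Rightarrow> nat set set" where
  "edges \<Gamma> = (\<lambda>h. {h, flip \<Gamma> h}) ` halves \<Gamma>"

definition ends :: "mgraph \<Rightarrow> nat set \<Rightarrow> nat set" where
  "ends \<Gamma> e = att \<Gamma> ` e"

definition halves_at :: "mgraph \<Rightarrow> nat \<Rightarrow> nat set" where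
  "halves_at \<Gamma> v = {h \<in> halves \<Gamma>. att \<Gamma> h = v}"

text \<open>The valence counts half-edges, so a loop contributes two.\<close>

definition regular :: "nat \<Rightarrow> mgraph \<Rightarrow> bool" where
  "regular d \<Gamma> \<longleftrightarrow> (\<forall>v\<in>verts \<Gamma>. card (halves_at \<Gamma> v) = d)"

definition adj :: "mgraph \<Rightarrow> (nat \<times> nat) set" where
  "adj \<Gamma> = {(att \<Gamma> h, att \<Gamma> (flip \<Gamma> h)) | h. h \<in> halves \<Gamma>}"

definition graph_connected :: "mgraph \<Rightarrow> bool" where
  "graph_connected \<Gamma> \<longleftrightarrow>
     verts \<Gamma> \<noteq> {} \<and> (\<forall>u\<in>verts \<Gamma>. \<forall>v\<in>verts \<Gamma>. (u, v) \<in> (adj \<Gamma>)\<^sup>*)"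

definition components :: "mgraph \<Rightarrow> nat set set" where
  "components \<Gamma> = verts \<Gamma> // (adj \<Gamma>)\<^sup>*"

text \<open>First Betti number, via the Euler characteristic \<open>b\<^sub>0 - b\<^sub>1 = |V| - |E|\<close>.\<close>

definition betti1 :: "mgraph \<Rightarrow> int" where
  "betti1 \<Gamma> = int (card (components \<Gamma>)) - int (card (verts \<Gamma>)) + int (card (edges \<Gamma>))"

definition isomorphic :: "mgraph \<Rightarrow> mgraph \<Rightarrow> bool" where
  "isomorphic \<Gamma> \<Gamma>' \<longleftrightarrow>
     (\<exists>p q. bij_betw p (verts \<Gamma>) (verts \<Gamma>') \<and> bij_betw q (halves \<Gamma>) (halves \<Gamma>') \<and>
        (\<forall>h\<in>halves \<Gamma>. q (flip \<Gamma> h) = flip \<Gamma>' (q h) \<and> p (att \<Gamma> h) = att \<Gamma>' (q h)))"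

definition iso_rel :: "(mgraph \<times> mgraph) set" where
  "iso_rel = {(\<Gamma>, \<Gamma>'). multigraph \<Gamma> \<and> multigraph \<Gamma>' \<and> isomorphic \<Gamma> \<Gamma>'}"

definition Graph :: "nat \<Rightarrow> mgraph set set" where
  "Graph g = {\<Gamma>. multigraph \<Gamma> \<and> graph_connected \<Gamma> \<and> regular 3 \<Gamma> \<and> betti1 \<Gamma> = int g} // iso_rel"

text \<open>
  A Whitehead move on an edge \<open>{h, flip h}\<close> with distinct endpoints \<open>u\<close>, \<open>v\<close>.  Collapsing and
  reopening the edge only changes where the half-edges in \<open>A \<union> B\<close> are attached (four of them if
  the graph is trivalent); the endpoints of the reopened edge are again called \<open>u\<close> and \<open>v\<close>.  The pair
  \<open>P\<close> is now attached at \<open>u\<close> and its complement at \<open>v\<close>; \<open>P \<noteq> A\<close> and \<open>P \<noteq> B\<close> exclude the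
  splitting into pairs before the move.  Half-edges and edges keep their names.
\<close>

definition whitehead_move :: "mgraph \<Rightarrow> nat set \<Rightarrow> mgraph \<Rightarrow> bool" where
  "whitehead_move \<Gamma> e \<Gamma>' \<longleftrightarrow>
     (\<exists>h\<in>halves \<Gamma>. \<exists>u v A B P.
        e = {h, flip \<Gamma> h} \<and> u = att \<Gamma> h \<and> v = att \<Gamma> (flip \<Gamma> h) \<and> u \<noteq> v \<and>
        A = halves_at \<Gamma> u - {h} \<and> B = halves_at \<Gamma> v - {flip \<Gamma> h} \<and>
        P \<subseteq> A \<union> B \<and> card P = 2 \<and> card (A \<union> B - P) = 2 \<and> P \<noteq> A \<and> P \<noteq> B \<and>
        \<Gamma>' = \<Gamma>\<lparr>att := \<lambda>x. if x \<in> P then u else if x \<in> A \<union> B then v else att \<Gamma> x\<rparr>)"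

inductive whitehead_moves :: "mgraph \<Rightarrow> nat set list \<Rightarrow> mgraph \<Rightarrow> bool" where
  Nil: "whitehead_moves \<Gamma> [] \<Gamma>"
| Cons: "whitehead_move \<Gamma> e \<Gamma>' \<Longrightarrow> whitehead_moves \<Gamma>' es \<Gamma>'' \<Longrightarrow> whitehead_moves \<Gamma> (e # es) \<Gamma>''"

definition simultaneous_move :: "mgraph \<Rightarrow> mgraph \<Rightarrow> bool" where
  "simultaneous_move \<Gamma> \<Gamma>' \<longleftrightarrow>
     (\<exists>es. distinct es \<and> set es \<subseteq> edges \<Gamma> \<and>
        (\<forall>e\<in>set es. \<forall>f\<in>set es. e \<noteq> f \<longrightarrow> ends \<Gamma> e \<inter> ends \<Gamma> f = {}) \<and>
        whitehead_moves \<Gamma> es \<Gamma>')"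

definition simul_rel :: "nat \<Rightarrow> (mgraph set \<times> mgraph set) set" where
  "simul_rel g = {(X, Y). X \<in> Graph g \<and> Y \<in> Graph g \<and> (\<exists>\<Gamma>\<in>X. \<exists>\<Gamma>'\<in>Y. simultaneous_move \<Gamma> \<Gamma>')}"

text \<open>The distance and the diameter are extended naturals: finiteness is not built in.\<close>

definition d_S :: "nat \<Rightarrow> mgraph set \<Rightarrow> mgraph set \<Rightarrow> enat" where
  "d_S g X Y = (INF n\<in>{n. (X, Y) \<in> simul_rel g ^^ n}. enat n)"

definition diameter_S :: "nat \<Rightarrow> enat" where
  "diameter_S g = (SUP X\<in>Graph g. SUP Y\<in>Graph g. d_S g X Y)"

definition ball_S :: "nat \<Rightarrow> mgraph set \<Rightarrow> real \<Rightarrow> mgraph set set" where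
  "ball_S g X r = {Y \<in> Graph g. ereal_of_enat (d_S g X Y) \<le> ereal r}"

definition on_the_order_of :: "real \<Rightarrow> real \<Rightarrow> enat \<Rightarrow> bool" where
  "on_the_order_of K r b \<longleftrightarrow>
     ereal (1 / K) * ereal_of_enat b \<le> ereal r \<and> ereal r \<le> ereal K * ereal_of_enat b"

definition subgraph :: "mgraph \<Rightarrow> mgraph \<Rightarrow> bool" where
  "subgraph \<Delta> \<Gamma> \<longleftrightarrow>
     multigraph \<Delta> \<and> verts \<Delta> \<subseteq> verts \<Gamma> \<and> halves \<Delta> \<subseteq> halves \<Gamma> \<and>
     (\<forall>h\<in>halves \<Delta>. flip \<Delta> h = flip \<Gamma> h \<and> att \<Delta> h = att \<Gamma> h)"

definition boundary :: "mgraph \<Rightarrow> mgraph \<Rightarrow> nat set set" where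
  "boundary \<Gamma> \<Delta> = {e \<in> edges \<Delta>. \<exists>f \<in> edges \<Gamma> - edges \<Delta>. ends \<Gamma> e \<inter> ends \<Gamma> f \<noteq> {}}"

text \<open>The minimum ranges over a nonempty set as soon as the graph has at least two edges.\<close>

definition cheeger :: "mgraph \<Rightarrow> real" where
  "cheeger \<Gamma> =
     Min {real (card (boundary \<Gamma> \<Delta>)) / real (card (edges \<Delta>)) | \<Delta>.
            subgraph \<Delta> \<Gamma> \<and> 1 \<le> card (edges \<Delta>) \<and> real (card (edges \<Delta>)) \<le> real (card (edges \<Gamma>)) / 2}"

text \<open>A family of graphs up to isomorphism, so that infinite means infinitely many isomorphism types.\<close>

definition expander_family :: "nat \<Rightarrow> real \<Rightarrow> mgraph set set \<Rightarrow> bool" where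
  "expander_family d \<delta> F \<longleftrightarrow>
     infinite F \<and> F \<subseteq> {\<Gamma>. multigraph \<Gamma> \<and> verts \<Gamma> \<noteq> {}} // iso_rel \<and>
     (\<forall>X\<in>F. \<forall>\<Gamma>\<in>X. regular d \<Gamma> \<and> cheeger \<Gamma> \<ge> \<delta>)"

end

theory Submission imports Defs begin

text \<open>
  Every cubic graph with a rooted spanning tree of height \<open>h\<close> can be brought to one fixed graph by
  \<open>O(h + log g)\<close> simultaneous moves: cutting the non-tree edges gives a binary tree with labelled
  leaves, and simultaneous rotations sort its leaves into the trie of the labels by a pipelined merge
  sort, in which the merging of two tries starts as soon as their roots are in place.  By the growth
  of balls, expander graphs have diameter \<open>O(log g)\<close>, so all of them lie within
  \<open>O(log g)\<close> of this base graph.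

  Let \<open>R\<close> be the maximal distance from the base graph.  If \<open>R\<close> is much larger than \<open>log g\<close>, a
  ball around a graph at distance \<open>R\<close> avoids all expanders, and the diameter is at most \<open>2R\<close>.
  Otherwise the diameter is \<open>O(log g)\<close>.  A simultaneous move changes graph distances at most by the
  factor 3, so a chain of linear diameter has distance at least a multiple of \<open>log g\<close> from all
  expanders, and a ball around the chain works.
\<close>

section \<open>Cubic graphs up to isomorphism\<close>

text \<open>Merging two tries takes time proportional to the label length, so merging level after
  level would cost the product of height and label length. Only a sum keeps expanders within
  \<open>O(log g)\<close> of the base graph. Overlapping the merges is possible because a merge,
  when it splits by bit \<open>d\<close>, looks at nothing but the top nodes of its two inputs.

  The result does not depend on the start because the labels encode the gluing: the two halves of a
  cut edge receive consecutive labels \<open>2j - 1\<close>, \<open>2j\<close>, and label 0 marks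
  the edge from which the root hangs. The trie of these labels, and hence the graph, depends on
  \<open>g\<close> only.

  For arbitrary graphs the height of the tree is only bounded linearly in \<open>g\<close> here, so
  the order of the diameter stays undetermined. The final dichotomy gets by with the fact that the
  diameter lies between \<open>R\<close> and \<open>2R\<close>.\<close>

definition cubic_graphs :: "nat \<Rightarrow> mgraph set" where
  "cubic_graphs g = {\<Gamma>. multigraph \<Gamma> \<and> graph_connected \<Gamma> \<and> regular 3 \<Gamma> \<and> betti1 \<Gamma> = int g}"

lemma multigraphD:
  assumes "multigraph \<Gamma>"
  shows "finite (verts \<Gamma>)" "finite (halves \<Gamma>)"
    "h \<in> halves \<Gamma> \<Longrightarrow> flip \<Gamma> h \<in> halves \<Gamma>"
    "h \<in> halves \<Gamma> \<Longrightarrow> flip \<Gamma> h \<noteq> h"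
    "h \<in> halves \<Gamma> \<Longrightarrow> flip \<Gamma> (flip \<Gamma> h) = h"
    "h \<in> halves \<Gamma> \<Longrightarrow> att \<Gamma> h \<in> verts \<Gamma>"
  using assms by (auto simp: multigraph_def)

lemma card_halves_eq_edges:
  assumes "multigraph \<Gamma>"
  shows "card (halves \<Gamma>) = 2 * card (edges \<Gamma>)"
proof -
  note M = multigraphD[OF assms]
  have U: "\<Union>(edges \<Gamma>) = halves \<Gamma>"
    using M(3) by (auto simp: edges_def)
  have "2 * card (edges \<Gamma>) = card (\<Union>(edges \<Gamma>))"
  proof (rule card_partition)
    show "finite (edges \<Gamma>)" "finite (\<Union>(edges \<Gamma>))"
      using M(2) U by (auto simp: edges_def)
    show "card c = 2" if c: "c \<in> edges \<Gamma>" for c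
    proof -
      obtain h where "h \<in> halves \<Gamma>" "c = {h, flip \<Gamma> h}" using c by (auto simp: edges_def)
      then show ?thesis using M(4)[of h] by simp
    qed
    show "c1 \<inter> c2 = {}" if c: "c1 \<in> edges \<Gamma>" "c2 \<in> edges \<Gamma>" and ne: "c1 \<noteq> c2" for c1 c2
    proof -
      obtain h k where hk: "h \<in> halves \<Gamma>" "c1 = {h, flip \<Gamma> h}" "k \<in> halves \<Gamma>" "c2 = {k, flip \<Gamma> k}"
        using c by (auto simp: edges_def)
      show ?thesis using ne hk M(5)[OF hk(1)] M(5)[OF hk(3)]
        by (auto simp: doubleton_eq_iff)
    qed
  qed
  then show ?thesis using U by simp
qed

lemma halves_eq_UN:
  assumes "multigraph \<Gamma>"
  shows "halves \<Gamma> = (\<Union>v\<in>verts \<Gamma>. halves_at \<Gamma> v)"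
  using multigraphD[OF assms] by (auto simp: halves_at_def)

lemma card_halves_regular:
  assumes "multigraph \<Gamma>" "regular d \<Gamma>"
  shows "card (halves \<Gamma>) = d * card (verts \<Gamma>)"
proof -
  note M = multigraphD[OF assms(1)]
  have "card (\<Union>v\<in>verts \<Gamma>. halves_at \<Gamma> v) = (\<Sum>v\<in>verts \<Gamma>. card (halves_at \<Gamma> v))"
    using M(1,2) by (intro card_UN_disjoint) (auto simp: halves_at_def)
  then show ?thesis
    using assms(2) halves_eq_UN[OF assms(1)] by (simp add: regular_def mult.commute)
qed

lemma adj_sym: "multigraph \<Gamma> \<Longrightarrow> (u, v) \<in> adj \<Gamma> \<Longrightarrow> (v, u) \<in> adj \<Gamma>"
  unfolding adj_def using multigraphD(3,5)[of \<Gamma>] by force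

lemma adj_verts: "multigraph \<Gamma> \<Longrightarrow> (u, v) \<in> adj \<Gamma> \<Longrightarrow> u \<in> verts \<Gamma> \<and> v \<in> verts \<Gamma>"
  unfolding adj_def using multigraphD(3,6)[of \<Gamma>] by auto

lemma components_connected:
  assumes "multigraph \<Gamma>" "graph_connected \<Gamma>"
  shows "components \<Gamma> = {verts \<Gamma>}"
proof -
  have "(adj \<Gamma>)\<^sup>* `` {u} = verts \<Gamma>" if u: "u \<in> verts \<Gamma>" for u
  proof
    show "(adj \<Gamma>)\<^sup>* `` {u} \<subseteq> verts \<Gamma>"
    proof
      fix v assume "v \<in> (adj \<Gamma>)\<^sup>* `` {u}"
      then have "(u, v) \<in> (adj \<Gamma>)\<^sup>*" by simp
      then show "v \<in> verts \<Gamma>"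
        by (induction rule: rtrancl_induct) (use u adj_verts[OF assms(1)] in auto)
    qed
    show "verts \<Gamma> \<subseteq> (adj \<Gamma>)\<^sup>* `` {u}" using assms(2) u by (auto simp: graph_connected_def)
  qed
  then show ?thesis
    using assms(2) by (auto simp: components_def quotient_def graph_connected_def)
qed

text \<open>One component and 2|E| = 3|V| give the Betti number 1 + |V|/2. From here on the rank is
  treated as a vertex count, written as a sum to avoid truncated subtraction.\<close>

lemma betti1_cubic:
  assumes "multigraph \<Gamma>" "graph_connected \<Gamma>" "regular 3 \<Gamma>"
  shows "betti1 \<Gamma> = int g \<longleftrightarrow> card (verts \<Gamma>) + 2 = 2 * g"
proof -
  have "2 * card (edges \<Gamma>) = 3 * card (verts \<Gamma>)"
    using card_halves_eq_edges[OF assms(1)] card_halves_regular[OF assms(1,3)] by simp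
  then show ?thesis
    by (simp add: betti1_def components_connected[OF assms(1,2)]) linarith
qed

lemma cubic_graphs_iff:
  "\<Gamma> \<in> cubic_graphs g \<longleftrightarrow> multigraph \<Gamma> \<and> graph_connected \<Gamma> \<and> regular 3 \<Gamma> \<and> card (verts \<Gamma>) + 2 = 2 * g"
  using betti1_cubic by (auto simp: cubic_graphs_def)

section \<open>Isomorphisms and the properties they preserve\<close>

definition is_iso :: "(nat \<Rightarrow> nat) \<Rightarrow> (nat \<Rightarrow> nat) \<Rightarrow> mgraph \<Rightarrow> mgraph \<Rightarrow> bool" where
  "is_iso p q \<Gamma> \<Gamma>' \<longleftrightarrow> bij_betw p (verts \<Gamma>) (verts \<Gamma>') \<and> bij_betw q (halves \<Gamma>) (halves \<Gamma>') \<and>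
        (\<forall>h\<in>halves \<Gamma>. q (flip \<Gamma> h) = flip \<Gamma>' (q h) \<and> p (att \<Gamma> h) = att \<Gamma>' (q h))"

lemma isomorphic_iff: "isomorphic \<Gamma> \<Gamma>' \<longleftrightarrow> (\<exists>p q. is_iso p q \<Gamma> \<Gamma>')"
  by (simp add: isomorphic_def is_iso_def)

lemma isomorphic_refl: "isomorphic \<Gamma> \<Gamma>"
  unfolding isomorphic_def by (rule exI[of _ id], rule exI[of _ id]) auto

lemma isomorphic_trans: "isomorphic \<Gamma> \<Gamma>' \<Longrightarrow> isomorphic \<Gamma>' \<Gamma>'' \<Longrightarrow> isomorphic \<Gamma> \<Gamma>''"
proof -
  assume "isomorphic \<Gamma> \<Gamma>'" "isomorphic \<Gamma>' \<Gamma>''"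
  then obtain p q p' q' where a: "is_iso p q \<Gamma> \<Gamma>'" and b: "is_iso p' q' \<Gamma>' \<Gamma>''"
    by (auto simp: isomorphic_iff)
  have "is_iso (p' \<circ> p) (q' \<circ> q) \<Gamma> \<Gamma>''"
    using a b bij_betw_trans[of p _ _ p'] bij_betw_trans[of q _ _ q'] bij_betwE[of q "halves \<Gamma>"]
    unfolding is_iso_def by auto
  then show ?thesis by (auto simp: isomorphic_iff)
qed

lemma isomorphic_sym:
  assumes "multigraph \<Gamma>" "isomorphic \<Gamma> \<Gamma>'"
  shows "isomorphic \<Gamma>' \<Gamma>"
proof -
  note M = multigraphD[OF assms(1)]
  obtain p q where a: "is_iso p q \<Gamma> \<Gamma>'" using assms(2) by (auto simp: isomorphic_iff)
  let ?p = "the_inv_into (verts \<Gamma>) p" and ?q = "the_inv_into (halves \<Gamma>) q"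
  have bp: "bij_betw p (verts \<Gamma>) (verts \<Gamma>')" and bq: "bij_betw q (halves \<Gamma>) (halves \<Gamma>')"
    using a by (auto simp: is_iso_def)
  have "?q (flip \<Gamma>' h) = flip \<Gamma> (?q h) \<and> ?p (att \<Gamma>' h) = att \<Gamma> (?q h)" if h: "h \<in> halves \<Gamma>'" for h
  proof -
    obtain k where k: "k \<in> halves \<Gamma>" "h = q k" using h bq by (auto simp: bij_betw_def)
    have "flip \<Gamma>' h = q (flip \<Gamma> k)" "att \<Gamma>' h = p (att \<Gamma> k)" using a k by (auto simp: is_iso_def)
    then show ?thesis using k M bp bq by (simp add: bij_betw_def the_inv_into_f_f)
  qed
  then have "is_iso ?p ?q \<Gamma>' \<Gamma>"
    using bij_betw_the_inv_into[OF bp] bij_betw_the_inv_into[OF bq] by (simp add: is_iso_def)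
  then show ?thesis by (auto simp: isomorphic_iff)
qed

lemma equiv_iso_rel: "equiv {\<Gamma>. multigraph \<Gamma>} iso_rel"
  by (auto intro!: equivI refl_onI symI transI simp: iso_rel_def isomorphic_refl
      intro: isomorphic_sym isomorphic_trans)

lemma is_iso_adj_relpow:
  assumes "is_iso p q \<Gamma> \<Gamma>'" and m: "\<And>h. h \<in> halves \<Gamma> \<Longrightarrow> flip \<Gamma> h \<in> halves \<Gamma>"
    and "(u, v) \<in> adj \<Gamma> ^^ n"
  shows "(p u, p v) \<in> adj \<Gamma>' ^^ n"
  using assms(3)
proof (induction n arbitrary: v)
  case (Suc n)
  then obtain w where w: "(u, w) \<in> adj \<Gamma> ^^ n" "(w, v) \<in> adj \<Gamma>" by auto
  have "(p w, p v) \<in> adj \<Gamma>'"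
  proof -
    obtain h where h: "h \<in> halves \<Gamma>" "w = att \<Gamma> h" "v = att \<Gamma> (flip \<Gamma> h)"
      using w(2) by (auto simp: adj_def)
    then have "q h \<in> halves \<Gamma>'" "p w = att \<Gamma>' (q h)" "p v = att \<Gamma>' (flip \<Gamma>' (q h))"
      using assms(1) m by (auto simp: is_iso_def bij_betw_def)
    then show ?thesis by (auto simp: adj_def)
  qed
  then show ?case using Suc.IH[OF w(1)] by auto
qed auto

text \<open>A bound in place of a diameter: it contains connectedness and needs no value for
  infinite distances.\<close>

definition diam_le :: "mgraph \<Rightarrow> nat \<Rightarrow> bool" where
  "diam_le \<Gamma> D \<longleftrightarrow> (\<forall>u\<in>verts \<Gamma>. \<forall>v\<in>verts \<Gamma>. \<exists>k\<le>D. (u, v) \<in> adj \<Gamma> ^^ k)"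

lemma diam_le_iso:
  assumes "multigraph \<Gamma>" "isomorphic \<Gamma> \<Gamma>'" "diam_le \<Gamma> D"
  shows "diam_le \<Gamma>' D"
proof -
  obtain p q where a: "is_iso p q \<Gamma> \<Gamma>'" using assms(2) by (auto simp: isomorphic_iff)
  then have "verts \<Gamma>' = p ` verts \<Gamma>" by (auto simp: is_iso_def bij_betw_def)
  moreover have "\<exists>k\<le>D. (p u, p v) \<in> adj \<Gamma>' ^^ k" if "u \<in> verts \<Gamma>" "v \<in> verts \<Gamma>" for u v
    using assms(3) that is_iso_adj_relpow[OF a multigraphD(3)[OF assms(1)]] unfolding diam_le_def by blast
  ultimately show ?thesis by (auto simp: diam_le_def)
qed

lemma connected_iso:
  assumes "multigraph \<Gamma>" "isomorphic \<Gamma> \<Gamma>'" "graph_connected \<Gamma>"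
  shows "graph_connected \<Gamma>'"
proof -
  obtain p q where a: "is_iso p q \<Gamma> \<Gamma>'" using assms(2) by (auto simp: isomorphic_iff)
  then have V: "verts \<Gamma>' = p ` verts \<Gamma>" by (auto simp: is_iso_def bij_betw_def)
  have "(p u, p v) \<in> (adj \<Gamma>')\<^sup>*" if "(u, v) \<in> (adj \<Gamma>)\<^sup>*" for u v
    using that is_iso_adj_relpow[OF a multigraphD(3)[OF assms(1)]] by (metis rtrancl_power)
  then show ?thesis using assms(3) V unfolding graph_connected_def by auto
qed

lemma regular_iso:
  assumes "multigraph \<Gamma>" "isomorphic \<Gamma> \<Gamma>'" "regular d \<Gamma>"
  shows "regular d \<Gamma>'"
proof -
  note M = multigraphD[OF assms(1)]
  obtain p q where a: "is_iso p q \<Gamma> \<Gamma>'" using assms(2) by (auto simp: isomorphic_iff)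
  then have V: "verts \<Gamma>' = p ` verts \<Gamma>" and H: "halves \<Gamma>' = q ` halves \<Gamma>"
    and ip: "inj_on p (verts \<Gamma>)" and iq: "inj_on q (halves \<Gamma>)" by (auto simp: is_iso_def bij_betw_def)
  have "card (halves_at \<Gamma>' (p v)) = d" if v: "v \<in> verts \<Gamma>" for v
  proof -
    have "halves_at \<Gamma>' (p v) = q ` halves_at \<Gamma> v"
      using a H v ip M(6) unfolding halves_at_def is_iso_def by (auto simp: inj_on_eq_iff)
    moreover have "inj_on q (halves_at \<Gamma> v)" using iq by (rule inj_on_subset) (auto simp: halves_at_def)
    ultimately show ?thesis using assms(3) v by (simp add: card_image regular_def)
  qed
  then show ?thesis using V by (auto simp: regular_def)
qed

lemma cubic_graphs_iso:
  assumes "\<Gamma> \<in> cubic_graphs g" "isomorphic \<Gamma> \<Gamma>'" "multigraph \<Gamma>'"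
  shows "\<Gamma>' \<in> cubic_graphs g"
proof -
  have "card (verts \<Gamma>') = card (verts \<Gamma>)"
    using assms(2) by (auto simp: isomorphic_def dest: bij_betw_same_card)
  then show ?thesis using assms connected_iso regular_iso unfolding cubic_graphs_iff by auto
qed

definition iso_class :: "mgraph \<Rightarrow> mgraph set" where
  "iso_class \<Gamma> = iso_rel `` {\<Gamma>}"

lemma Graph_eq: "Graph g = iso_class ` cubic_graphs g"
  by (auto simp: Graph_def cubic_graphs_def quotient_def iso_class_def)

lemma in_iso_class: "multigraph \<Gamma> \<Longrightarrow> \<Gamma> \<in> iso_class \<Gamma>"
  by (simp add: iso_class_def iso_rel_def isomorphic_refl)

lemma iso_class_eqI: "multigraph \<Gamma> \<Longrightarrow> multigraph \<Gamma>' \<Longrightarrow> isomorphic \<Gamma> \<Gamma>' \<Longrightarrow> iso_class \<Gamma> = iso_class \<Gamma>'"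
  unfolding iso_class_def using equiv_iso_rel by (rule equiv_class_eq) (simp add: iso_rel_def)

lemma Graph_memD:
  assumes "X \<in> Graph g" "\<Gamma> \<in> X"
  shows "\<Gamma> \<in> cubic_graphs g" "X = iso_class \<Gamma>"
proof -
  obtain \<Gamma>0 where 0: "\<Gamma>0 \<in> cubic_graphs g" "X = iso_class \<Gamma>0" using assms(1) by (auto simp: Graph_eq)
  then have i: "isomorphic \<Gamma>0 \<Gamma>" "multigraph \<Gamma>" "multigraph \<Gamma>0"
    using assms(2) by (auto simp: iso_class_def iso_rel_def)
  show "\<Gamma> \<in> cubic_graphs g" using cubic_graphs_iso[OF 0(1) i(1,2)] .
  show "X = iso_class \<Gamma>" using 0 i iso_class_eqI by blast
qed

lemma Graph_repr:
  assumes "X \<in> Graph g"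
  obtains \<Gamma> where "\<Gamma> \<in> cubic_graphs g" "X = iso_class \<Gamma>" "\<Gamma> \<in> X"
  using assms in_iso_class by (auto simp: Graph_eq cubic_graphs_iff)

lemma iso_class_Graph: "\<Gamma> \<in> cubic_graphs g \<Longrightarrow> iso_class \<Gamma> \<in> Graph g"
  by (simp add: Graph_eq)

lemma simul_rel_iso_class:
  assumes "\<Gamma> \<in> cubic_graphs g" "\<Gamma>' \<in> cubic_graphs g" "simultaneous_move \<Gamma> \<Gamma>'"
  shows "(iso_class \<Gamma>, iso_class \<Gamma>') \<in> simul_rel g"
  using assms in_iso_class iso_class_Graph unfolding simul_rel_def cubic_graphs_iff by blast

section \<open>Whitehead moves\<close>

text \<open>In a cubic graph each reopening of an edge swaps one half-edge at one end with one at
  the other end. With \<open>y\<close> fixed, the two choices of \<open>z\<close> give the two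
  possible moves.\<close>

definition exchange :: "mgraph \<Rightarrow> nat \<Rightarrow> nat \<Rightarrow> mgraph" where
  "exchange \<Gamma> y z = \<Gamma>\<lparr>att := (att \<Gamma>)(y := att \<Gamma> z, z := att \<Gamma> y)\<rparr>"

lemma whitehead_move_exchange:
  assumes h: "h \<in> halves \<Gamma>" and uv: "att \<Gamma> h = u" "att \<Gamma> (flip \<Gamma> h) = v" "u \<noteq> v"
    and u: "halves_at \<Gamma> u = {h, x, y}" "card {h, x, y} = 3"
    and v: "halves_at \<Gamma> v = {flip \<Gamma> h, z, w}" "card {flip \<Gamma> h, z, w} = 3"
  shows "whitehead_move \<Gamma> {h, flip \<Gamma> h} (exchange \<Gamma> y z)"
proof -
  have at: "att \<Gamma> x = u" "att \<Gamma> y = u" "att \<Gamma> z = v" "att \<Gamma> w = v"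
    using u(1) v(1) by (auto simp: halves_at_def)
  have d: "h \<noteq> x" "h \<noteq> y" "x \<noteq> y" "flip \<Gamma> h \<noteq> z" "flip \<Gamma> h \<noteq> w" "z \<noteq> w"
    using u(2) v(2) by (auto simp: card_insert_if split: if_splits)
  have d': "x \<noteq> z" "x \<noteq> w" "y \<noteq> z" "y \<noteq> w" using at uv by auto
  have A: "halves_at \<Gamma> u - {h} = {x, y}" and B: "halves_at \<Gamma> v - {flip \<Gamma> h} = {z, w}"
    using u(1) v(1) d by auto
  have P: "{x, y} \<union> {z, w} - {x, z} = {y, w}" using d d' by auto
  have "exchange \<Gamma> y z = \<Gamma>\<lparr>att := \<lambda>t. if t \<in> {x, z} then u else if t \<in> {x, y} \<union> {z, w} then v else att \<Gamma> t\<rparr>"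
    unfolding exchange_def using at d d' by (intro arg_cong[of _ _ "\<lambda>f. \<Gamma>\<lparr>att := f\<rparr>"]) (auto simp: fun_eq_iff)
  moreover have "card {x, z} = 2" "card ({x, y} \<union> {z, w} - {x, z}) = 2"
    unfolding P using d d' by auto
  moreover have "{x, z} \<noteq> {x, y}" "{x, z} \<noteq> {z, w}" "{x, z} \<subseteq> {x, y} \<union> {z, w}"
    using d d' by (auto simp: doubleton_eq_iff)
  ultimately show ?thesis
    unfolding whitehead_move_def using uv A B
    by (intro bexI[OF _ h] exI[of _ u] exI[of _ v] exI[of _ "{x, y}"] exI[of _ "{z, w}"] exI[of _ "{x, z}"] conjI)
       (rule refl | assumption | simp only:)+
qed

text \<open>Half-edges are reattached only within the two ends of \<open>e\<close>, and the halves
  of \<open>e\<close> stay put. This locality makes moves on disjoint edges independent and limits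
  the distortion of distances.\<close>

lemma whitehead_move_local:
  assumes "whitehead_move \<Gamma> e \<Gamma>'"
  shows "verts \<Gamma>' = verts \<Gamma>" "halves \<Gamma>' = halves \<Gamma>" "flip \<Gamma>' = flip \<Gamma>"
    "att \<Gamma>' x = att \<Gamma> x \<or> att \<Gamma> x \<in> ends \<Gamma> e \<and> att \<Gamma>' x \<in> ends \<Gamma> e"
    "x \<in> e \<Longrightarrow> att \<Gamma>' x = att \<Gamma> x"
proof -
  obtain h u v A B P where e: "e = {h, flip \<Gamma> h}"
    and u: "u = att \<Gamma> h" and v: "v = att \<Gamma> (flip \<Gamma> h)" and uv: "u \<noteq> v"
    and A: "A = halves_at \<Gamma> u - {h}" and B: "B = halves_at \<Gamma> v - {flip \<Gamma> h}" and P: "P \<subseteq> A \<union> B"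
    and \<Gamma>': "\<Gamma>' = \<Gamma>\<lparr>att := \<lambda>x. if x \<in> P then u else if x \<in> A \<union> B then v else att \<Gamma> x\<rparr>"
    using assms unfolding whitehead_move_def by blast
  show "verts \<Gamma>' = verts \<Gamma>" "halves \<Gamma>' = halves \<Gamma>" "flip \<Gamma>' = flip \<Gamma>" by (simp_all add: \<Gamma>')
  have att': "att \<Gamma>' x = (if x \<in> P then u else if x \<in> A \<union> B then v else att \<Gamma> x)" by (simp add: \<Gamma>')
  have ends: "ends \<Gamma> e = {u, v}" by (simp add: ends_def e u v)
  have AB: "x \<in> A \<union> B \<Longrightarrow> att \<Gamma> x \<in> {u, v}" by (auto simp: A B halves_at_def)
  show "att \<Gamma>' x = att \<Gamma> x \<or> att \<Gamma> x \<in> ends \<Gamma> e \<and> att \<Gamma>' x \<in> ends \<Gamma> e"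
  proof (cases "x \<in> A \<union> B")
    case True
    then show ?thesis using AB att' ends by simp
  next
    case False
    then show ?thesis using P att' by auto
  qed
  show "att \<Gamma>' x = att \<Gamma> x" if "x \<in> e"
  proof -
    have "x \<notin> A \<union> B" using that uv unfolding e A B halves_at_def u v by auto
    then show ?thesis using P att' by auto
  qed
qed

text \<open>The move is undone by reopening the same edge with the old pair \<open>A\<close> in the
  role of \<open>P\<close>. Since \<open>A\<close>, \<open>B\<close> and \<open>P\<close> have two
  elements each, \<open>P \<noteq> B\<close> ensures that \<open>A\<close> is not the complement of
  \<open>P\<close>. Reversibility makes \<open>simul_rel\<close> symmetric.\<close>

lemma whitehead_move_cubic:
  assumes m: "multigraph \<Gamma>" and r: "regular 3 \<Gamma>" and w: "whitehead_move \<Gamma> e \<Gamma>'"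
  shows "multigraph \<Gamma>'" "regular 3 \<Gamma>'" "whitehead_move \<Gamma>' e \<Gamma>"
proof -
  note M = multigraphD[OF m]
  obtain h u v A B P where h: "h \<in> halves \<Gamma>" and e: "e = {h, flip \<Gamma> h}"
    and u: "u = att \<Gamma> h" and v: "v = att \<Gamma> (flip \<Gamma> h)" and uv: "u \<noteq> v"
    and A: "A = halves_at \<Gamma> u - {h}" and B: "B = halves_at \<Gamma> v - {flip \<Gamma> h}"
    and P: "P \<subseteq> A \<union> B" "card P = 2" "card (A \<union> B - P) = 2" "P \<noteq> A" "P \<noteq> B"
    and \<Gamma>': "\<Gamma>' = \<Gamma>\<lparr>att := \<lambda>x. if x \<in> P then u else if x \<in> A \<union> B then v else att \<Gamma> x\<rparr>"
    using w unfolding whitehead_move_def by blast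
  have uv_in: "u \<in> verts \<Gamma>" "v \<in> verts \<Gamma>" using h u v M by auto
  have hu: "h \<in> halves_at \<Gamma> u" "flip \<Gamma> h \<in> halves_at \<Gamma> v"
    using h u v M by (auto simp: halves_at_def)
  have fin: "finite (halves_at \<Gamma> t)" for t using M(2) by (auto simp: halves_at_def)
  have cA: "card A = 2" "card B = 2"
    using r uv_in hu fin A B by (auto simp: regular_def)
  have fA: "finite A" "finite B" using A B fin by auto
  have AB: "A \<inter> B = {}" "h \<notin> A \<union> B" "flip \<Gamma> h \<notin> A \<union> B"
    using A B uv u v by (auto simp: halves_at_def)
  have att_A: "x \<in> A \<Longrightarrow> att \<Gamma> x = u \<and> x \<in> halves \<Gamma>" and att_B: "x \<in> B \<Longrightarrow> att \<Gamma> x = v \<and> x \<in> halves \<Gamma>" for x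
    using A B by (auto simp: halves_at_def)
  show "multigraph \<Gamma>'" using m uv_in unfolding multigraph_def \<Gamma>' by auto
  have att': "att \<Gamma>' x = (if x \<in> P then u else if x \<in> A \<union> B then v else att \<Gamma> x)" for x by (simp add: \<Gamma>')
  have mem: "x \<in> halves_at \<Gamma>' t \<longleftrightarrow> x \<in> halves \<Gamma> \<and> att \<Gamma>' x = t" for x t
    by (simp add: halves_at_def \<Gamma>')
  have old: "x \<in> halves \<Gamma> \<and> att \<Gamma> x = t \<longleftrightarrow> x \<in> halves_at \<Gamma> t" for x t by (simp add: halves_at_def)
  have old_uv: "halves_at \<Gamma> u = insert h A" "halves_at \<Gamma> v = insert (flip \<Gamma> h) B" using A B hu by auto
  have in_halves: "x \<in> A \<union> B \<Longrightarrow> x \<in> halves \<Gamma>" for x using att_A att_B by blast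
  have Hu: "halves_at \<Gamma>' u = insert h P"
  proof (rule set_eqI)
    fix x show "x \<in> halves_at \<Gamma>' u \<longleftrightarrow> x \<in> insert h P"
    proof (cases "x \<in> A \<union> B")
      case True
      then show ?thesis using mem[of x u] att'[of x] in_halves uv AB(2) by auto
    next
      case False
      then show ?thesis using mem[of x u] att'[of x] old[of x u] old_uv(1) P(1) by auto
    qed
  qed
  have Hv: "halves_at \<Gamma>' v = insert (flip \<Gamma> h) (A \<union> B - P)"
  proof (rule set_eqI)
    fix x show "x \<in> halves_at \<Gamma>' v \<longleftrightarrow> x \<in> insert (flip \<Gamma> h) (A \<union> B - P)"
    proof (cases "x \<in> A \<union> B")
      case True
      then have "x \<noteq> flip \<Gamma> h" using AB(3) by auto
      then show ?thesis using True mem[of x v] att'[of x] in_halves uv by auto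
    next
      case False
      then show ?thesis using mem[of x v] att'[of x] old[of x v] old_uv(2) P(1) by auto
    qed
  qed
  have Ho: "halves_at \<Gamma>' t = halves_at \<Gamma> t" if t: "t \<noteq> u" "t \<noteq> v" for t
  proof (rule set_eqI)
    fix x show "x \<in> halves_at \<Gamma>' t \<longleftrightarrow> x \<in> halves_at \<Gamma> t"
    proof (cases "x \<in> A \<union> B")
      case True
      then have "att \<Gamma> x \<noteq> t" using att_A[of x] att_B[of x] t by auto
      then show ?thesis using True mem[of x t] att'[of x] old[of x t] t by auto
    next
      case False
      then show ?thesis using mem[of x t] att'[of x] old[of x t] P(1) by auto
    qed
  qed
  have fP: "finite P" using P(1) fA finite_subset by blast
  have "card (halves_at \<Gamma>' t) = 3" if "t \<in> verts \<Gamma>" for t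
  proof -
    consider "t = u" | "t = v" | "t \<noteq> u" "t \<noteq> v" by blast
    then show ?thesis
    proof cases
      case 1
      then show ?thesis using Hu P(1,2) AB fP by (auto simp: card_insert_if)
    next
      case 2
      then show ?thesis using Hv P(3) AB fA by (auto simp: card_insert_if)
    next
      case 3
      then show ?thesis using Ho that r by (auto simp: regular_def)
    qed
  qed
  then show "regular 3 \<Gamma>'" unfolding regular_def \<Gamma>' by simp
  have A': "halves_at \<Gamma>' u - {h} = P" and B': "halves_at \<Gamma>' v - {flip \<Gamma> h} = A \<union> B - P"
    using Hu Hv AB P(1) by auto
  have U: "P \<union> (A \<union> B - P) = A \<union> B" using P(1) by auto
  have C: "A \<union> B - A = B" using AB by auto
  have ne: "A \<noteq> P" "A \<noteq> A \<union> B - P"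
  proof -
    show "A \<noteq> P" using P by auto
    show "A \<noteq> A \<union> B - P"
    proof
      assume "A = A \<union> B - P"
      then have "P = B" using AB P(1) cA P(2) fA card_subset_eq[of B P] by blast
      then show False using P by simp
    qed
  qed
  have "\<Gamma> = \<Gamma>'\<lparr>att := \<lambda>x. if x \<in> A then u else if x \<in> A \<union> B then v else att \<Gamma>' x\<rparr>"
  proof -
    have "(\<lambda>x. if x \<in> A then u else if x \<in> A \<union> B then v else att \<Gamma>' x) = att \<Gamma>"
      using att_A att_B P(1) att' by (intro ext) (metis UnE UnCI subsetD)
    then show ?thesis unfolding \<Gamma>' by simp
  qed
  then have 1: "\<Gamma> = \<Gamma>'\<lparr>att := \<lambda>x. if x \<in> A then u else if x \<in> P \<union> (A \<union> B - P) then v else att \<Gamma>' x\<rparr>"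
    unfolding U .
  have fl: "flip \<Gamma>' = flip \<Gamma>" "halves \<Gamma>' = halves \<Gamma>" by (simp_all add: \<Gamma>')
  have 2: "e = {h, flip \<Gamma>' h}" "u = att \<Gamma>' h" "v = att \<Gamma>' (flip \<Gamma>' h)" "h \<in> halves \<Gamma>'"
    using AB P(1) e h u v att'[of h] att'[of "flip \<Gamma> h"] unfolding fl by auto
  have 3: "P = halves_at \<Gamma>' u - {h}" "A \<union> B - P = halves_at \<Gamma>' v - {flip \<Gamma>' h}"
    using A' B' unfolding fl by auto
  have 4: "A \<subseteq> P \<union> (A \<union> B - P)" "card A = 2" "card (P \<union> (A \<union> B - P) - A) = 2"
    unfolding U C using cA by auto
  show "whitehead_move \<Gamma>' e \<Gamma>"
    unfolding whitehead_move_def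
    by (rule bexI[of _ h], rule exI[of _ u], rule exI[of _ v], rule exI[of _ P],
        rule exI[of _ "A \<union> B - P"], rule exI[of _ A], intro conjI) (fact 1 2 3 4 ne uv)+
qed

section \<open>Compositions of moves on disjoint edges\<close>

definition disjoint_ends :: "mgraph \<Rightarrow> nat set list \<Rightarrow> bool" where
  "disjoint_ends \<Gamma> es \<longleftrightarrow> (\<forall>e\<in>set es. \<forall>f\<in>set es. e \<noteq> f \<longrightarrow> ends \<Gamma> e \<inter> ends \<Gamma> f = {})"

text \<open>The moves are performed one after another, but a move on \<open>e\<close> does not touch
  the ends of an edge disjoint from \<open>e\<close>. So all ends can be computed in the initial
  graph, and a half-edge shifts at most across one edge.\<close>

lemma whitehead_moves_local:
  assumes "whitehead_moves \<Gamma> es \<Gamma>'" "distinct es" "disjoint_ends \<Gamma> es"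
  shows "verts \<Gamma>' = verts \<Gamma> \<and> halves \<Gamma>' = halves \<Gamma> \<and> flip \<Gamma>' = flip \<Gamma> \<and>
    (\<forall>x. att \<Gamma>' x = att \<Gamma> x \<or> (\<exists>e\<in>set es. att \<Gamma> x \<in> ends \<Gamma> e \<and> att \<Gamma>' x \<in> ends \<Gamma> e)) \<and>
    (\<forall>e\<in>set es. ends \<Gamma>' e = ends \<Gamma> e)"
  using assms
proof (induction rule: whitehead_moves.induct)
  case (Cons \<Gamma> e \<Gamma>1 es \<Gamma>')
  note L = whitehead_move_local[OF Cons.hyps(1)]
  have e: "ends \<Gamma>1 e = ends \<Gamma> e" using L(5) by (auto simp: ends_def)
  have f: "ends \<Gamma>1 f = ends \<Gamma> f" if "f \<in> set es" for f
  proof -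
    have "ends \<Gamma> e \<inter> ends \<Gamma> f = {}" using that Cons.prems by (auto simp: disjoint_ends_def)
    then have "att \<Gamma>1 x = att \<Gamma> x" if "x \<in> f" for x using L(4)[of x] that by (auto simp: ends_def)
    then show ?thesis by (auto simp: ends_def)
  qed
  have dis: "disjoint_ends \<Gamma>1 (e # es)"
    using Cons.prems(2) e f by (auto simp: disjoint_ends_def)
  then have "disjoint_ends \<Gamma>1 es" by (auto simp: disjoint_ends_def)
  note IH = Cons.IH[OF _ this]
  have I: "verts \<Gamma>' = verts \<Gamma>1" "halves \<Gamma>' = halves \<Gamma>1" "flip \<Gamma>' = flip \<Gamma>1"
    and I4: "\<And>x. att \<Gamma>' x = att \<Gamma>1 x \<or> (\<exists>f\<in>set es. att \<Gamma>1 x \<in> ends \<Gamma>1 f \<and> att \<Gamma>' x \<in> ends \<Gamma>1 f)"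
    and I5: "\<And>f. f \<in> set es \<Longrightarrow> ends \<Gamma>' f = ends \<Gamma>1 f"
    using IH Cons.prems(1) by auto
  have "ends \<Gamma> e \<inter> ends \<Gamma> f = {}" if "f \<in> set es" for f
    using that Cons.prems by (auto simp: disjoint_ends_def)
  note ef = this
  have 4: "att \<Gamma>' x = att \<Gamma> x \<or> (\<exists>e\<in>set (e # es). att \<Gamma> x \<in> ends \<Gamma> e \<and> att \<Gamma>' x \<in> ends \<Gamma> e)" for x
    using L(4)[of x] I4[of x] f ef by auto
  have "att \<Gamma>' x = att \<Gamma>1 x" if "x \<in> e" for x
  proof -
    have "att \<Gamma>1 x \<in> ends \<Gamma> e" using that e by (auto simp: ends_def)
    then show ?thesis using I4[of x] f ef by auto
  qed
  then have "ends \<Gamma>' e = ends \<Gamma>1 e" by (auto simp: ends_def)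
  then show ?case using L(1-3) I I5 4 e f by auto
qed auto

lemma whitehead_moves_append:
  "whitehead_moves \<Gamma> es \<Gamma>1 \<Longrightarrow> whitehead_moves \<Gamma>1 fs \<Gamma>2 \<Longrightarrow> whitehead_moves \<Gamma> (es @ fs) \<Gamma>2"
  by (induction rule: whitehead_moves.induct) (auto intro: whitehead_moves.intros)

lemma whitehead_moves_rev:
  "whitehead_moves \<Gamma> es \<Gamma>' \<Longrightarrow> multigraph \<Gamma> \<Longrightarrow> regular 3 \<Gamma> \<Longrightarrow> whitehead_moves \<Gamma>' (rev es) \<Gamma>"
proof (induction rule: whitehead_moves.induct)
  case (Cons \<Gamma> e \<Gamma>1 es \<Gamma>')
  note W = whitehead_move_cubic[OF Cons.prems Cons.hyps(1)]
  have "whitehead_moves \<Gamma>1 [e] \<Gamma>" using W(3) by (auto intro: whitehead_moves.intros)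
  then show ?case using Cons.IH[OF W(1,2)] whitehead_moves_append by auto
qed (auto intro: whitehead_moves.intros)

lemma edges_cong: "halves \<Gamma>' = halves \<Gamma> \<Longrightarrow> flip \<Gamma>' = flip \<Gamma> \<Longrightarrow> edges \<Gamma>' = edges \<Gamma>"
  by (simp add: edges_def)

lemma simultaneous_move_alt:
  "simultaneous_move \<Gamma> \<Gamma>' \<longleftrightarrow>
    (\<exists>es. distinct es \<and> set es \<subseteq> edges \<Gamma> \<and> disjoint_ends \<Gamma> es \<and> whitehead_moves \<Gamma> es \<Gamma>')"
  by (simp add: simultaneous_move_def disjoint_ends_def)

lemma simultaneous_move_sym:
  assumes "multigraph \<Gamma>" "regular 3 \<Gamma>" "simultaneous_move \<Gamma> \<Gamma>'"
  shows "simultaneous_move \<Gamma>' \<Gamma>"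
proof -
  obtain es where es: "distinct es" "set es \<subseteq> edges \<Gamma>" "disjoint_ends \<Gamma> es" "whitehead_moves \<Gamma> es \<Gamma>'"
    using assms(3) by (auto simp: simultaneous_move_alt)
  note L = whitehead_moves_local[OF es(4,1,3)]
  have "disjoint_ends \<Gamma>' (rev es)" using es(3) L by (simp add: disjoint_ends_def)
  moreover have "set (rev es) \<subseteq> edges \<Gamma>'" using es(2) L edges_cong[of \<Gamma>' \<Gamma>] by simp
  ultimately show ?thesis using whitehead_moves_rev[OF es(4) assms(1,2)] es(1)
    unfolding simultaneous_move_alt by (intro exI[of _ "rev es"]) simp
qed

lemma simul_rel_sym: "(X, Y) \<in> simul_rel g \<Longrightarrow> (Y, X) \<in> simul_rel g"
proof -
  assume "(X, Y) \<in> simul_rel g"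
  then obtain \<Gamma> \<Gamma>' where *: "X \<in> Graph g" "Y \<in> Graph g" "\<Gamma> \<in> X" "\<Gamma>' \<in> Y" "simultaneous_move \<Gamma> \<Gamma>'"
    by (auto simp: simul_rel_def)
  then have "simultaneous_move \<Gamma>' \<Gamma>"
    using simultaneous_move_sym Graph_memD(1)[OF *(1,3)] by (auto simp: cubic_graphs_iff)
  then show ?thesis using * by (auto simp: simul_rel_def)
qed

lemma relpow_Un_Id: "(s, t) \<in> (R \<union> Id) ^^ n \<Longrightarrow> \<exists>k\<le>n. (s, t) \<in> R ^^ k"
proof (induction n arbitrary: t)
  case (Suc n)
  then obtain r where r: "(s, r) \<in> (R \<union> Id) ^^ n" "(r, t) \<in> R \<union> Id" by auto
  then obtain k where k: "k \<le> n" "(s, r) \<in> R ^^ k" using Suc.IH by blast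
  show ?case
  proof (cases "r = t")
    case True
    then show ?thesis using k by (auto intro: exI[of _ k])
  next
    case False
    then have "(s, t) \<in> R ^^ Suc k" using k r by auto
    then show ?thesis using k by blast
  qed
qed auto

text \<open>Each half-edge stays where it is or shifts across one edge of \<Gamma>. An edge of
  \<Gamma>' thus becomes a walk of at most three steps in \<Gamma>: to the old attachment of its
  first half, along the old edge, to the new attachment of its second half. The \<open>Id\<close> in
  \<open>?R\<close> covers the steps that stay in place.\<close>

lemma simultaneous_move_diam:
  assumes "multigraph \<Gamma>" "simultaneous_move \<Gamma> \<Gamma>'" "diam_le \<Gamma>' D"
  shows "diam_le \<Gamma> (3 * D)"
proof -
  let ?R = "adj \<Gamma> \<union> Id"
  obtain es where es: "distinct es" "set es \<subseteq> edges \<Gamma>" "disjoint_ends \<Gamma> es" "whitehead_moves \<Gamma> es \<Gamma>'"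
    using assms(2) by (auto simp: simultaneous_move_alt)
  note L = whitehead_moves_local[OF es(4,1,3)]
  have sym: "(s, t) \<in> ?R \<Longrightarrow> (t, s) \<in> ?R" for s t using adj_sym[OF assms(1)] by auto
  have end_R: "(s, t) \<in> ?R" if st: "s \<in> ends \<Gamma> e" "t \<in> ends \<Gamma> e" and e: "e \<in> edges \<Gamma>" for s t e
  proof -
    obtain h where h: "h \<in> halves \<Gamma>" "e = {h, flip \<Gamma> h}" using e by (auto simp: edges_def)
    then have "(att \<Gamma> h, att \<Gamma> (flip \<Gamma> h)) \<in> adj \<Gamma>" by (auto simp: adj_def)
    then show ?thesis using st h sym by (auto simp: ends_def)
  qed
  have R: "(att \<Gamma> x, att \<Gamma>' x) \<in> ?R" for x
  proof -
    have "att \<Gamma>' x = att \<Gamma> x \<or> (\<exists>e\<in>set es. att \<Gamma> x \<in> ends \<Gamma> e \<and> att \<Gamma>' x \<in> ends \<Gamma> e)"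
      using L by blast
    then show ?thesis using end_R es(2) by auto
  qed
  have "(s, t) \<in> ?R ^^ 3" if st: "(s, t) \<in> adj \<Gamma>'" for s t
  proof -
    obtain h where "h \<in> halves \<Gamma>'" "s = att \<Gamma>' h" "t = att \<Gamma>' (flip \<Gamma>' h)"
      using st unfolding adj_def by blast
    then have h: "h \<in> halves \<Gamma>" "s = att \<Gamma>' h" "t = att \<Gamma>' (flip \<Gamma> h)" using L by simp_all
    have "(s, att \<Gamma> h) \<in> ?R" "(att \<Gamma> h, att \<Gamma> (flip \<Gamma> h)) \<in> ?R" "(att \<Gamma> (flip \<Gamma> h), t) \<in> ?R"
      using R sym h by (auto simp: adj_def)
    then show ?thesis unfolding numeral_3_eq_3 by auto
  qed
  then have "adj \<Gamma>' \<subseteq> ?R ^^ 3" by auto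
  then have sub: "adj \<Gamma>' ^^ k \<subseteq> ?R ^^ (3 * k)" for k
  proof (induction k)
    case (Suc k)
    have "adj \<Gamma>' ^^ Suc k \<subseteq> ?R ^^ (3 * k) O ?R ^^ 3" using Suc \<open>adj \<Gamma>' \<subseteq> ?R ^^ 3\<close> by auto
    then show ?case by (simp add: relpow_add[symmetric] add.commute)
  qed simp
  show ?thesis unfolding diam_le_def
  proof (intro ballI)
    fix u v assume "u \<in> verts \<Gamma>" "v \<in> verts \<Gamma>"
    then obtain k where k: "k \<le> D" "(u, v) \<in> adj \<Gamma>' ^^ k" using assms(3) L unfolding diam_le_def by blast
    then obtain j where "j \<le> 3 * k" "(u, v) \<in> adj \<Gamma> ^^ j" using relpow_Un_Id[OF subsetD[OF sub[of k] k(2)]] by auto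
    then show "\<exists>j\<le>3 * D. (u, v) \<in> adj \<Gamma> ^^ j" using k(1) by (intro exI[of _ j]) simp
  qed
qed

lemma simul_relpow_diam:
  assumes "(X, Y) \<in> simul_rel g ^^ n" "X \<in> Graph g" "\<Gamma>' \<in> Y" "diam_le \<Gamma>' D" "\<Gamma> \<in> X"
  shows "diam_le \<Gamma> (3 ^ n * D)"
  using assms(1,2,5)
proof (induction n arbitrary: X \<Gamma>)
  case 0
  then have "multigraph \<Gamma>'" "iso_class \<Gamma>' = iso_class \<Gamma>" "multigraph \<Gamma>"
    using Graph_memD[of X g] assms(3) by (auto simp: cubic_graphs_iff)
  then have "isomorphic \<Gamma>' \<Gamma>" using in_iso_class[of \<Gamma>] by (auto simp: iso_class_def iso_rel_def)
  then show ?case using diam_le_iso[OF \<open>multigraph \<Gamma>'\<close>] assms(4) by simp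
next
  case (Suc n)
  then obtain Z where Z: "(X, Z) \<in> simul_rel g" "(Z, Y) \<in> simul_rel g ^^ n"
    using Suc.prems(1) relpow_Suc_D2[of X Y n] by blast
  then obtain \<Gamma>1 \<Gamma>2 where *: "Z \<in> Graph g" "\<Gamma>1 \<in> X" "\<Gamma>2 \<in> Z" "simultaneous_move \<Gamma>1 \<Gamma>2"
    by (auto simp: simul_rel_def)
  have m: "multigraph \<Gamma>1" "iso_class \<Gamma>1 = iso_class \<Gamma>" "multigraph \<Gamma>"
    using Graph_memD[OF Suc.prems(2)] *(2) Suc.prems(3) by (auto simp: cubic_graphs_iff)
  have "diam_le \<Gamma>1 (3 * (3 ^ n * D))"
    using simultaneous_move_diam[OF m(1) *(4) Suc.IH[OF Z(2) *(1,3)]] .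
  moreover have "isomorphic \<Gamma>1 \<Gamma>" using m in_iso_class[of \<Gamma>] by (auto simp: iso_class_def iso_rel_def)
  ultimately show ?case using diam_le_iso[OF m(1)] by (simp add: mult.assoc)
qed

text \<open>Recording a vertex set that contains the ends of all moved edges allows moves in
  disjoint subtrees to be fused into a single simultaneous move.\<close>

definition moves_in :: "nat set \<Rightarrow> mgraph \<Rightarrow> mgraph \<Rightarrow> bool" where
  "moves_in V \<Gamma> \<Gamma>' \<longleftrightarrow> (\<exists>es. distinct es \<and> set es \<subseteq> edges \<Gamma> \<and> disjoint_ends \<Gamma> es \<and>
     whitehead_moves \<Gamma> es \<Gamma>' \<and> (\<forall>e\<in>set es. ends \<Gamma> e \<subseteq> V))"

lemma moves_in_simultaneous: "moves_in V \<Gamma> \<Gamma>' \<Longrightarrow> simultaneous_move \<Gamma> \<Gamma>'"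
  by (auto simp: moves_in_def simultaneous_move_alt)

lemma moves_in_refl: "moves_in V \<Gamma> \<Gamma>"
  unfolding moves_in_def by (intro exI[of _ "[]"]) (auto simp: disjoint_ends_def intro: whitehead_moves.intros)

lemma moves_in_local:
  assumes "moves_in V \<Gamma> \<Gamma>'"
  shows "verts \<Gamma>' = verts \<Gamma>" "halves \<Gamma>' = halves \<Gamma>" "flip \<Gamma>' = flip \<Gamma>"
    "att \<Gamma>' x = att \<Gamma> x \<or> att \<Gamma> x \<in> V \<and> att \<Gamma>' x \<in> V"
proof -
  obtain es where es: "distinct es" "disjoint_ends \<Gamma> es" "whitehead_moves \<Gamma> es \<Gamma>'" "\<forall>e\<in>set es. ends \<Gamma> e \<subseteq> V"
    using assms by (auto simp: moves_in_def)
  show "verts \<Gamma>' = verts \<Gamma>" "halves \<Gamma>' = halves \<Gamma>" "flip \<Gamma>' = flip \<Gamma>"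
    "att \<Gamma>' x = att \<Gamma> x \<or> att \<Gamma> x \<in> V \<and> att \<Gamma>' x \<in> V"
    using whitehead_moves_local[OF es(3,1,2)] es(4) by blast+
qed

lemma moves_in_halves_at: "moves_in V \<Gamma> \<Gamma>' \<Longrightarrow> v \<notin> V \<Longrightarrow> halves_at \<Gamma>' v = halves_at \<Gamma> v"
  unfolding halves_at_def using moves_in_local[of V \<Gamma> \<Gamma>'] by metis

lemma moves_in_mono: "moves_in V \<Gamma> \<Gamma>' \<Longrightarrow> V \<subseteq> W \<Longrightarrow> moves_in W \<Gamma> \<Gamma>'"
  unfolding moves_in_def by blast

text \<open>The second batch has its ends in \<open>W\<close>, where the first batch changes
  nothing, so these ends are the same in \<Gamma> and in \<Gamma>1. Hence edges of different batches
  share no vertex, and the concatenated list is one simultaneous move.\<close>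

lemma moves_in_trans:
  assumes "moves_in V \<Gamma> \<Gamma>1" "moves_in W \<Gamma>1 \<Gamma>2" "V \<inter> W = {}"
  shows "moves_in (V \<union> W) \<Gamma> \<Gamma>2"
proof -
  note L = moves_in_local[OF assms(1)]
  obtain es where es: "distinct es" "set es \<subseteq> edges \<Gamma>" "disjoint_ends \<Gamma> es" "whitehead_moves \<Gamma> es \<Gamma>1"
    "\<forall>e\<in>set es. ends \<Gamma> e \<subseteq> V" using assms(1) by (auto simp: moves_in_def)
  obtain fs where fs: "distinct fs" "set fs \<subseteq> edges \<Gamma>" "disjoint_ends \<Gamma>1 fs" "whitehead_moves \<Gamma>1 fs \<Gamma>2"
    "\<forall>e\<in>set fs. ends \<Gamma>1 e \<subseteq> W" using assms(2) edges_cong[OF L(2,3)] by (auto simp: moves_in_def)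
  have f: "ends \<Gamma> f = ends \<Gamma>1 f" if "f \<in> set fs" for f
  proof -
    have "att \<Gamma>1 x = att \<Gamma> x" if "x \<in> f" for x
    proof -
      have "att \<Gamma>1 x \<in> W" using that fs(5) \<open>f \<in> set fs\<close> by (auto simp: ends_def)
      then show ?thesis using L(4)[of x] assms(3) by auto
    qed
    then show ?thesis by (auto simp: ends_def)
  qed
  have ne: "ends \<Gamma> e \<noteq> {}" if "e \<in> edges \<Gamma>" for e using that by (auto simp: ends_def edges_def)
  have "set es \<inter> set fs = {}"
  proof -
    have False if "e \<in> set es" "e \<in> set fs" for e
      using that ne[of e] es(2,5) fs(5) f[of e] assms(3) by blast
    then show ?thesis by blast
  qed
  then have "distinct (es @ fs)" using es(1) fs(1) by simp
  moreover have "disjoint_ends \<Gamma> (es @ fs)"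
  proof -
    have "ends \<Gamma> e \<inter> ends \<Gamma> e' = {}" if "e \<in> set es" "e' \<in> set fs" for e e'
      using that es(5) fs(5) f assms(3) by blast
    note cross = this
    show ?thesis unfolding disjoint_ends_def
    proof (intro ballI impI)
      fix e e' assume "e \<in> set (es @ fs)" "e' \<in> set (es @ fs)" and ne: "e \<noteq> e'"
      then consider "e \<in> set es" "e' \<in> set es" | "e \<in> set es" "e' \<in> set fs"
        | "e \<in> set fs" "e' \<in> set es" | "e \<in> set fs" "e' \<in> set fs" by auto
      then show "ends \<Gamma> e \<inter> ends \<Gamma> e' = {}"
      proof cases
        case 1
        then show ?thesis using es(3) ne unfolding disjoint_ends_def by blast
      next
        case 2
        then show ?thesis by (rule cross)
      next
        case 3
        then show ?thesis using cross[of e' e] by blast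
      next
        case 4
        then show ?thesis using fs(3) ne f[of e] f[of e'] unfolding disjoint_ends_def by blast
      qed
    qed
  qed
  moreover have "set (es @ fs) \<subseteq> edges \<Gamma>" using es(2) fs(2) by simp
  moreover have "\<forall>e\<in>set (es @ fs). ends \<Gamma> e \<subseteq> V \<union> W"
    using es(5) fs(5) f unfolding set_append by blast
  ultimately show ?thesis unfolding moves_in_def
    using whitehead_moves_append[OF es(4) fs(4)] by blast
qed

lemma moves_in_exchange:
  assumes h: "h \<in> halves \<Gamma>" and uv: "att \<Gamma> h = u" "att \<Gamma> (flip \<Gamma> h) = v" "u \<noteq> v"
    and u: "halves_at \<Gamma> u = {h, x, y}" "card {h, x, y} = 3"
    and v: "halves_at \<Gamma> v = {flip \<Gamma> h, z, w}" "card {flip \<Gamma> h, z, w} = 3"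
  shows "moves_in {u, v} \<Gamma> (exchange \<Gamma> y z)"
    and "halves_at (exchange \<Gamma> y z) u = {h, x, z}" "halves_at (exchange \<Gamma> y z) v = {flip \<Gamma> h, y, w}"
proof -
  show "moves_in {u, v} \<Gamma> (exchange \<Gamma> y z)"
    unfolding moves_in_def using whitehead_move_exchange[OF assms] h uv
    by (intro exI[of _ "[{h, flip \<Gamma> h}]"])
       (auto simp: disjoint_ends_def edges_def ends_def intro: whitehead_moves.intros)
  have d: "h \<noteq> x" "h \<noteq> y" "x \<noteq> y" "flip \<Gamma> h \<noteq> z" "flip \<Gamma> h \<noteq> w" "z \<noteq> w"
    using u(2) v(2) by (auto simp: card_insert_if split: if_splits)
  have at: "att \<Gamma> x = u" "att \<Gamma> y = u" "att \<Gamma> z = v" "att \<Gamma> w = v" "y \<in> halves \<Gamma>" "z \<in> halves \<Gamma>"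
    using u(1) v(1) by (auto simp: halves_at_def)
  have "halves_at (exchange \<Gamma> y z) u = insert z (halves_at \<Gamma> u - {y})"
    "halves_at (exchange \<Gamma> y z) v = insert y (halves_at \<Gamma> v - {z})"
    using at uv by (auto simp: halves_at_def exchange_def)
  then show "halves_at (exchange \<Gamma> y z) u = {h, x, z}" "halves_at (exchange \<Gamma> y z) v = {flip \<Gamma> h, y, w}"
    using u(1) v(1) d by auto
qed

section \<open>Sorting the leaves of a binary tree\<close>

datatype ktree = Lf nat | Br ktree ktree

fun keys :: "ktree \<Rightarrow> nat set" where
  "keys (Lf x) = {x}"
| "keys (Br a b) = keys a \<union> keys b"

fun ht :: "ktree \<Rightarrow> nat" where
  "ht (Lf x) = 0"
| "ht (Br a b) = Suc (max (ht a) (ht b))"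

fun disjoint_keys :: "ktree \<Rightarrow> bool" where
  "disjoint_keys (Lf x) \<longleftrightarrow> True"
| "disjoint_keys (Br a b) \<longleftrightarrow> keys a \<inter> keys b = {} \<and> disjoint_keys a \<and> disjoint_keys b"

text \<open>The tree version of one simultaneous move. After a rotation the recursion continues in
  the subtrees below both ends of the rotated edge, so the rotated edges are pairwise disjoint.
  Exchanging the two children of a node is free, because the graph does not see their order; this
  accounts for the mirrored variants.\<close>

inductive par :: "ktree \<Rightarrow> ktree \<Rightarrow> bool" where
  Lf: "par (Lf x) (Lf x)"
| Br: "par a a' \<Longrightarrow> par b b' \<Longrightarrow> par (Br a b) (Br a' b')"
| swap: "par a a' \<Longrightarrow> par b b' \<Longrightarrow> par (Br a b) (Br b' a')"
| rot: "par a a' \<Longrightarrow> par b b' \<Longrightarrow> par c c' \<Longrightarrow> par (Br (Br a b) c) (Br (Br a' c') b')"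
| rot_swap: "par a a' \<Longrightarrow> par b b' \<Longrightarrow> par c c' \<Longrightarrow> par (Br (Br a b) c) (Br b' (Br a' c'))"
| rot_right: "par a a' \<Longrightarrow> par b b' \<Longrightarrow> par c c' \<Longrightarrow> par (Br a (Br b c)) (Br c' (Br b' a'))"

lemma par_refl: "par t t"
  by (induction t) (auto intro: par.intros)

text \<open>A round has three steps because regrouping the four subtrees in a merge takes three
  rotations (\<open>par3_exchange\<close>). Simpler rearrangements fill the round with steps that
  act in the subtrees only, so every subtree always advances by a full round.\<close>

definition par3 :: "ktree \<Rightarrow> ktree \<Rightarrow> bool" where
  "par3 s t \<longleftrightarrow> (\<exists>u v. par s u \<and> par u v \<and> par v t)"

lemma par3_relpowp: "par3 s t \<Longrightarrow> (par ^^ 3) s t"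
  unfolding par3_def numeral_3_eq_3 by (auto simp: OO_def)

lemma par3_refl: "par3 t t"
  using par_refl by (auto simp: par3_def)

lemma par3_Br: "par3 a a' \<Longrightarrow> par3 b b' \<Longrightarrow> par3 (Br a b) (Br a' b')"
  unfolding par3_def by (meson par.Br)

lemma par3_swap: "par3 a a' \<Longrightarrow> par3 b b' \<Longrightarrow> par3 (Br a b) (Br b' a')"
  unfolding par3_def by (meson par.Br par.swap)

lemma par3_left: "par3 a a' \<Longrightarrow> par3 b b' \<Longrightarrow> par3 c c' \<Longrightarrow> par3 (Br (Br a b) c) (Br (Br a' c') b')"
  unfolding par3_def by (meson par.Br par.rot)

lemma par3_left2: "par3 a a' \<Longrightarrow> par3 b b' \<Longrightarrow> par3 c c' \<Longrightarrow> par3 (Br (Br a b) c) (Br a' (Br b' c'))"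
  unfolding par3_def by (meson par.Br par.swap par.rot_swap)

lemma par3_right: "par3 a a' \<Longrightarrow> par3 b b' \<Longrightarrow> par3 c c' \<Longrightarrow> par3 (Br c (Br a b)) (Br (Br a' c') b')"
  unfolding par3_def by (meson par.Br par.swap par.rot)

lemma par3_right2: "par3 a a' \<Longrightarrow> par3 b b' \<Longrightarrow> par3 c c' \<Longrightarrow> par3 (Br c (Br a b)) (Br a' (Br b' c'))"
  unfolding par3_def by (meson par.Br par.swap par.rot_swap)

lemma par3_exchange:
  assumes "par3 a a'" "par3 b b'" "par3 c c'" "par3 d d'"
  shows "par3 (Br (Br a b) (Br c d)) (Br (Br c' a') (Br d' b'))"
proof -
  obtain a1 a2 b1 b2 c1 c2 d1 d2 where
    p: "par a a1" "par a1 a2" "par a2 a'" "par b b1" "par b1 b2" "par b2 b'"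
       "par c c1" "par c1 c2" "par c2 c'" "par d d1" "par d1 d2" "par d2 d'"
    using assms by (auto simp: par3_def)
  \<comment> \<open>The three rotations exchange \<open>b\<close> with \<open>Br c d\<close>, then
    \<open>a\<close> with \<open>d\<close> inside the left subtree, then \<open>Br c a\<close> with
    \<open>b\<close>. Meanwhile each of the four subtrees makes its own three steps.\<close>
  have "par (Br (Br a b) (Br c d)) (Br (Br a1 (Br c1 d1)) b1)"
    by (rule par.rot[OF p(1,4) par.Br[OF p(7,10)]])
  moreover have "par (Br (Br a1 (Br c1 d1)) b1) (Br (Br d2 (Br c2 a2)) b2)"
    by (rule par.Br[OF par.rot_right[OF p(2,8,11)] p(5)])
  moreover have "par (Br (Br d2 (Br c2 a2)) b2) (Br (Br c' a') (Br d' b'))"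
    by (rule par.rot_swap[OF p(12) par.Br[OF p(9,3)] p(6)])
  ultimately show ?thesis by (auto simp: par3_def)
qed

section \<open>Tries of binary labels\<close>

definition agree :: "nat \<Rightarrow> nat set \<Rightarrow> bool" where
  "agree d A \<longleftrightarrow> (\<forall>x\<in>A. \<forall>y\<in>A. \<forall>i<d. bit x i = bit y i)"

text \<open>Bits are read from the least significant one: if \<open>A\<close> and \<open>B\<close>
  are nonempty, \<open>d\<close> is the first bit at which the keys differ.\<close>

definition splits :: "nat \<Rightarrow> nat set \<Rightarrow> nat set \<Rightarrow> bool" where
  "splits d A B \<longleftrightarrow> agree d (A \<union> B) \<and> (\<forall>x\<in>A. \<not> bit x d) \<and> (\<forall>x\<in>B. bit x d)"

lemma agreeD: "agree d A \<Longrightarrow> x \<in> A \<Longrightarrow> y \<in> A \<Longrightarrow> i < d \<Longrightarrow> bit x i = bit y i"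
  unfolding agree_def by blast

lemma agree_mono: "agree d A \<Longrightarrow> e \<le> d \<Longrightarrow> agree e A"
  unfolding agree_def by (meson order_less_le_trans)

lemma agree_subset: "agree d A \<Longrightarrow> B \<subseteq> A \<Longrightarrow> agree d B"
  unfolding agree_def by blast

lemma agree_Suc: "agree (Suc d) A \<longleftrightarrow> agree d A \<and> (\<exists>\<beta>. \<forall>x\<in>A. bit x d = \<beta>)"
proof -
  have "agree (Suc d) A \<longleftrightarrow> agree d A \<and> (\<forall>x\<in>A. \<forall>y\<in>A. bit x d = bit y d)"
    unfolding agree_def less_Suc_eq by blast
  then show ?thesis by blast
qed

lemma splitsI:
  assumes "agree d C" "A \<union> B \<subseteq> C" "\<forall>x\<in>A. \<not> bit x d" "\<forall>x\<in>B. bit x d"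
  shows "splits d A B" "agree (Suc d) A" "agree (Suc d) B"
proof -
  have "agree d (A \<union> B)" "agree d A" "agree d B"
    using assms(2) by (auto intro: agree_subset[OF assms(1)])
  then show "splits d A B" "agree (Suc d) A" "agree (Suc d) B"
    using assms(3,4) by (auto simp: splits_def agree_Suc)
qed

lemma splits_bits:
  assumes "splits d A B"
  shows "\<forall>x\<in>A. \<not> bit x d" "\<forall>x\<in>B. bit x d"
  using assms by (auto simp: splits_def)

text \<open>The compressed binary trie: bits shared by all keys of a subtree produce no node, so the
  splitting bits may jump along a branch.\<close>

fun trie :: "ktree \<Rightarrow> bool" where
  "trie (Lf x) \<longleftrightarrow> True"
| "trie (Br a b) \<longleftrightarrow> (\<exists>d. splits d (keys a) (keys b)) \<and> trie a \<and> trie b"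

lemma keys_nonempty [simp]: "keys t \<noteq> {}"
  by (induction t) auto

text \<open>For \<open>d < d'\<close> all keys would agree at bit \<open>d\<close>, although both
  \<open>A\<close> and \<open>B\<close> are inhabited and differ there. So the splitting bit, and
  with it both parts, is determined by the set of keys.\<close>

lemma splits_unique:
  assumes "splits d A B" "splits d' A' B'" "A \<union> B = A' \<union> B'"
    "A \<noteq> {}" "B \<noteq> {}" "A' \<noteq> {}" "B' \<noteq> {}"
  shows "A = A' \<and> B = B'"
proof -
  have "d = d'"
  proof (rule linorder_cases)
    assume "d < d'"
    then show ?thesis using assms unfolding splits_def agree_def by blast
  next
    assume "d' < d"
    then show ?thesis using assms unfolding splits_def agree_def by blast
  qed
  then show ?thesis using assms unfolding splits_def by blast
qed

lemma trie_unique: "trie s \<Longrightarrow> trie t \<Longrightarrow> keys s = keys t \<Longrightarrow> s = t"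
proof (induction s arbitrary: t)
  case (Lf x)
  then show ?case
  proof (cases t)
    case (Br a b)
    then obtain d where d: "splits d (keys a) (keys b)" using Lf.prems(2) by auto
    obtain y z where yz: "y \<in> keys a" "z \<in> keys b" using keys_nonempty by blast
    then have "y \<in> {x}" "z \<in> {x}" using Lf.prems(3) Br by auto
    then show ?thesis using splits_bits[OF d] yz by blast
  qed auto
next
  case (Br a b)
  then obtain d where d: "splits d (keys a) (keys b)" by auto
  show ?case
  proof (cases t)
    case (Lf x)
    obtain y z where yz: "y \<in> keys a" "z \<in> keys b" using keys_nonempty by blast
    then have "y \<in> {x}" "z \<in> {x}" using Br.prems(3) Lf by auto
    then show ?thesis using splits_bits[OF d] yz by blast
  next
    case t: (Br a' b')
    then obtain d' where "splits d' (keys a') (keys b')" using Br.prems by auto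
    then have "keys a = keys a' \<and> keys b = keys b'"
      using splits_unique[OF d] Br.prems(3) t by simp
    then have "a = a'" "b = b'" using Br.IH(1)[of a'] Br.IH(2)[of b'] Br.prems t by auto
    then show ?thesis using t by simp
  qed
qed

text \<open>
  A snapshot of the pipelined merge sort.  A node \<open>CS d\<close> is settled: it separates its keys by bit
  \<open>d\<close>.  At a node \<open>CM d\<close> two tries whose keys agree below bit \<open>d\<close> are still to be merged.
\<close>

datatype cfg = CL nat | CS nat cfg cfg | CM nat cfg cfg

fun forget :: "cfg \<Rightarrow> ktree" where
  "forget (CL x) = Lf x"
| "forget (CS d a b) = Br (forget a) (forget b)"
| "forget (CM d a b) = Br (forget a) (forget b)"

abbreviation ckeys :: "cfg \<Rightarrow> nat set" where
  "ckeys c \<equiv> keys (forget c)"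

text \<open>
  At time \<open>\<tau>\<close>, a configuration with parameter \<open>\<sigma>\<close> is on schedule: a node \<open>CM d\<close> is
  going to be split by bit \<open>d\<close> no later than at time \<open>d + \<sigma>\<close>, one round after its children.
\<close>

fun on_time :: "nat \<Rightarrow> nat \<Rightarrow> cfg \<Rightarrow> bool" where
  "on_time \<tau> \<sigma> (CL x) \<longleftrightarrow> True"
| "on_time \<tau> \<sigma> (CS d a b) \<longleftrightarrow> splits d (ckeys a) (ckeys b) \<and> on_time \<tau> \<sigma> a \<and> on_time \<tau> \<sigma> b"
| "on_time \<tau> \<sigma> (CM d a b) \<longleftrightarrow>
     agree d (ckeys a \<union> ckeys b) \<and> ckeys a \<inter> ckeys b = {} \<and> \<tau> < d + \<sigma> \<and> 0 < \<sigma> \<and>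
     on_time \<tau> (\<sigma> - 1) a \<and> on_time \<tau> (\<sigma> - 1) b"

lemma on_time_mono: "on_time \<tau> \<sigma> c \<Longrightarrow> \<sigma> \<le> \<sigma>' \<Longrightarrow> on_time \<tau> \<sigma>' c"
  by (induction c arbitrary: \<sigma> \<sigma>') (auto intro: diff_le_mono)

text \<open>The moment \<open>d + s\<close> is when the parent splits by bit \<open>d\<close>. A
  child \<open>CM e\<close> still pending then has \<open>d + s < e + s\<close>, so its keys agree
  at bit \<open>d\<close>. A settled child \<open>CS e\<close> cannot have \<open>e < d\<close>,
  because its keys agree below \<open>d\<close>; for \<open>e > d\<close> they agree at
  \<open>d\<close> as well, and \<open>e = d\<close> supplies the two parts. Top nodes are therefore
  all that has to be inspected.\<close>

lemma on_time_due:
  assumes "on_time (d + s) s c" "agree d (ckeys c)"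
  shows "(\<exists>a b. c = CS d a b) \<or> (\<exists>\<beta>. \<forall>x\<in>ckeys c. bit x d = \<beta>)"
proof (cases c)
  case (CL x)
  then show ?thesis by auto
next
  case (CS e a b)
  obtain y z where yz: "y \<in> ckeys a" "z \<in> ckeys b" using keys_nonempty by blast
  have sp: "splits e (ckeys a) (ckeys b)" using assms CS by simp
  have "\<not> e < d"
    using agreeD[OF assms(2), of y z e] yz splits_bits[OF sp] CS by auto
  then consider "e = d" | "Suc d \<le> e" by linarith
  then show ?thesis
  proof cases
    case 2
    then have "agree (Suc d) (ckeys c)" using sp CS by (auto simp: splits_def intro: agree_mono)
    then show ?thesis by (simp add: agree_Suc)
  qed (use CS in auto)
next
  case (CM e a b)
  then have "agree (Suc d) (ckeys c)" using assms by (auto intro: agree_mono)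
  then show ?thesis by (simp add: agree_Suc)
qed

text \<open>A merge waits until time \<open>d + s\<close> and then treats bit \<open>d\<close>:
  parts with equal bit are brought together and merged one level lower, starting from bit
  \<open>Suc d\<close>. The new merges sit below a \<open>CS\<close> node, which leaves the
  parameter unchanged, so \<sigma> never has to grow: it bounds the number of merges stacked on a
  branch, and pushing a merge down past settled nodes does not increase that number.\<close>

lemma round_exists:
  "on_time \<tau> \<sigma> c \<Longrightarrow> \<exists>c'. on_time (Suc \<tau>) \<sigma> c' \<and> par3 (forget c) (forget c') \<and> ckeys c' = ckeys c"
proof (induction "size c" arbitrary: c \<sigma> rule: less_induct)
  case less
  show ?case
  proof (cases c)
    case (CL x)
    then show ?thesis using par3_refl by (intro exI[of _ c]) auto
  next
    case (CS d a b)
    have "on_time \<tau> \<sigma> a" "on_time \<tau> \<sigma> b" using less.prems CS by auto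
    then obtain a' b' where "on_time (Suc \<tau>) \<sigma> a'" "par3 (forget a) (forget a')" "ckeys a' = ckeys a"
      "on_time (Suc \<tau>) \<sigma> b'" "par3 (forget b) (forget b')" "ckeys b' = ckeys b"
      using less.hyps[of a \<sigma>] less.hyps[of b \<sigma>] CS by auto
    then show ?thesis using less.prems CS
      by (intro exI[of _ "CS d a' b'"]) (auto intro: par3_Br)
  next
    case (CM d a b)
    define s where "s = \<sigma> - 1"
    have \<sigma>: "\<sigma> = Suc s" and le: "\<tau> \<le> d + s" and ot: "on_time \<tau> s a" "on_time \<tau> s b"
      and ag: "agree d (ckeys a \<union> ckeys b)" and dj: "ckeys a \<inter> ckeys b = {}"
      using less.prems CM by (auto simp: s_def)
    obtain a' b' where a': "on_time (Suc \<tau>) s a'" "par3 (forget a) (forget a')" "ckeys a' = ckeys a"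
      and b': "on_time (Suc \<tau>) s b'" "par3 (forget b) (forget b')" "ckeys b' = ckeys b"
      using less.hyps[of a s] less.hyps[of b s] CM ot by auto
    note up = on_time_mono[of "Suc \<tau>" s _ "Suc s"]
    show ?thesis
    proof (cases "\<tau> = d + s")
      case False
      then show ?thesis using a' b' le ag dj \<sigma> CM
        by (intro exI[of _ "CM d a' b'"]) (auto intro: par3_Br)
    next
      case True
      \<comment> \<open>A settled child is dissolved at this moment, and it is its two children that
        advance by a round; this is why the induction runs over the size.\<close>
      have parts: "\<exists>x0' x1'. on_time (Suc \<tau>) s x0' \<and> par3 (forget x0) (forget x0') \<and> ckeys x0' = ckeys x0 \<and>
          on_time (Suc \<tau>) s x1' \<and> par3 (forget x1) (forget x1') \<and> ckeys x1' = ckeys x1"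
        if "CS d x0 x1 = a \<or> CS d x0 x1 = b" for x0 x1
      proof -
        have "on_time \<tau> s (CS d x0 x1)" "size x0 < size c" "size x1 < size c" using that ot CM by auto
        then show ?thesis using less.hyps[of x0 s] less.hyps[of x1 s] by auto
      qed
      have "on_time (d + s) s a" "agree d (ckeys a)" "on_time (d + s) s b" "agree d (ckeys b)"
        using ot True by (auto intro: agree_subset[OF ag])
      note due = on_time_due[OF this(1,2)] on_time_due[OF this(3,4)]
      consider (1) a0 a1 b0 b1 where "a = CS d a0 a1" "b = CS d b0 b1"
        | (2) a0 a1 \<beta> where "a = CS d a0 a1" "\<forall>x\<in>ckeys b. bit x d = \<beta>"
        | (3) b0 b1 \<beta> where "b = CS d b0 b1" "\<forall>x\<in>ckeys a. bit x d = \<beta>"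
        | (4) \<alpha> \<beta> where "\<forall>x\<in>ckeys a. bit x d = \<alpha>" "\<forall>x\<in>ckeys b. bit x d = \<beta>"
        using due by blast
      then show ?thesis
      proof cases
        case 1
        obtain a0' a1' where A: "on_time (Suc \<tau>) s a0'" "par3 (forget a0) (forget a0')" "ckeys a0' = ckeys a0"
          "on_time (Suc \<tau>) s a1'" "par3 (forget a1) (forget a1')" "ckeys a1' = ckeys a1"
          using parts 1 by metis
        obtain b0' b1' where B: "on_time (Suc \<tau>) s b0'" "par3 (forget b0) (forget b0')" "ckeys b0' = ckeys b0"
          "on_time (Suc \<tau>) s b1'" "par3 (forget b1) (forget b1')" "ckeys b1' = ckeys b1"
          using parts 1 by metis
        have bits: "\<forall>x\<in>ckeys b0 \<union> ckeys a0. \<not> bit x d" "\<forall>x\<in>ckeys b1 \<union> ckeys a1. bit x d"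
          using ot 1 splits_bits by auto
        have "on_time (Suc \<tau>) \<sigma> (CS d (CM (Suc d) b0' a0') (CM (Suc d) b1' a1'))"
          using splitsI[OF ag _ bits] A B dj \<sigma> True unfolding 1 by auto
        moreover have "par3 (forget c) (Br (Br (forget b0') (forget a0')) (Br (forget b1') (forget a1')))"
          using par3_exchange[OF A(2,5) B(2,5)] 1 CM by simp
        ultimately show ?thesis using A B 1 CM
          by (intro exI[of _ "CS d (CM (Suc d) b0' a0') (CM (Suc d) b1' a1')"]) auto
      next
        case 2
        obtain a0' a1' where A: "on_time (Suc \<tau>) s a0'" "par3 (forget a0) (forget a0')" "ckeys a0' = ckeys a0"
          "on_time (Suc \<tau>) s a1'" "par3 (forget a1) (forget a1')" "ckeys a1' = ckeys a1"
          using parts 2 by metis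
        show ?thesis
        proof (cases \<beta>)
          case True
          have bits: "\<forall>x\<in>ckeys a0. \<not> bit x d" "\<forall>x\<in>ckeys a1 \<union> ckeys b. bit x d"
            using True ot 2 splits_bits by auto
          have "on_time (Suc \<tau>) \<sigma> (CS d a0' (CM (Suc d) a1' b'))"
            using splitsI[OF ag _ bits] A b' dj \<sigma> \<open>\<tau> = d + s\<close> up unfolding 2(1) by auto
          then show ?thesis using A b' 2 CM
            by (intro exI[of _ "CS d a0' (CM (Suc d) a1' b')"]) (auto intro: par3_left2)
        next
          case False
          have bits: "\<forall>x\<in>ckeys a0 \<union> ckeys b. \<not> bit x d" "\<forall>x\<in>ckeys a1. bit x d"
            using False ot 2 splits_bits by auto
          have "on_time (Suc \<tau>) \<sigma> (CS d (CM (Suc d) a0' b') a1')"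
            using splitsI[OF ag _ bits] A b' dj \<sigma> \<open>\<tau> = d + s\<close> up unfolding 2(1) by auto
          then show ?thesis using A b' 2 CM
            by (intro exI[of _ "CS d (CM (Suc d) a0' b') a1'"]) (auto intro: par3_left)
        qed
      next
        case 3
        obtain b0' b1' where B: "on_time (Suc \<tau>) s b0'" "par3 (forget b0) (forget b0')" "ckeys b0' = ckeys b0"
          "on_time (Suc \<tau>) s b1'" "par3 (forget b1) (forget b1')" "ckeys b1' = ckeys b1"
          using parts 3 by metis
        show ?thesis
        proof (cases \<beta>)
          case True
          have bits: "\<forall>x\<in>ckeys b0. \<not> bit x d" "\<forall>x\<in>ckeys b1 \<union> ckeys a. bit x d"
            using True ot 3 splits_bits by auto
          have "on_time (Suc \<tau>) \<sigma> (CS d b0' (CM (Suc d) b1' a'))"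
            using splitsI[OF ag _ bits] B a' dj \<sigma> \<open>\<tau> = d + s\<close> up unfolding 3(1) by auto
          then show ?thesis using B a' 3 CM
            by (intro exI[of _ "CS d b0' (CM (Suc d) b1' a')"]) (auto intro: par3_right2)
        next
          case False
          have bits: "\<forall>x\<in>ckeys b0 \<union> ckeys a. \<not> bit x d" "\<forall>x\<in>ckeys b1. bit x d"
            using False ot 3 splits_bits by auto
          have "on_time (Suc \<tau>) \<sigma> (CS d (CM (Suc d) b0' a') b1')"
            using splitsI[OF ag _ bits] B a' dj \<sigma> \<open>\<tau> = d + s\<close> up unfolding 3(1) by auto
          then show ?thesis using B a' 3 CM
            by (intro exI[of _ "CS d (CM (Suc d) b0' a') b1'"]) (auto intro: par3_right)
        qed
      next
        case 4
        consider "\<alpha> = \<beta>" | "\<not> \<alpha>" "\<beta>" | "\<alpha>" "\<not> \<beta>" by auto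
        then show ?thesis
        proof cases
          \<comment> \<open>Bit \<open>d\<close> does not separate any keys here, so the merge moves
            on to the next bit without changing the tree at this node.\<close>
          case 1
          then have "agree (Suc d) (ckeys a \<union> ckeys b)" using ag 4 by (auto simp: agree_Suc)
          then show ?thesis using a' b' dj \<sigma> le CM
            by (intro exI[of _ "CM (Suc d) a' b'"]) (auto intro: par3_Br)
        next
          case 2
          then show ?thesis using a' b' ag 4 up \<sigma> CM
            by (intro exI[of _ "CS d a' b'"]) (auto intro: par3_Br simp: splits_def)
        next
          case 3
          then show ?thesis using a' b' ag 4 up \<sigma> CM
            by (intro exI[of _ "CS d b' a'"]) (auto intro: par3_swap simp: splits_def Un_commute)
        qed
      qed
    qed
  qed
qed

fun initial :: "ktree \<Rightarrow> cfg" where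
  "initial (Lf x) = CL x"
| "initial (Br a b) = CM 0 (initial a) (initial b)"

lemma forget_initial [simp]: "forget (initial t) = t"
  by (induction t) auto

lemma on_time_initial: "disjoint_keys t \<Longrightarrow> ht t \<le> \<sigma> \<Longrightarrow> on_time 0 \<sigma> (initial t)"
  by (induction t arbitrary: \<sigma>) (auto simp: agree_def)

text \<open>A merge still pending at bit \<open>d\<close> would satisfy
  \<open>k + \<sigma> \<le> \<tau> < d + \<sigma>\<close>, so its keys would agree on the first
  \<open>k\<close> bits. Keys below \<open>2 ^ k\<close> would then coincide, contradicting the
  disjointness of its two sides.\<close>

lemma on_time_finished:
  "on_time \<tau> \<sigma> c \<Longrightarrow> k + \<sigma> \<le> \<tau> \<Longrightarrow> ckeys c \<subseteq> {..<2 ^ k} \<Longrightarrow> trie (forget c)"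
proof (induction c arbitrary: \<sigma>)
  case (CM d a b)
  obtain y z where yz: "y \<in> ckeys a" "z \<in> ckeys b" using keys_nonempty by blast
  have "bit y i = bit z i" for i
  proof (cases "i < k")
    case True
    have "agree d (ckeys a \<union> ckeys b)" "k \<le> d" using CM.prems by auto
    then show ?thesis using agreeD[of d _ y z i] True yz by simp
  next
    case False
    have "\<not> bit x i" if "x < 2 ^ k" for x :: nat
      using that False by (metis bit_take_bit_iff take_bit_nat_eq_self_iff)
    then show ?thesis using CM.prems(3) yz by auto
  qed
  then have "y = z" by (simp add: bit_eq_iff)
  then show ?case using CM.prems yz by auto
qed auto

text \<open>Every inner node starts as a merge from bit 0, with the height as parameter, and all
  merges are over after \<open>k + ht t\<close> rounds of three steps. The sum in place of a product
  is the gain from pipelining.\<close>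

lemma par_sort:
  assumes "disjoint_keys t" "keys t \<subseteq> {..<2 ^ k}"
  obtains s where "(par ^^ (3 * (k + ht t))) t s" "trie s" "keys s = keys t"
proof -
  have "\<exists>c. on_time \<tau> (ht t) c \<and> (par ^^ (3 * \<tau>)) t (forget c) \<and> ckeys c = keys t" for \<tau>
  proof (induction \<tau>)
    case 0
    then show ?case using on_time_initial[OF assms(1)] by (intro exI[of _ "initial t"]) auto
  next
    case (Suc \<tau>)
    then obtain c where c: "on_time \<tau> (ht t) c" "(par ^^ (3 * \<tau>)) t (forget c)" "ckeys c = keys t" by auto
    obtain c' where c': "on_time (Suc \<tau>) (ht t) c'" "par3 (forget c) (forget c')" "ckeys c' = ckeys c"
      using round_exists[OF c(1)] by auto
    have "(par ^^ (3 * \<tau> + 3)) t (forget c')"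
      using c(2) par3_relpowp[OF c'(2)] by (auto simp: relpowp_add)
    then show ?case using c c' by (intro exI[of _ c']) (auto simp: add.commute)
  qed
  from this[of "k + ht t"] obtain c where
    "on_time (k + ht t) (ht t) c" "(par ^^ (3 * (k + ht t))) t (forget c)" "ckeys c = keys t" by auto
  with assms(2) on_time_finished[of "k + ht t" "ht t" c k] that show ?thesis by auto
qed

section \<open>Rotations of spanning trees\<close>

text \<open>
  In \<open>Fork v p a b\<close>, the vertex \<open>v\<close> is joined to its parent by an edge whose half \<open>p\<close> is attached at
  the parent and whose half \<open>flip \<Gamma> p\<close> is attached at \<open>v\<close>.
\<close>

datatype atree = Tip nat | Fork nat nat atree atree

fun dart :: "atree \<Rightarrow> nat" where
  "dart (Tip x) = x"
| "dart (Fork v p a b) = p"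

fun vset :: "atree \<Rightarrow> nat set" where
  "vset (Tip x) = {}"
| "vset (Fork v p a b) = insert v (vset a \<union> vset b)"

fun ndarts :: "atree \<Rightarrow> nat set" where
  "ndarts (Tip x) = {}"
| "ndarts (Fork v p a b) = insert p (ndarts a \<union> ndarts b)"

fun tips :: "atree \<Rightarrow> nat set" where
  "tips (Tip x) = {x}"
| "tips (Fork v p a b) = tips a \<union> tips b"

text \<open>The half-edges that point away from the root at the vertices of the tree. The dart of
  the whole tree belongs to them only if it recurs further down.\<close>

fun pdarts :: "atree \<Rightarrow> nat set" where
  "pdarts (Tip x) = {}"
| "pdarts (Fork v p a b) = {dart a, dart b} \<union> pdarts a \<union> pdarts b"

fun shape :: "(nat \<Rightarrow> nat) \<Rightarrow> atree \<Rightarrow> ktree" where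
  "shape \<kappa> (Tip x) = Lf (\<kappa> x)"
| "shape \<kappa> (Fork v p a b) = Br (shape \<kappa> a) (shape \<kappa> b)"

text \<open>Cardinality 3 makes the half-edges at \<open>v\<close> distinct. The place where the
  dart of the whole tree is attached is left open, so that the root edge may lead back into the
  tree, as it does in a spanning tree.\<close>

fun wf_tree :: "mgraph \<Rightarrow> atree \<Rightarrow> bool" where
  "wf_tree \<Gamma> (Tip x) \<longleftrightarrow> True"
| "wf_tree \<Gamma> (Fork v p a b) \<longleftrightarrow>
     p \<in> halves \<Gamma> \<and> halves_at \<Gamma> v = {flip \<Gamma> p, dart a, dart b} \<and> card {flip \<Gamma> p, dart a, dart b} = 3 \<and>
     v \<notin> vset a \<and> v \<notin> vset b \<and> vset a \<inter> vset b = {} \<and> wf_tree \<Gamma> a \<and> wf_tree \<Gamma> b"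

lemma wf_tree_moves_in: "wf_tree \<Gamma> t \<Longrightarrow> moves_in V \<Gamma> \<Gamma>' \<Longrightarrow> V \<inter> vset t = {} \<Longrightarrow> wf_tree \<Gamma>' t"
proof (induction t)
  case (Fork v p a b)
  then have "halves_at \<Gamma>' v = halves_at \<Gamma> v" by (intro moves_in_halves_at) auto
  moreover have "wf_tree \<Gamma>' a" "wf_tree \<Gamma>' b" using Fork by auto
  ultimately show ?case using Fork.prems moves_in_local[OF Fork.prems(2)] by auto
qed auto

lemma wf_tree_mirror: "wf_tree \<Gamma> (Fork v p a b) \<Longrightarrow> wf_tree \<Gamma> (Fork v p b a)"
  by (auto simp: insert_commute)

text \<open>The rotation is the Whitehead move on the tree edge between \<open>v\<close> and
  \<open>w\<close> that swaps the darts of \<open>b\<close> and \<open>c\<close>. The three subtrees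
  avoid both vertices and remain valid.\<close>

lemma wf_tree_rotate:
  assumes wf: "wf_tree \<Gamma> (Fork v p (Fork w q a b) c)"
  obtains \<Gamma>' where "moves_in {v, w} \<Gamma> \<Gamma>'" "wf_tree \<Gamma>' (Fork v p (Fork w q a c) b)"
proof -
  let ?G = "exchange \<Gamma> (dart c) (dart b)"
  have v: "halves_at \<Gamma> v = {q, flip \<Gamma> p, dart c}" "card {q, flip \<Gamma> p, dart c} = 3"
    and w: "halves_at \<Gamma> w = {flip \<Gamma> q, dart b, dart a}" "card {flip \<Gamma> q, dart b, dart a} = 3"
    and d: "v \<noteq> w" and p: "p \<in> halves \<Gamma>"
    using wf by (auto simp: insert_commute)
  have q: "q \<in> halves \<Gamma>" "att \<Gamma> q = v" "att \<Gamma> (flip \<Gamma> q) = w"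
    using v(1) w(1) by (auto simp: halves_at_def)
  note E = moves_in_exchange[OF q d v w]
  have at: "att \<Gamma> (flip \<Gamma> p) = v" "att \<Gamma> (dart c) = v" "att \<Gamma> (dart b) = w" "att \<Gamma> (dart a) = w"
    using v(1) w(1) by (auto simp: halves_at_def)
  have "card {q, flip \<Gamma> p, dart b} = 3" "card {flip \<Gamma> q, dart c, dart a} = 3"
    using v(2) w(2) at q d by (auto simp: card_insert_if split: if_splits)
  moreover have "wf_tree ?G a" "wf_tree ?G b" "wf_tree ?G c"
    using wf_tree_moves_in[OF _ E(1)] wf by auto
  ultimately have "wf_tree ?G (Fork v p (Fork w q a c) b)"
    using E(2,3) wf moves_in_local[OF E(1)] by (auto simp: insert_commute)
  then show ?thesis using that E(1) by blast
qed

text \<open>What the surrounding tree sees of a subtree: where it hangs, which vertices it occupies,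
  and which cut half-edges, hence labels, it carries.\<close>

definition same_frame :: "atree \<Rightarrow> atree \<Rightarrow> bool" where
  "same_frame t t' \<longleftrightarrow> dart t' = dart t \<and> vset t' = vset t \<and> tips t' = tips t"

text \<open>The quantification over all \<Gamma> is what lets the claim for one subtree be used
  after its sibling has already altered the graph.\<close>

definition steps_to :: "(nat \<Rightarrow> nat) \<Rightarrow> atree \<Rightarrow> ktree \<Rightarrow> bool" where
  "steps_to \<kappa> t s \<longleftrightarrow> (\<forall>\<Gamma>. wf_tree \<Gamma> t \<longrightarrow>
     (\<exists>\<Gamma>' t'. moves_in (vset t) \<Gamma> \<Gamma>' \<and> wf_tree \<Gamma>' t' \<and> shape \<kappa> t' = s \<and> same_frame t t'))"

lemma steps_to_pair:
  assumes "steps_to \<kappa> a sa" "steps_to \<kappa> b sb" "wf_tree \<Gamma> a" "wf_tree \<Gamma> b" "vset a \<inter> vset b = {}"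
  obtains \<Gamma>' a' b' where "moves_in (vset a \<union> vset b) \<Gamma> \<Gamma>'" "wf_tree \<Gamma>' a'" "wf_tree \<Gamma>' b'"
    "shape \<kappa> a' = sa" "shape \<kappa> b' = sb" "same_frame a a'" "same_frame b b'"
proof -
  obtain \<Gamma>1 a' where 1: "moves_in (vset a) \<Gamma> \<Gamma>1" "wf_tree \<Gamma>1 a'" "shape \<kappa> a' = sa" "same_frame a a'"
    using assms(1,3) unfolding steps_to_def by blast
  have "wf_tree \<Gamma>1 b" using wf_tree_moves_in[OF assms(4) 1(1) assms(5)] .
  then obtain \<Gamma>2 b' where 2: "moves_in (vset b) \<Gamma>1 \<Gamma>2" "wf_tree \<Gamma>2 b'" "shape \<kappa> b' = sb" "same_frame b b'"
    using assms(2) unfolding steps_to_def by blast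
  have "wf_tree \<Gamma>2 a'" using wf_tree_moves_in[OF 1(2) 2(1)] 1(4) assms(5) by (auto simp: same_frame_def)
  moreover have "moves_in (vset a \<union> vset b) \<Gamma> \<Gamma>2" using moves_in_trans[OF 1(1) 2(1) assms(5)] .
  ultimately show ?thesis using that 1 2 by blast
qed

lemma wf_tree_Fork_frame:
  assumes "wf_tree \<Gamma> (Fork v p a b)" "moves_in V \<Gamma> \<Gamma>'" "v \<notin> V" "same_frame a a'" "same_frame b b'"
    "wf_tree \<Gamma>' a'" "wf_tree \<Gamma>' b'"
  shows "wf_tree \<Gamma>' (Fork v p a' b')"
  using assms moves_in_halves_at[OF assms(2,3)] moves_in_local[OF assms(2)] by (auto simp: same_frame_def)

lemma steps_to_Fork:
  assumes "steps_to \<kappa> a sa" "steps_to \<kappa> b sb" "wf_tree \<Gamma> (Fork v p a b)"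
  obtains \<Gamma>' a' b' where "moves_in (vset a \<union> vset b) \<Gamma> \<Gamma>'" "wf_tree \<Gamma>' (Fork v p a' b')"
    "shape \<kappa> a' = sa" "shape \<kappa> b' = sb" "same_frame a a'" "same_frame b b'"
proof -
  have "wf_tree \<Gamma> a" "wf_tree \<Gamma> b" "vset a \<inter> vset b = {}" "v \<notin> vset a \<union> vset b" using assms(3) by auto
  from steps_to_pair[OF assms(1,2) this(1-3)] this(4) show ?thesis
    using that wf_tree_Fork_frame[OF assms(3)] by metis
qed

lemma steps_to_rotate:
  assumes "steps_to \<kappa> a sa" "steps_to \<kappa> b sb" "steps_to \<kappa> c sc"
    and wf: "wf_tree \<Gamma> (Fork v p (Fork w q a b) c)"
  obtains \<Gamma>' a' b' c' where "moves_in (vset (Fork v p (Fork w q a b) c)) \<Gamma> \<Gamma>'"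
    "wf_tree \<Gamma>' (Fork v p (Fork w q a' c') b')" "shape \<kappa> a' = sa" "shape \<kappa> b' = sb" "shape \<kappa> c' = sc"
    "same_frame a a'" "same_frame b b'" "same_frame c c'"
proof -
  have wfs: "wf_tree \<Gamma> (Fork w q a b)" "wf_tree \<Gamma> c" using wf by auto
  obtain \<Gamma>1 a' b' where 1: "moves_in (vset a \<union> vset b) \<Gamma> \<Gamma>1" "wf_tree \<Gamma>1 (Fork w q a' b')"
    "shape \<kappa> a' = sa" "shape \<kappa> b' = sb" "same_frame a a'" "same_frame b b'"
    using steps_to_Fork[OF assms(1,2) wfs(1)] .
  have f: "same_frame (Fork w q a b) (Fork w q a' b')" using 1 by (auto simp: same_frame_def)
  have "wf_tree \<Gamma>1 c" using wf_tree_moves_in[OF wfs(2) 1(1)] wf by auto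
  then obtain \<Gamma>2 c' where 2: "moves_in (vset c) \<Gamma>1 \<Gamma>2" "wf_tree \<Gamma>2 c'" "shape \<kappa> c' = sc" "same_frame c c'"
    using assms(3) unfolding steps_to_def by blast
  have m12: "moves_in (vset a \<union> vset b \<union> vset c) \<Gamma> \<Gamma>2" using moves_in_trans[OF 1(1) 2(1)] wf by auto
  have "vset c \<inter> vset (Fork w q a' b') = {}" using f wf by (auto simp: same_frame_def)
  then have "wf_tree \<Gamma>2 (Fork w q a' b')" using wf_tree_moves_in[OF 1(2) 2(1)] by blast
  then have "wf_tree \<Gamma>2 (Fork v p (Fork w q a' b') c')"
    using wf_tree_Fork_frame[OF wf m12 _ f 2(4) _ 2(2)] wf by auto
  then obtain \<Gamma>3 where 3: "moves_in {v, w} \<Gamma>2 \<Gamma>3" "wf_tree \<Gamma>3 (Fork v p (Fork w q a' c') b')"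
    by (rule wf_tree_rotate)
  have "moves_in (vset a \<union> vset b \<union> vset c \<union> {v, w}) \<Gamma> \<Gamma>3" using moves_in_trans[OF m12 3(1)] wf by auto
  then have "moves_in (vset (Fork v p (Fork w q a b) c)) \<Gamma> \<Gamma>3" by (rule moves_in_mono) auto
  then show ?thesis using that 1 2 3 by blast
qed

lemma shape_BrE:
  assumes "shape \<kappa> t = Br sa sb"
  obtains v p a b where "t = Fork v p a b" "shape \<kappa> a = sa" "shape \<kappa> b = sb"
  using assms by (cases t) auto

text \<open>The subtrees move first, then at most one rotation takes place on the edge above them;
  the vertex sets are disjoint, so all this is one simultaneous move. An exchange of children is
  achieved by reading the same graph through the mirrored tree.\<close>

lemma par_steps_to: "par s s' \<Longrightarrow> shape \<kappa> t = s \<Longrightarrow> steps_to \<kappa> t s'"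
proof (induction arbitrary: t rule: par.induct)
  case (Lf x)
  then show ?case using moves_in_refl by (auto simp: steps_to_def same_frame_def)
next
  case (Br sa sa' sb sb')
  then obtain v p a b where t: "t = Fork v p a b" "shape \<kappa> a = sa" "shape \<kappa> b = sb" by (cases t) auto
  show ?case unfolding steps_to_def
  proof (intro allI impI)
    fix \<Gamma> assume "wf_tree \<Gamma> t"
    then have wf: "wf_tree \<Gamma> (Fork v p a b)" by (simp only: t(1))
    obtain \<Gamma>' a' b' where *: "moves_in (vset a \<union> vset b) \<Gamma> \<Gamma>'" "wf_tree \<Gamma>' (Fork v p a' b')"
      "shape \<kappa> a' = sa'" "shape \<kappa> b' = sb'" "same_frame a a'" "same_frame b b'"
      using steps_to_Fork[OF Br.IH(1)[OF t(2)] Br.IH(2)[OF t(3)] wf] .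
    show "\<exists>\<Gamma>' t'. moves_in (vset t) \<Gamma> \<Gamma>' \<and> wf_tree \<Gamma>' t' \<and> shape \<kappa> t' = Br sa' sb' \<and> same_frame t t'"
      using * t(1) moves_in_mono[OF *(1), of "vset t"]
      by (intro exI[of _ \<Gamma>'] exI[of _ "Fork v p a' b'"]) (auto simp: same_frame_def)
  qed
next
  case (swap sa sa' sb sb')
  then obtain v p a b where t: "t = Fork v p a b" "shape \<kappa> a = sa" "shape \<kappa> b = sb" by (cases t) auto
  show ?case unfolding steps_to_def
  proof (intro allI impI)
    fix \<Gamma> assume "wf_tree \<Gamma> t"
    then have wf: "wf_tree \<Gamma> (Fork v p a b)" by (simp only: t(1))
    obtain \<Gamma>' a' b' where *: "moves_in (vset a \<union> vset b) \<Gamma> \<Gamma>'" "wf_tree \<Gamma>' (Fork v p a' b')"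
      "shape \<kappa> a' = sa'" "shape \<kappa> b' = sb'" "same_frame a a'" "same_frame b b'"
      using steps_to_Fork[OF swap.IH(1)[OF t(2)] swap.IH(2)[OF t(3)] wf] .
    show "\<exists>\<Gamma>' t'. moves_in (vset t) \<Gamma> \<Gamma>' \<and> wf_tree \<Gamma>' t' \<and> shape \<kappa> t' = Br sb' sa' \<and> same_frame t t'"
      using * t(1) moves_in_mono[OF *(1), of "vset t"] wf_tree_mirror[OF *(2)]
      by (intro exI[of _ \<Gamma>'] exI[of _ "Fork v p b' a'"]) (auto simp: same_frame_def simp del: wf_tree.simps)
  qed
next
  case (rot sa sa' sb sb' sc sc')
  then obtain v p w q a b c where t: "t = Fork v p (Fork w q a b) c"
    "shape \<kappa> a = sa" "shape \<kappa> b = sb" "shape \<kappa> c = sc"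
    by (metis shape_BrE)
  show ?case unfolding steps_to_def
  proof (intro allI impI)
    fix \<Gamma> assume "wf_tree \<Gamma> t"
    then have wf: "wf_tree \<Gamma> (Fork v p (Fork w q a b) c)" by (simp only: t(1))
    obtain \<Gamma>' a' b' c' where *: "moves_in (vset (Fork v p (Fork w q a b) c)) \<Gamma> \<Gamma>'"
      "wf_tree \<Gamma>' (Fork v p (Fork w q a' c') b')"
      "shape \<kappa> a' = sa'" "shape \<kappa> b' = sb'" "shape \<kappa> c' = sc'"
      "same_frame a a'" "same_frame b b'" "same_frame c c'"
      using steps_to_rotate[OF rot.IH(1)[OF t(2)] rot.IH(2)[OF t(3)] rot.IH(3)[OF t(4)] wf] .
    then show "\<exists>\<Gamma>' t'. moves_in (vset t) \<Gamma> \<Gamma>' \<and> wf_tree \<Gamma>' t' \<and> shape \<kappa> t' = Br (Br sa' sc') sb' \<and> same_frame t t'"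
      using t(1) by (intro exI[of _ \<Gamma>'] exI[of _ "Fork v p (Fork w q a' c') b'"])
        (auto simp: same_frame_def simp del: wf_tree.simps)
  qed
next
  case (rot_swap sa sa' sb sb' sc sc')
  then obtain v p w q a b c where t: "t = Fork v p (Fork w q a b) c"
    "shape \<kappa> a = sa" "shape \<kappa> b = sb" "shape \<kappa> c = sc"
    by (metis shape_BrE)
  show ?case unfolding steps_to_def
  proof (intro allI impI)
    fix \<Gamma> assume "wf_tree \<Gamma> t"
    then have wf: "wf_tree \<Gamma> (Fork v p (Fork w q a b) c)" by (simp only: t(1))
    obtain \<Gamma>' a' b' c' where *: "moves_in (vset (Fork v p (Fork w q a b) c)) \<Gamma> \<Gamma>'"
      "wf_tree \<Gamma>' (Fork v p (Fork w q a' c') b')"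
      "shape \<kappa> a' = sa'" "shape \<kappa> b' = sb'" "shape \<kappa> c' = sc'"
      "same_frame a a'" "same_frame b b'" "same_frame c c'"
      using steps_to_rotate[OF rot_swap.IH(1)[OF t(2)] rot_swap.IH(2)[OF t(3)] rot_swap.IH(3)[OF t(4)] wf] .
    then show "\<exists>\<Gamma>' t'. moves_in (vset t) \<Gamma> \<Gamma>' \<and> wf_tree \<Gamma>' t' \<and> shape \<kappa> t' = Br sb' (Br sa' sc') \<and> same_frame t t'"
      using t(1) wf_tree_mirror[OF *(2)] by (intro exI[of _ \<Gamma>'] exI[of _ "Fork v p b' (Fork w q a' c')"])
        (auto simp: same_frame_def simp del: wf_tree.simps)
  qed
next
  case (rot_right sa sa' sb sb' sc sc')
  then obtain v p w q a b c where t: "t = Fork v p a (Fork w q b c)"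
    "shape \<kappa> a = sa" "shape \<kappa> b = sb" "shape \<kappa> c = sc"
    by (metis shape_BrE)
  show ?case unfolding steps_to_def
  proof (intro allI impI)
    fix \<Gamma> assume "wf_tree \<Gamma> t"
    then have wf: "wf_tree \<Gamma> (Fork v p (Fork w q b c) a)" unfolding t(1) by (rule wf_tree_mirror)
    obtain \<Gamma>' a' b' c' where *: "moves_in (vset (Fork v p (Fork w q b c) a)) \<Gamma> \<Gamma>'"
      "wf_tree \<Gamma>' (Fork v p (Fork w q b' a') c')"
      "shape \<kappa> b' = sb'" "shape \<kappa> c' = sc'" "shape \<kappa> a' = sa'"
      "same_frame b b'" "same_frame c c'" "same_frame a a'"
      using steps_to_rotate[OF rot_right.IH(2)[OF t(3)] rot_right.IH(3)[OF t(4)] rot_right.IH(1)[OF t(2)] wf] .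
    then show "\<exists>\<Gamma>' t'. moves_in (vset t) \<Gamma> \<Gamma>' \<and> wf_tree \<Gamma>' t' \<and> shape \<kappa> t' = Br sc' (Br sb' sa') \<and> same_frame t t'"
      using t(1) wf_tree_mirror[OF *(2)] moves_in_mono[OF *(1), of "vset t"]
      by (intro exI[of _ \<Gamma>'] exI[of _ "Fork v p c' (Fork w q b' a')"])
        (auto simp: same_frame_def simp del: wf_tree.simps)
  qed
qed

text \<open>
  A rooted binary spanning tree: the root hangs at the half-edge \<open>flip \<Gamma> (dart t)\<close>, the tips are
  the other half-edges of the edges outside the spanning tree.
\<close>

definition spanning :: "mgraph \<Rightarrow> atree \<Rightarrow> bool" where
  "spanning \<Gamma> t \<longleftrightarrow> multigraph \<Gamma> \<and> wf_tree \<Gamma> t \<and> vset t = verts \<Gamma> \<and> verts \<Gamma> \<noteq> {}"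

lemma wf_tree_reach:
  "wf_tree \<Gamma> t \<Longrightarrow> w \<in> vset t \<Longrightarrow> (att \<Gamma> (flip \<Gamma> (dart t)), w) \<in> (adj \<Gamma>)\<^sup>*"
proof (induction t)
  case (Fork v p a b)
  have att: "att \<Gamma> (flip \<Gamma> p) = v" using Fork.prems(1) by (auto simp: halves_at_def)
  have child: "(v, att \<Gamma> (flip \<Gamma> h)) \<in> adj \<Gamma>" if "h \<in> {dart a, dart b}" for h
    using Fork.prems(1) that unfolding adj_def by (auto simp: halves_at_def)
  consider "w = v" | "w \<in> vset a" | "w \<in> vset b" using Fork.prems(2) by auto
  then show ?case
  proof cases
    case 2
    then have "(att \<Gamma> (flip \<Gamma> (dart a)), w) \<in> (adj \<Gamma>)\<^sup>*" using Fork by simp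
    then show ?thesis using child[of "dart a"] att by (simp add: converse_rtrancl_into_rtrancl)
  next
    case 3
    then have "(att \<Gamma> (flip \<Gamma> (dart b)), w) \<in> (adj \<Gamma>)\<^sup>*" using Fork by simp
    then show ?thesis using child[of "dart b"] att by (simp add: converse_rtrancl_into_rtrancl)
  qed (use att in auto)
qed auto

text \<open>Connectedness and 3-regularity can be read off the tree, so along the moves it is enough
  to preserve \<open>spanning\<close>.\<close>

lemma spanning_cubic:
  assumes "spanning \<Gamma> t"
  shows "graph_connected \<Gamma>" "regular 3 \<Gamma>"
proof -
  have m: "multigraph \<Gamma>" and w: "wf_tree \<Gamma> t" and V: "vset t = verts \<Gamma>"
    using assms by (auto simp: spanning_def)
  have "(att \<Gamma> (flip \<Gamma> (dart t)), u) \<in> (adj \<Gamma>)\<^sup>*" if "u \<in> verts \<Gamma>" for u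
    using wf_tree_reach[OF w] that V by blast
  moreover have "sym ((adj \<Gamma>)\<^sup>*)" using adj_sym[OF m] by (intro sym_rtrancl symI)
  ultimately show "graph_connected \<Gamma>" using assms unfolding graph_connected_def spanning_def
    by (metis (no_types, lifting) rtrancl_trans symD)
  have "card (halves_at \<Gamma> u) = 3" if "wf_tree \<Gamma> s" "u \<in> vset s" for u s
    using that by (induction s) auto
  then show "regular 3 \<Gamma>" using w V unfolding regular_def by blast
qed

lemma moves_in_multigraph:
  assumes "moves_in V \<Gamma> \<Gamma>'" "multigraph \<Gamma>" "V \<subseteq> verts \<Gamma>"
  shows "multigraph \<Gamma>'"
proof -
  note L = moves_in_local[OF assms(1)]
  have "att \<Gamma>' h \<in> verts \<Gamma>" if "h \<in> halves \<Gamma>" for h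
    using L(4)[of h] that multigraphD(6)[OF assms(2)] assms(3) by auto
  then show ?thesis using assms(2) unfolding multigraph_def L(1-3) by simp
qed

lemma par_simul_rel:
  assumes "spanning \<Gamma> t" "card (verts \<Gamma>) + 2 = 2 * g" "par (shape \<kappa> t) s"
  obtains \<Gamma>' t' where "spanning \<Gamma>' t'" "(iso_class \<Gamma>, iso_class \<Gamma>') \<in> simul_rel g" "shape \<kappa> t' = s"
    "flip \<Gamma>' = flip \<Gamma>" "verts \<Gamma>' = verts \<Gamma>" "halves \<Gamma>' = halves \<Gamma>" "same_frame t t'"
proof -
  have m: "multigraph \<Gamma>" "wf_tree \<Gamma> t" "vset t = verts \<Gamma>" "verts \<Gamma> \<noteq> {}" using assms(1) by (auto simp: spanning_def)
  obtain \<Gamma>' t' where *: "moves_in (vset t) \<Gamma> \<Gamma>'" "wf_tree \<Gamma>' t'" "shape \<kappa> t' = s" "same_frame t t'"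
    using par_steps_to[OF assms(3) refl] m(2) unfolding steps_to_def by blast
  note L = moves_in_local[OF *(1)]
  have sp: "spanning \<Gamma>' t'"
    using moves_in_multigraph[OF *(1) m(1)] m * L unfolding spanning_def same_frame_def by simp
  have "\<Gamma> \<in> cubic_graphs g" "\<Gamma>' \<in> cubic_graphs g"
    using spanning_cubic[OF assms(1)] spanning_cubic[OF sp] m(1) sp L(1) assms(2)
    by (auto simp: cubic_graphs_iff spanning_def)
  then have "(iso_class \<Gamma>, iso_class \<Gamma>') \<in> simul_rel g"
    using simul_rel_iso_class moves_in_simultaneous[OF *(1)] by blast
  then show ?thesis using that sp * L by blast
qed

lemma par_relpow_simul_rel:
  assumes "spanning \<Gamma> t" "card (verts \<Gamma>) + 2 = 2 * g" "(par ^^ n) (shape \<kappa> t) s"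
  shows "\<exists>\<Gamma>' t'. spanning \<Gamma>' t' \<and> (iso_class \<Gamma>, iso_class \<Gamma>') \<in> simul_rel g ^^ n \<and> shape \<kappa> t' = s \<and>
    flip \<Gamma>' = flip \<Gamma> \<and> verts \<Gamma>' = verts \<Gamma> \<and> halves \<Gamma>' = halves \<Gamma> \<and> same_frame t t'"
  using assms(3)
proof (induction n arbitrary: s)
  case 0
  then show ?case using assms(1) by (intro exI[of _ \<Gamma>] exI[of _ t]) (auto simp: same_frame_def)
next
  case (Suc n)
  then obtain s1 where s1: "(par ^^ n) (shape \<kappa> t) s1" "par s1 s" by auto
  obtain \<Gamma>1 t1 where 1: "spanning \<Gamma>1 t1" "(iso_class \<Gamma>, iso_class \<Gamma>1) \<in> simul_rel g ^^ n" "shape \<kappa> t1 = s1"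
    "flip \<Gamma>1 = flip \<Gamma>" "verts \<Gamma>1 = verts \<Gamma>" "halves \<Gamma>1 = halves \<Gamma>" "same_frame t t1"
    using Suc.IH[OF s1(1)] by blast
  have "card (verts \<Gamma>1) + 2 = 2 * g" "par (shape \<kappa> t1) s" using 1 assms(2) s1(2) by auto
  from par_simul_rel[OF 1(1) this] obtain \<Gamma>2 t2 where 2: "spanning \<Gamma>2 t2"
    "(iso_class \<Gamma>1, iso_class \<Gamma>2) \<in> simul_rel g" "shape \<kappa> t2 = s"
    "flip \<Gamma>2 = flip \<Gamma>1" "verts \<Gamma>2 = verts \<Gamma>1" "halves \<Gamma>2 = halves \<Gamma>1" "same_frame t1 t2" .
  have "(iso_class \<Gamma>, iso_class \<Gamma>2) \<in> simul_rel g ^^ Suc n" using 1(2) 2(2) by auto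
  then show ?case using 1 2 by (intro exI[of _ \<Gamma>2] exI[of _ t2]) (auto simp: same_frame_def)
qed

section \<open>Uniqueness of the sorted graph\<close>

abbreviation darts :: "atree \<Rightarrow> nat set" where
  "darts t \<equiv> insert (dart t) (pdarts t)"

lemma finite_atree: "finite (vset t)" "finite (tips t)" "finite (ndarts t)" "finite (pdarts t)"
  by (induction t) auto

lemma darts_eq: "darts t = tips t \<union> ndarts t"
  by (induction t) auto

lemma keys_shape: "keys (shape \<kappa> t) = \<kappa> ` tips t"
  by (induction t) auto

lemma halves_atD: "h \<in> halves_at \<Gamma> v \<Longrightarrow> h \<in> halves \<Gamma> \<and> att \<Gamma> h = v"
  by (simp add: halves_at_def)

lemma wf_tree_Fork_att:
  assumes "wf_tree \<Gamma> (Fork v p a b)"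
  shows "att \<Gamma> (flip \<Gamma> p) = v" "att \<Gamma> (dart a) = v" "att \<Gamma> (dart b) = v"
    "flip \<Gamma> p \<in> halves \<Gamma>" "dart a \<in> halves \<Gamma>" "dart b \<in> halves \<Gamma>"
    "dart a \<noteq> dart b" "dart a \<noteq> flip \<Gamma> p" "dart b \<noteq> flip \<Gamma> p"
proof -
  have h: "halves_at \<Gamma> v = {flip \<Gamma> p, dart a, dart b}" and c: "card {flip \<Gamma> p, dart a, dart b} = 3"
    using assms by auto
  show "att \<Gamma> (flip \<Gamma> p) = v" "att \<Gamma> (dart a) = v" "att \<Gamma> (dart b) = v"
    "flip \<Gamma> p \<in> halves \<Gamma>" "dart a \<in> halves \<Gamma>" "dart b \<in> halves \<Gamma>"
    using h halves_atD[of _ \<Gamma> v] by auto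
  show "dart a \<noteq> dart b" "dart a \<noteq> flip \<Gamma> p" "dart b \<noteq> flip \<Gamma> p"
    using c by (auto simp: card_insert_if split: if_splits)
qed

lemma wf_tree_pdarts: "wf_tree \<Gamma> t \<Longrightarrow> x \<in> pdarts t \<Longrightarrow> x \<in> halves \<Gamma> \<and> att \<Gamma> x \<in> vset t"
proof (induction t)
  case (Fork v p a b)
  note F = wf_tree_Fork_att[OF Fork.prems(1)]
  consider "x = dart a" | "x = dart b" | "x \<in> pdarts a" | "x \<in> pdarts b" using Fork.prems(2) by auto
  then show ?case using F Fork by cases auto
qed auto

lemma wf_tree_ndarts: "wf_tree \<Gamma> t \<Longrightarrow> q \<in> ndarts t \<Longrightarrow> q \<in> halves \<Gamma> \<and> flip \<Gamma> q \<in> halves \<Gamma> \<and> att \<Gamma> (flip \<Gamma> q) \<in> vset t"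
proof (induction t)
  case (Fork v p a b)
  note F = wf_tree_Fork_att[OF Fork.prems(1)]
  consider "q = p" | "q \<in> ndarts a" | "q \<in> ndarts b" using Fork.prems(2) by auto
  then show ?case using F Fork by cases auto
qed auto

lemma wf_tree_darts_disjoint:
  assumes "wf_tree \<Gamma> (Fork v p a b)"
  shows "darts a \<inter> darts b = {}"
proof -
  note F = wf_tree_Fork_att[OF assms]
  have w: "wf_tree \<Gamma> a" "wf_tree \<Gamma> b" "v \<notin> vset a" "v \<notin> vset b" "vset a \<inter> vset b = {}" using assms by auto
  have "False" if "x \<in> darts a" "x \<in> darts b" for x
    using that F w wf_tree_pdarts[OF w(1), of x] wf_tree_pdarts[OF w(2), of x] by auto
  then show ?thesis by blast
qed

lemma flip_ndarts_notin_pdarts: "wf_tree \<Gamma> t \<Longrightarrow> q \<in> ndarts t \<Longrightarrow> flip \<Gamma> q \<notin> pdarts t"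
proof (induction t)
  case (Fork v p a b)
  note F = wf_tree_Fork_att[OF Fork.prems(1)]
  have w: "wf_tree \<Gamma> a" "wf_tree \<Gamma> b" "v \<notin> vset a" "v \<notin> vset b" "vset a \<inter> vset b = {}" using Fork.prems by auto
  have P: "x \<in> pdarts a \<Longrightarrow> att \<Gamma> x \<in> vset a" "x \<in> pdarts b \<Longrightarrow> att \<Gamma> x \<in> vset b" for x
    using wf_tree_pdarts w by auto
  consider "q = p" | "q \<in> ndarts a" | "q \<in> ndarts b" using Fork.prems(2) by auto
  then show ?case
  proof cases
    case 1
    then show ?thesis using F P[of "flip \<Gamma> q"] w by auto
  next
    case 2
    then have "att \<Gamma> (flip \<Gamma> q) \<in> vset a" "flip \<Gamma> q \<notin> pdarts a" using wf_tree_ndarts w Fork.IH by auto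
    then show ?thesis using F P[of "flip \<Gamma> q"] w by auto
  next
    case 3
    then have "att \<Gamma> (flip \<Gamma> q) \<in> vset b" "flip \<Gamma> q \<notin> pdarts b" using wf_tree_ndarts w Fork.IH by auto
    then show ?thesis using F P[of "flip \<Gamma> q"] w by auto
  qed
qed auto

lemma wf_tree_halves_at: "wf_tree \<Gamma> t \<Longrightarrow> w \<in> vset t \<Longrightarrow> h \<in> halves_at \<Gamma> w \<Longrightarrow> h \<in> pdarts t \<or> h \<in> flip \<Gamma> ` ndarts t"
  by (induction t) auto

text \<open>The root dart of a spanning tree is both a tip and the dart of a fork. The hypothesis
  excludes this; it holds for the two subtrees of the root, whose darts are attached at the
  root.\<close>

lemma tips_notin_ndarts: "wf_tree \<Gamma> t \<Longrightarrow> att \<Gamma> (dart t) \<notin> vset t \<Longrightarrow> tips t \<inter> ndarts t = {}"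
proof (induction t)
  case (Fork v p a b)
  note F = wf_tree_Fork_att[OF Fork.prems(1)]
  have w: "wf_tree \<Gamma> a" "wf_tree \<Gamma> b" "v \<notin> vset a" "v \<notin> vset b" using Fork.prems by auto
  have "p \<notin> darts a" "p \<notin> darts b"
    using wf_tree_pdarts[OF w(1), of p] wf_tree_pdarts[OF w(2), of p] Fork.prems(2) F by auto
  moreover have "tips a \<inter> ndarts a = {}" "tips b \<inter> ndarts b = {}" using Fork.IH F w by auto
  ultimately show ?case using wf_tree_darts_disjoint[OF Fork.prems(1)] unfolding darts_eq by auto
qed auto

lemma card_tips: "wf_tree \<Gamma> t \<Longrightarrow> card (tips t) = card (vset t) + 1"
proof (induction t)
  case (Fork v p a b)
  have "tips a \<inter> tips b = {}" using wf_tree_darts_disjoint[OF Fork.prems] unfolding darts_eq by auto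
  moreover have "vset a \<inter> vset b = {}" "v \<notin> vset a \<union> vset b" using Fork.prems by auto
  ultimately show ?case using Fork by (simp add: card_Un_disjoint finite_atree)
qed auto

lemma disjoint_keys_shape: "wf_tree \<Gamma> t \<Longrightarrow> inj_on \<kappa> (tips t) \<Longrightarrow> disjoint_keys (shape \<kappa> t)"
proof (induction t)
  case (Fork v p a b)
  have "tips a \<inter> tips b = {}" using wf_tree_darts_disjoint[OF Fork.prems(1)] unfolding darts_eq by auto
  then have "\<kappa> ` tips a \<inter> \<kappa> ` tips b = {}" using Fork.prems(2) by (auto simp: inj_on_def)
  then show ?case using Fork by (auto simp: keys_shape inj_on_Un)
qed auto

text \<open>Each half-edge points down (\<open>pdarts\<close>) or is the child-side half of an edge
  above a fork. The edge above the root closes up inside the graph, so its dart is one of the tips;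
  \<open>flip\<close> pairs the remaining tips, which are the two halves of the cut edges.\<close>

lemma spanning_structure:
  assumes "spanning \<Gamma> t"
  shows "h \<in> halves \<Gamma> \<Longrightarrow> h \<notin> pdarts t \<Longrightarrow> \<exists>q\<in>ndarts t. h = flip \<Gamma> q"
    and "dart t \<in> tips t" and "tips t \<subseteq> pdarts t" and "x \<in> ndarts t \<Longrightarrow> x \<in> tips t \<Longrightarrow> x = dart t"
    and "ndarts t \<subseteq> pdarts t"
    and "x \<in> tips t \<Longrightarrow> x \<noteq> dart t \<Longrightarrow> flip \<Gamma> x \<in> tips t \<and> flip \<Gamma> x \<noteq> dart t"
    and "x \<in> pdarts t \<Longrightarrow> flip \<Gamma> x \<in> pdarts t \<Longrightarrow> x \<in> tips t \<and> x \<noteq> dart t"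
proof -
  have m: "multigraph \<Gamma>" and wf: "wf_tree \<Gamma> t" and V: "vset t = verts \<Gamma>" and ne: "verts \<Gamma> \<noteq> {}"
    using assms by (auto simp: spanning_def)
  note M = multigraphD[OF m]
  obtain v p a b where t: "t = Fork v p a b" using V ne by (cases t) auto
  note F = wf_tree_Fork_att[OF wf[unfolded t]]
  have w: "wf_tree \<Gamma> a" "wf_tree \<Gamma> b" "v \<notin> vset a" "v \<notin> vset b" "p \<in> halves \<Gamma>" using wf t by auto
  show 1: "\<exists>q\<in>ndarts t. h = flip \<Gamma> q" if "h \<in> halves \<Gamma>" "h \<notin> pdarts t" for h
  proof -
    have "att \<Gamma> h \<in> vset t" "h \<in> halves_at \<Gamma> (att \<Gamma> h)" using that V M by (auto simp: halves_at_def)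
    then show ?thesis using wf_tree_halves_at[OF wf] that by blast
  qed
  note 2 = flip_ndarts_notin_pdarts[OF wf]
  have pd: "pdarts t = tips t \<union> ndarts a \<union> ndarts b" using darts_eq[of a] darts_eq[of b] t by auto
  have nd: "ndarts t = insert p (ndarts a \<union> ndarts b)" using t by simp
  \<comment> \<open>Otherwise \<open>p\<close> would be the flip of some fork dart \<open>q\<close>
    different from \<open>p\<close>. Then \<open>flip \<Gamma> p = q\<close> would point down, which
    the flip of a fork dart never does.\<close>
  have p: "p \<in> pdarts t"
  proof (rule ccontr)
    assume "p \<notin> pdarts t"
    then obtain q where q: "q \<in> ndarts t" "p = flip \<Gamma> q" using 1 w by blast
    have qh: "q \<in> halves \<Gamma>" using wf_tree_ndarts[OF wf q(1)] by simp
    have "flip \<Gamma> p = q" "q \<noteq> p" using q(2) M(4)[OF qh] M(5)[OF qh] by simp_all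
    then have "flip \<Gamma> p \<in> pdarts t" using q(1) nd pd by auto
    moreover have "flip \<Gamma> p \<notin> pdarts t" using 2 nd by simp
    ultimately show False by simp
  qed
  have pn: "p \<notin> ndarts a \<union> ndarts b"
    using wf_tree_ndarts[OF w(1), of p] wf_tree_ndarts[OF w(2), of p] F w by auto
  then show pt: "dart t \<in> tips t" using p pd t by auto
  show tp: "tips t \<subseteq> pdarts t" using pd by auto
  have disj: "tips t \<inter> (ndarts a \<union> ndarts b) = {}"
    using tips_notin_ndarts[OF w(1)] tips_notin_ndarts[OF w(2)] wf_tree_darts_disjoint[OF wf[unfolded t]] F w
    unfolding darts_eq t by auto
  then show "x \<in> ndarts t \<Longrightarrow> x \<in> tips t \<Longrightarrow> x = dart t" for x using nd t by auto
  show "ndarts t \<subseteq> pdarts t" using pd nd p by auto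
  show 7: "x \<in> tips t \<and> x \<noteq> dart t" if "x \<in> pdarts t" "flip \<Gamma> x \<in> pdarts t" for x
  proof -
    have "x \<notin> ndarts t" using 2 that by blast
    then show ?thesis using that pd nd t by auto
  qed
  show "flip \<Gamma> x \<in> tips t \<and> flip \<Gamma> x \<noteq> dart t" if x: "x \<in> tips t" "x \<noteq> dart t" for x
  proof -
    have xh: "x \<in> halves \<Gamma>" using x tp wf_tree_pdarts[OF wf] by auto
    have xn: "x \<notin> ndarts t" using x disj nd t by auto
    have "flip \<Gamma> x \<in> pdarts t"
    proof (rule ccontr)
      assume "flip \<Gamma> x \<notin> pdarts t"
      then obtain q where q: "q \<in> ndarts t" "flip \<Gamma> x = flip \<Gamma> q" using 1 M xh by blast
      have "q \<in> halves \<Gamma>" using wf_tree_ndarts[OF wf q(1)] by simp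
      then have "x = q" using q(2) M(5)[OF xh] M(5)[of q] by metis
      then show False using q xn by simp
    qed
    moreover have "flip \<Gamma> (flip \<Gamma> x) \<in> pdarts t" using M(5)[OF xh] x tp by auto
    ultimately show ?thesis by (rule 7)
  qed
qed

section \<open>From equal labelled shapes to isomorphic graphs\<close>

fun amap :: "(nat \<Rightarrow> nat) \<Rightarrow> (nat \<Rightarrow> nat) \<Rightarrow> atree \<Rightarrow> atree" where
  "amap p q (Tip x) = Tip (q x)"
| "amap p q (Fork v d a b) = Fork (p v) (q d) (amap p q a) (amap p q b)"

lemma amap_cong:
  "(\<And>v. v \<in> vset t \<Longrightarrow> p v = p' v) \<Longrightarrow> (\<And>d. d \<in> darts t \<Longrightarrow> q d = q' d) \<Longrightarrow> amap p q t = amap p' q' t"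
  by (induction t) auto

lemma amap_sets:
  "dart (amap p q t) = q (dart t)" "vset (amap p q t) = p ` vset t" "pdarts (amap p q t) = q ` pdarts t"
  "ndarts (amap p q t) = q ` ndarts t" "tips (amap p q t) = q ` tips t"
proof -
  show d: "dart (amap p q t) = q (dart t)" for t by (cases t) auto
  show "vset (amap p q t) = p ` vset t" "ndarts (amap p q t) = q ` ndarts t" "tips (amap p q t) = q ` tips t"
    by (induction t) auto
  show "pdarts (amap p q t) = q ` pdarts t" by (induction t) (auto simp: d)
qed

lemma amap_shape: "shape \<kappa>' (amap p q t) = shape \<kappa> t \<Longrightarrow> x \<in> tips t \<Longrightarrow> \<kappa>' (q x) = \<kappa> x"
  by (induction t) auto

lemma amap_att:
  "wf_tree \<Gamma> t \<Longrightarrow> wf_tree \<Gamma>' (amap p q t) \<Longrightarrow> x \<in> pdarts t \<Longrightarrow> p (att \<Gamma> x) = att \<Gamma>' (q x)"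
proof (induction t)
  case (Fork v d a b)
  have "wf_tree \<Gamma>' (Fork (p v) (q d) (amap p q a) (amap p q b))" using Fork.prems(2) by simp
  note F = wf_tree_Fork_att[OF Fork.prems(1)] and F' = wf_tree_Fork_att[OF this]
  consider "x = dart a" | "x = dart b" | "x \<in> pdarts a" | "x \<in> pdarts b" using Fork.prems(3) by auto
  then show ?case using F F' Fork by cases (auto simp: amap_sets)
qed auto

lemma amap_att_flip:
  "wf_tree \<Gamma> t \<Longrightarrow> wf_tree \<Gamma>' (amap p q t) \<Longrightarrow> x \<in> ndarts t \<Longrightarrow> p (att \<Gamma> (flip \<Gamma> x)) = att \<Gamma>' (flip \<Gamma>' (q x))"
proof (induction t)
  case (Fork v d a b)
  have "wf_tree \<Gamma>' (Fork (p v) (q d) (amap p q a) (amap p q b))" using Fork.prems(2) by simp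
  note F = wf_tree_Fork_att[OF Fork.prems(1)] and F' = wf_tree_Fork_att[OF this]
  consider "x = d" | "x \<in> ndarts a" | "x \<in> ndarts b" using Fork.prems(3) by auto
  then show ?case using F F' Fork by cases auto
qed auto

lemma same_shape_amap_children:
  assumes wf: "wf_tree \<Gamma> (Fork v d a b)" and "a' = amap pa qa a" "b' = amap pb qb b"
  obtains p q where "p v = v'" "a' = amap p q a" "b' = amap p q b" "d \<notin> darts a \<union> darts b \<longrightarrow> q d = d'"
proof -
  let ?p = "\<lambda>x. if x = v then v' else if x \<in> vset a then pa x else pb x"
  let ?q = "\<lambda>x. if x \<in> darts a then qa x else if x \<in> darts b then qb x else d'"
  have "amap pa qa a = amap ?p ?q a" using wf by (intro amap_cong) auto
  moreover have "amap pb qb b = amap ?p ?q b"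
    using wf wf_tree_darts_disjoint[OF wf] by (intro amap_cong) auto
  ultimately show ?thesis using that[of ?p ?q] assms(2,3) by auto
qed

text \<open>A root dart recurring as a tip would have two prescribed images under \<open>q\<close>.
  In a spanning tree it does recur, so the lemma is applied to the two subtrees of the root, and the
  root dart is matched separately by its label.\<close>

lemma same_shape_amap:
  "wf_tree \<Gamma> t \<Longrightarrow> att \<Gamma> (dart t) \<notin> vset t \<Longrightarrow> shape \<kappa> t = shape \<kappa>' t' \<Longrightarrow> \<exists>p q. t' = amap p q t"
proof (induction t arbitrary: t')
  case (Tip x)
  then obtain y where "t' = Tip y" by (cases t') auto
  then show ?case by (intro exI[of _ id] exI[of _ "\<lambda>_. y"]) simp
next
  case (Fork v d a b)
  note F = wf_tree_Fork_att[OF Fork.prems(1)]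
  have w: "wf_tree \<Gamma> a" "wf_tree \<Gamma> b" "v \<notin> vset a" "v \<notin> vset b" using Fork.prems by auto
  obtain v' d' a' b' where t': "t' = Fork v' d' a' b'" "shape \<kappa> a = shape \<kappa>' a'" "shape \<kappa> b = shape \<kappa>' b'"
    using Fork.prems(3) by (cases t') auto
  obtain pa qa pb qb where "a' = amap pa qa a" "b' = amap pb qb b"
    using Fork.IH(1)[OF w(1) _ t'(2)] Fork.IH(2)[OF w(2) _ t'(3)] w F by metis
  from same_shape_amap_children[OF Fork.prems(1) this]
  obtain p q where "p v = v'" "a' = amap p q a" "b' = amap p q b" "d \<notin> darts a \<union> darts b \<longrightarrow> q d = d'" .
  moreover have "d \<notin> darts a \<union> darts b"
    using wf_tree_pdarts[OF w(1), of d] wf_tree_pdarts[OF w(2), of d] Fork.prems(2) F by auto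
  ultimately show ?case using t'(1) by (intro exI[of _ p] exI[of _ q]) simp
qed

text \<open>Cutting the non-tree edges forgets how they were glued. The labels restore this: \<pi>
  tells which label is glued to which, and label 0 identifies the tip to which the root edge
  returns.\<close>

definition labelling :: "(nat \<Rightarrow> nat) \<Rightarrow> mgraph \<Rightarrow> atree \<Rightarrow> (nat \<Rightarrow> nat) \<Rightarrow> bool" where
  "labelling \<pi> \<Gamma> t \<kappa> \<longleftrightarrow> inj_on \<kappa> (tips t) \<and> \<kappa> (dart t) = 0 \<and>
     (\<forall>x\<in>tips t. x \<noteq> dart t \<longrightarrow> \<kappa> (flip \<Gamma> x) = \<pi> (\<kappa> x))"

lemma same_shape_isomorphic:
  assumes sp: "spanning \<Gamma> t" "spanning \<Gamma>' t'" and lab: "labelling \<pi> \<Gamma> t \<kappa>" "labelling \<pi> \<Gamma>' t' \<kappa>'"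
    and sh: "shape \<kappa> t = shape \<kappa>' t'"
  shows "isomorphic \<Gamma> \<Gamma>'"
proof -
  have m: "multigraph \<Gamma>" "wf_tree \<Gamma> t" "vset t = verts \<Gamma>" "verts \<Gamma> \<noteq> {}"
    and m': "multigraph \<Gamma>'" "wf_tree \<Gamma>' t'" "vset t' = verts \<Gamma>'"
    using sp by (auto simp: spanning_def)
  note M = multigraphD[OF m(1)] and M' = multigraphD[OF m'(1)]
  note S = spanning_structure[OF sp(1)] and S' = spanning_structure[OF sp(2)]
  obtain v d a b where t: "t = Fork v d a b" using m(3,4) by (cases t) auto
  note F = wf_tree_Fork_att[OF m(2)[unfolded t]]
  have w: "wf_tree \<Gamma> a" "wf_tree \<Gamma> b" "v \<notin> vset a" "v \<notin> vset b" using m(2) t by auto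
  obtain v' d' a' b' where t': "t' = Fork v' d' a' b'" "shape \<kappa> a = shape \<kappa>' a'" "shape \<kappa> b = shape \<kappa>' b'"
    using sh t by (cases t') auto
  obtain pa qa pb qb where "a' = amap pa qa a" "b' = amap pb qb b"
    using same_shape_amap[OF w(1) _ t'(2)] same_shape_amap[OF w(2) _ t'(3)] w F by metis
  from same_shape_amap_children[OF m(2)[unfolded t] this]
  obtain p q where pq: "p v = v'" "a' = amap p q a" "b' = amap p q b" .
  have tt: "tips t' = q ` tips t" "pdarts t' = q ` pdarts t" using t t' pq by (auto simp: amap_sets)
  have \<kappa>q: "\<kappa>' (q x) = \<kappa> x" if "x \<in> tips t" for x
    using amap_shape[of \<kappa>' p q a \<kappa> x] amap_shape[of \<kappa>' p q b \<kappa> x] t' pq that t by auto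
  have inj: "inj_on \<kappa> (tips t)" "inj_on \<kappa>' (tips t')" using lab by (simp_all add: labelling_def)
  have \<pi>: "\<kappa> (flip \<Gamma> x) = \<pi> (\<kappa> x)" if "x \<in> tips t" "x \<noteq> dart t" for x
    using lab(1) that by (simp add: labelling_def)
  have \<pi>': "\<kappa>' (flip \<Gamma>' x) = \<pi> (\<kappa>' x)" if "x \<in> tips t'" "x \<noteq> dart t'" for x
    using lab(2) that by (simp add: labelling_def)
  \<comment> \<open>Both root darts are the unique tips labelled 0.\<close>
  have "q d = d'"
  proof -
    have "d \<in> tips t" "\<kappa> d = 0" "d' \<in> tips t'" "\<kappa>' d' = 0" using S(2) S'(2) lab t t' by (auto simp: labelling_def)
    moreover from this have "q d \<in> tips t'" "\<kappa>' (q d) = 0" using \<kappa>q[of d] tt(1) by simp_all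
    ultimately show ?thesis using inj_onD[OF inj(2), of "q d" d'] by simp
  qed
  then have t'_eq: "t' = amap p q t" using t t' pq by simp
  have wf': "wf_tree \<Gamma>' (amap p q t)" using m'(2) t'_eq by simp
  have dart': "dart t' = q (dart t)" by (simp add: t'_eq amap_sets)
  \<comment> \<open>The tree map \<open>q\<close> is meaningful on half-edges pointing down; those
    pointing up are carried along by \<open>flip\<close>. On cut edges, where both halves point
    down, the labels guarantee compatibility.\<close>
  define r where "r x = (if x \<in> pdarts t then q x else flip \<Gamma>' (q (flip \<Gamma> x)))" for x
  have pd: "x \<in> pdarts t \<Longrightarrow> x \<in> halves \<Gamma>" "x \<in> pdarts t' \<Longrightarrow> x \<in> halves \<Gamma>'" for x
    using wf_tree_pdarts[OF m(2)] wf_tree_pdarts[OF m'(2)] by auto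
  have off: "flip \<Gamma> x \<in> ndarts t \<and> flip \<Gamma> x \<in> pdarts t" if x: "x \<in> halves \<Gamma>" "x \<notin> pdarts t" for x
  proof -
    obtain y where y: "y \<in> ndarts t" "x = flip \<Gamma> y" using S(1)[OF x] by blast
    then have "flip \<Gamma> x = y" using M(5)[of y] wf_tree_ndarts[OF m(2) y(1)] by simp
    then show ?thesis using y S(5) by auto
  qed
  have qh: "x \<in> pdarts t \<Longrightarrow> q x \<in> halves \<Gamma>'" for x using pd(2) tt(2) by auto
  have flip_r: "r (flip \<Gamma> x) = flip \<Gamma>' (r x)" if x: "x \<in> halves \<Gamma>" for x
  proof (cases "x \<in> pdarts t")
    case x1: True
    show ?thesis
    proof (cases "flip \<Gamma> x \<in> pdarts t")
      case True
      have 1: "x \<in> tips t" "x \<noteq> dart t" using S(7)[OF x1 True] by auto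
      have 2: "flip \<Gamma> x \<in> tips t" using S(6)[OF 1] by simp
      have "\<kappa>' (q x) \<noteq> \<kappa>' (q (dart t))"
        using \<kappa>q[OF 1(1)] \<kappa>q[OF S(2)] inj_onD[OF inj(1) _ 1(1) S(2)] 1(2) by auto
      then have ne: "q x \<noteq> dart t'" unfolding dart' by auto
      have qx: "q x \<in> tips t'" using 1 tt by auto
      have "\<kappa>' (q (flip \<Gamma> x)) = \<kappa>' (flip \<Gamma>' (q x))"
        using \<kappa>q[OF 2] \<kappa>q[OF 1(1)] \<pi>[OF 1] \<pi>'[OF qx ne] by simp
      moreover have "q (flip \<Gamma> x) \<in> tips t'" using 2 tt by auto
      ultimately have "q (flip \<Gamma> x) = flip \<Gamma>' (q x)"
        using inj_onD[OF inj(2)] S'(6)[OF qx ne] by blast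
      then show ?thesis using True x1 by (simp add: r_def)
    next
      case False
      then show ?thesis using x1 M(5)[OF x] by (simp add: r_def)
    qed
  next
    case False
    then show ?thesis using off[OF x] M'(5)[OF qh] by (simp add: r_def)
  qed
  have att_r: "p (att \<Gamma> x) = att \<Gamma>' (r x)" if x: "x \<in> halves \<Gamma>" for x
  proof (cases "x \<in> pdarts t")
    case True
    then show ?thesis using amap_att[OF m(2) wf' True] by (simp add: r_def)
  next
    case False
    then show ?thesis using amap_att_flip[OF m(2) wf', of "flip \<Gamma> x"] off[OF x] M(5)[OF x] by (simp add: r_def)
  qed
  have r_in: "r x \<in> halves \<Gamma>'" if x: "x \<in> halves \<Gamma>" for x
    using qh off[OF x] M'(3) by (auto simp: r_def)
  have r_onto: "y \<in> r ` halves \<Gamma>" if y: "y \<in> halves \<Gamma>'" for y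
  proof (cases "y \<in> pdarts t'")
    case True
    then obtain x where "x \<in> pdarts t" "y = q x" using tt by auto
    then show ?thesis using pd by (auto simp: r_def intro!: image_eqI[of _ _ x])
  next
    case False
    then obtain z where z: "z \<in> ndarts t'" "y = flip \<Gamma>' z" using S'(1) y by blast
    then have "z \<in> pdarts t'" using S'(5) by auto
    then obtain x where x: "x \<in> pdarts t" "z = q x" using tt by auto
    then have "y = r (flip \<Gamma> x)" using flip_r[of x] pd z by (simp add: r_def)
    then show ?thesis using x pd M(3) by auto
  qed
  \<comment> \<open>Only surjectivity of \<open>p\<close> and \<open>r\<close> is shown directly.
    Injectivity follows by counting: equally many tips give equally many vertices, and regularity
    then gives equally many half-edges.\<close>
  have cV: "verts \<Gamma>' = p ` verts \<Gamma>" using t'_eq m(3) m'(3) by (auto simp: amap_sets)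
  have "card (tips t') = card (tips t)"
  proof -
    have "inj_on q (tips t)"
      by (rule inj_onI) (metis \<kappa>q inj(1) inj_onD)
    then show ?thesis unfolding tt(1) by (rule card_image)
  qed
  then have cv: "card (verts \<Gamma>') = card (verts \<Gamma>)"
    using card_tips[OF m(2)] card_tips[OF m'(2)] m m' by simp
  then have ip: "inj_on p (verts \<Gamma>)" using cV M(1) by (simp add: eq_card_imp_inj_on)
  have rH: "halves \<Gamma>' = r ` halves \<Gamma>" using r_in r_onto by auto
  have "card (halves \<Gamma>') = card (halves \<Gamma>)"
    using card_halves_regular[OF m(1) spanning_cubic(2)[OF sp(1)]]
      card_halves_regular[OF m'(1) spanning_cubic(2)[OF sp(2)]] cv by simp
  then have ir: "inj_on r (halves \<Gamma>)" using rH M(2) by (simp add: eq_card_imp_inj_on)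
  show ?thesis unfolding isomorphic_def
    using cV ip rH ir flip_r att_r by (intro exI[of _ p] exI[of _ r]) (auto simp: bij_betw_def)
qed

text \<open>Pairs 1 with 2, 3 with 4, and so on; label 0 is reserved for the root dart.\<close>

definition partner :: "nat \<Rightarrow> nat" where
  "partner k = (if odd k then k + 1 else k - 1)"

text \<open>The orbits of the involution are removed one by one. Evenness is part of the induction
  because the labels \<open>card ?T + 1\<close> and \<open>card ?T + 2\<close> of the last orbit are
  partners only if \<open>card ?T\<close> is even.\<close>

lemma pairing_exists:
  "finite S \<Longrightarrow> (\<And>x. x \<in> S \<Longrightarrow> f x \<in> S \<and> f x \<noteq> x \<and> f (f x) = x) \<Longrightarrow>
   even (card S) \<and> (\<exists>\<kappa>. bij_betw \<kappa> S {1..card S} \<and> (\<forall>x\<in>S. \<kappa> (f x) = partner (\<kappa> x)))"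
proof (induction "card S" arbitrary: S rule: less_induct)
  case less
  show ?case
  proof (cases "S = {}")
    case True
    then show ?thesis by (auto simp: bij_betw_def)
  next
    case False
    then obtain x where x: "x \<in> S" by auto
    have fx: "f x \<in> S" "f x \<noteq> x" "f (f x) = x" using less.prems(2)[OF x] by auto
    let ?T = "S - {x, f x}"
    have S: "S = insert x (insert (f x) ?T)" using x fx by auto
    have cS: "card S = card ?T + 2"
    proof -
      have "card S = card (insert x (insert (f x) ?T))" using S by simp
      also have "\<dots> = card ?T + 2" using less.prems(1) fx by simp
      finally show ?thesis .
    qed
    have T: "f y \<in> ?T \<and> f y \<noteq> y \<and> f (f y) = y" if "y \<in> ?T" for y
      using that less.prems(2)[of y] fx by auto
    have ev: "even (card ?T)" and "\<exists>\<kappa>. bij_betw \<kappa> ?T {1..card ?T} \<and> (\<forall>y\<in>?T. \<kappa> (f y) = partner (\<kappa> y))"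
      using less.hyps[of ?T] cS less.prems(1) T by auto
    then obtain \<kappa> where k: "bij_betw \<kappa> ?T {1..card ?T}" "\<forall>y\<in>?T. \<kappa> (f y) = partner (\<kappa> y)" by blast
    define l where "l = \<kappa>(x := card ?T + 1, f x := card ?T + 2)"
    have l: "l x = card ?T + 1" "l (f x) = card ?T + 2" "y \<in> ?T \<Longrightarrow> l y = \<kappa> y" for y
      using fx by (auto simp: l_def)
    have "bij_betw l ?T {1..card ?T}" using k(1) l(3) bij_betw_cong[of ?T l \<kappa> "{1..card ?T}"] by blast
    moreover have "bij_betw l {x, f x} {card ?T + 1, card ?T + 2}"
      using l fx by (auto simp: bij_betw_def inj_on_def)
    ultimately have "bij_betw l (?T \<union> {x, f x}) ({1..card ?T} \<union> {card ?T + 1, card ?T + 2})"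
      by (rule bij_betw_combine) auto
    moreover have "?T \<union> {x, f x} = S" using S by auto
    moreover have "{1..card ?T} \<union> {card ?T + 1, card ?T + 2} = {1..card S}" using cS by auto
    ultimately have b: "bij_betw l S {1..card S}" by simp
    have "l (f y) = partner (l y)" if y: "y \<in> S" for y
    proof -
      consider "y = x" | "y = f x" | "y \<in> ?T" using y by auto
      then show ?thesis
      proof cases
        case 3
        then show ?thesis using l(3)[of y] l(3)[of "f y"] T[of y] k(2) by simp
      qed (use l fx ev in \<open>auto simp: partner_def\<close>)
    qed
    then show ?thesis using b ev cS by auto
  qed
qed

lemma labelling_exists:
  assumes sp: "spanning \<Gamma> t"
  obtains \<kappa> where "labelling partner \<Gamma> t \<kappa>" "\<kappa> ` tips t = {..card (verts \<Gamma>)}"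
proof -
  have m: "multigraph \<Gamma>" "wf_tree \<Gamma> t" "vset t = verts \<Gamma>" using sp by (auto simp: spanning_def)
  note M = multigraphD[OF m(1)] and S = spanning_structure[OF sp]
  let ?S = "tips t - {dart t}"
  have th: "x \<in> tips t \<Longrightarrow> x \<in> halves \<Gamma>" for x using S(3) wf_tree_pdarts[OF m(2)] by auto
  have c: "card ?S = card (verts \<Gamma>)" using card_tips[OF m(2)] m(3) S(2) finite_atree by simp
  have "\<exists>\<kappa>. bij_betw \<kappa> ?S {1..card ?S} \<and> (\<forall>x\<in>?S. \<kappa> (flip \<Gamma> x) = partner (\<kappa> x))"
    using pairing_exists[of ?S "flip \<Gamma>"] finite_atree S(6) M th by auto
  then obtain \<kappa> where k: "bij_betw \<kappa> ?S {1..card ?S}" "\<forall>x\<in>?S. \<kappa> (flip \<Gamma> x) = partner (\<kappa> x)" by blast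
  define l where "l = \<kappa>(dart t := 0)"
  have "bij_betw l ?S {1..card ?S}" using k(1) bij_betw_cong[of ?S l \<kappa> "{1..card ?S}"] by (simp add: l_def)
  moreover have "bij_betw l {dart t} {0}" by (simp add: l_def bij_betw_def)
  ultimately have "bij_betw l (?S \<union> {dart t}) ({1..card ?S} \<union> {0})" by (rule bij_betw_combine) auto
  moreover have "?S \<union> {dart t} = tips t" using S(2) by auto
  moreover have "{1..card ?S} \<union> {0} = {..card ?S}" by auto
  ultimately have b: "bij_betw l (tips t) {..card (verts \<Gamma>)}" using c by simp
  have "l (flip \<Gamma> x) = partner (l x)" if "x \<in> tips t" "x \<noteq> dart t" for x
    using that k(2) S(6)[OF that] by (simp add: l_def)
  then have "labelling partner \<Gamma> t l" using b by (auto simp: labelling_def l_def bij_betw_def)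
  then show ?thesis using that b by (auto simp: bij_betw_def)
qed

definition sorted_graph :: "mgraph \<Rightarrow> bool" where
  "sorted_graph \<Gamma> \<longleftrightarrow> (\<exists>t \<kappa>. spanning \<Gamma> t \<and> labelling partner \<Gamma> t \<kappa> \<and>
     \<kappa> ` tips t = {..card (verts \<Gamma>)} \<and> trie (shape \<kappa> t))"

lemma sorted_graph_unique:
  assumes "sorted_graph \<Gamma>" "sorted_graph \<Gamma>'" "card (verts \<Gamma>) = card (verts \<Gamma>')"
  shows "iso_class \<Gamma> = iso_class \<Gamma>'"
proof -
  obtain t \<kappa> t' \<kappa>' where *: "spanning \<Gamma> t" "labelling partner \<Gamma> t \<kappa>" "\<kappa> ` tips t = {..card (verts \<Gamma>)}" "trie (shape \<kappa> t)"
    "spanning \<Gamma>' t'" "labelling partner \<Gamma>' t' \<kappa>'" "\<kappa>' ` tips t' = {..card (verts \<Gamma>')}" "trie (shape \<kappa>' t')"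
    using assms(1,2) unfolding sorted_graph_def by metis
  then have "shape \<kappa> t = shape \<kappa>' t'" using assms(3) by (intro trie_unique) (auto simp: keys_shape)
  then have "isomorphic \<Gamma> \<Gamma>'" using same_shape_isomorphic * by blast
  then show ?thesis using * iso_class_eqI by (auto simp: spanning_def)
qed

text \<open>The labels are at most \<open>2 * g - 2\<close>, so they fit into \<open>k\<close> bits.
  The height does not depend on the labelling, which is why the bound can be stated with
  \<open>id\<close>.\<close>

lemma sort_graph:
  assumes sp: "spanning \<Gamma> t" and c: "card (verts \<Gamma>) + 2 = 2 * g" and k: "2 * g \<le> 2 ^ k"
  obtains \<Gamma>' where "sorted_graph \<Gamma>'" "(iso_class \<Gamma>, iso_class \<Gamma>') \<in> simul_rel g ^^ (3 * (k + ht (shape id t)))"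
    "card (verts \<Gamma>') = card (verts \<Gamma>)" "\<Gamma>' \<in> cubic_graphs g"
proof -
  obtain \<kappa> where \<kappa>: "labelling partner \<Gamma> t \<kappa>" "\<kappa> ` tips t = {..card (verts \<Gamma>)}" using labelling_exists[OF sp] .
  have wf: "wf_tree \<Gamma> t" using sp by (simp add: spanning_def)
  have "disjoint_keys (shape \<kappa> t)" using disjoint_keys_shape[OF wf] \<kappa>(1) by (simp add: labelling_def)
  moreover have "keys (shape \<kappa> t) \<subseteq> {..<2 ^ k}" using \<kappa>(2) c k by (auto simp: keys_shape)
  ultimately obtain s where s: "(par ^^ (3 * (k + ht (shape \<kappa> t)))) (shape \<kappa> t) s" "trie s" by (rule par_sort)
  have "ht (shape \<kappa> t) = ht (shape id t)" by (induction t) auto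
  with par_relpow_simul_rel[OF sp c s(1)] obtain \<Gamma>' t' where *: "spanning \<Gamma>' t'"
    "(iso_class \<Gamma>, iso_class \<Gamma>') \<in> simul_rel g ^^ (3 * (k + ht (shape id t)))" "shape \<kappa> t' = s"
    "flip \<Gamma>' = flip \<Gamma>" "verts \<Gamma>' = verts \<Gamma>" "same_frame t t'" by metis
  have "sorted_graph \<Gamma>'"
    unfolding sorted_graph_def using * \<kappa> s(2)
    by (intro exI[of _ t'] exI[of _ \<kappa>]) (auto simp: labelling_def same_frame_def)
  moreover have "\<Gamma>' \<in> cubic_graphs g"
    using *(1,5) c spanning_cubic[OF *(1)] by (auto simp: cubic_graphs_iff spanning_def)
  ultimately show ?thesis using that * by auto
qed

section \<open>Spanning trees of small height\<close>

definition rel_dist :: "('a \<times> 'a) set \<Rightarrow> 'a \<Rightarrow> 'a \<Rightarrow> nat" where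
  "rel_dist R u v = (LEAST n. (u, v) \<in> R ^^ n)"

lemma rel_dist_relpow: "(u, v) \<in> R ^^ n \<Longrightarrow> (u, v) \<in> R ^^ rel_dist R u v"
  unfolding rel_dist_def by (rule LeastI)

lemma rel_dist_le: "(u, v) \<in> R ^^ n \<Longrightarrow> rel_dist R u v \<le> n"
  unfolding rel_dist_def by (rule Least_le)

lemma rel_dist_pred:
  assumes "(u, v) \<in> R ^^ n" "u \<noteq> v"
  obtains w where "(w, v) \<in> R" "(u, w) \<in> R ^^ rel_dist R u w" "rel_dist R u v = Suc (rel_dist R u w)"
proof -
  have r: "(u, v) \<in> R ^^ rel_dist R u v" using assms(1) by (rule rel_dist_relpow)
  then obtain k where k: "rel_dist R u v = Suc k" using assms(2) by (cases "rel_dist R u v") auto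
  then obtain w where w: "(u, w) \<in> R ^^ k" "(w, v) \<in> R" using r by auto
  have u: "(u, w) \<in> R ^^ rel_dist R u w" "rel_dist R u w \<le> k"
    using rel_dist_relpow[OF w(1)] rel_dist_le[OF w(1)] by auto
  have "(u, v) \<in> R ^^ Suc (rel_dist R u w)" using u(1) w(2) by auto
  then have "rel_dist R u v \<le> Suc (rel_dist R u w)" by (rule rel_dist_le)
  then show ?thesis using that[OF w(2) u(1)] u(2) k by simp
qed

lemma relpow_sym: "(\<And>u v. (u, v) \<in> R \<Longrightarrow> (v, u) \<in> R) \<Longrightarrow> (u, v) \<in> R ^^ n \<Longrightarrow> (v, u) \<in> R ^^ n"
proof (induction n arbitrary: v)
  case (Suc n)
  then obtain w where "(u, w) \<in> R ^^ n" "(w, v) \<in> R" by auto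
  then have "(w, u) \<in> R ^^ n" "(v, w) \<in> R" using Suc by auto
  then show ?case by (rule relpow_Suc_I2[rotated])
qed auto

definition adj_without :: "mgraph \<Rightarrow> nat set \<Rightarrow> (nat \<times> nat) set" where
  "adj_without \<Gamma> e = {(att \<Gamma> h, att \<Gamma> (flip \<Gamma> h)) | h. h \<in> halves \<Gamma> - e}"

lemma adj_withoutI: "h \<in> halves \<Gamma> \<Longrightarrow> h \<notin> e \<Longrightarrow> (att \<Gamma> h, att \<Gamma> (flip \<Gamma> h)) \<in> adj_without \<Gamma> e"
  by (auto simp: adj_without_def)

text \<open>The root is to hang from an edge outside the spanning tree. Some edge is missed by a
  breadth-first tree, and after deleting it any two vertices are still joined through the old root,
  which at most doubles the distance bound.\<close>

lemma nontree_edge: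
  assumes m: "multigraph \<Gamma>" and r: "regular 3 \<Gamma>" and ne: "verts \<Gamma> \<noteq> {}" and D: "diam_le \<Gamma> D"
  obtains h where "h \<in> halves \<Gamma>"
    "\<And>u v. u \<in> verts \<Gamma> \<Longrightarrow> v \<in> verts \<Gamma> \<Longrightarrow> \<exists>k\<le>2 * D. (u, v) \<in> adj_without \<Gamma> {h, flip \<Gamma> h} ^^ k"
proof -
  note M = multigraphD[OF m]
  obtain v0 where v0: "v0 \<in> verts \<Gamma>" using ne by auto
  let ?d = "rel_dist (adj \<Gamma>) v0"
  have "\<exists>h\<in>halves \<Gamma>. att \<Gamma> h = v \<and> ?d v = Suc (?d (att \<Gamma> (flip \<Gamma> h)))" if v: "v \<in> verts \<Gamma> - {v0}" for v
  proof -
    obtain n where n: "(v0, v) \<in> adj \<Gamma> ^^ n" using D v0 v unfolding diam_le_def by blast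
    obtain w where w: "(w, v) \<in> adj \<Gamma>" "?d v = Suc (?d w)" using rel_dist_pred[OF n] v by auto
    then have "(v, w) \<in> adj \<Gamma>" using adj_sym[OF m] by blast
    then show ?thesis using w(2) unfolding adj_def by auto
  qed
  then obtain up where up: "\<And>v. v \<in> verts \<Gamma> - {v0} \<Longrightarrow>
      up v \<in> halves \<Gamma> \<and> att \<Gamma> (up v) = v \<and> ?d v = Suc (?d (att \<Gamma> (flip \<Gamma> (up v))))"
    by metis
  \<comment> \<open>A tree edge for each vertex but the root makes at most |V| - 1 edges, whereas a
    cubic graph has at least |V|.\<close>
  let ?T = "(\<lambda>v. {up v, flip \<Gamma> (up v)}) ` (verts \<Gamma> - {v0})"
  have "card ?T \<le> card (verts \<Gamma> - {v0})" using M(1) by (intro card_image_le) auto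
  also have "\<dots> < card (verts \<Gamma>)" using M(1) v0 by (rule card_Diff1_less)
  also have "\<dots> \<le> card (edges \<Gamma>)" using card_halves_eq_edges[OF m] card_halves_regular[OF m r] by linarith
  finally have "\<not> edges \<Gamma> \<subseteq> ?T" using card_mono[of ?T "edges \<Gamma>"] M(1) by auto
  then obtain h where h: "h \<in> halves \<Gamma>" "{h, flip \<Gamma> h} \<notin> ?T" by (auto simp: edges_def)
  let ?A = "adj_without \<Gamma> {h, flip \<Gamma> h}"
  have symA: "(v, u) \<in> ?A" if uv: "(u, v) \<in> ?A" for u v
  proof -
    obtain k where k: "k \<in> halves \<Gamma>" "k \<notin> {h, flip \<Gamma> h}" "u = att \<Gamma> k" "v = att \<Gamma> (flip \<Gamma> k)"
      using uv unfolding adj_without_def by blast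
    have "flip \<Gamma> k \<notin> {h, flip \<Gamma> h}" using k(2) M(5)[OF k(1)] M(5)[OF h(1)] by auto
    then show ?thesis using k M(3)[OF k(1)] M(5)[OF k(1)] unfolding adj_without_def
      by (auto intro!: exI[of _ "flip \<Gamma> k"])
  qed
  have to_root: "v \<in> verts \<Gamma> \<Longrightarrow> (v, v0) \<in> ?A ^^ ?d v" for v
  proof (induction "?d v" arbitrary: v)
    case 0
    then have "v = v0" using up[of v] by fastforce
    then show ?case using 0 by auto
  next
    case (Suc n)
    show ?case
    proof (cases "v = v0")
      case True
      then have "?d v = 0" using rel_dist_le[of v0 v0 0 "adj \<Gamma>"] by simp
      then show ?thesis using True by simp
    next
      case False
      then have u: "up v \<in> halves \<Gamma>" "att \<Gamma> (up v) = v" "?d v = Suc (?d (att \<Gamma> (flip \<Gamma> (up v))))"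
        using up[of v] Suc.prems by auto
      have "{up v, flip \<Gamma> (up v)} \<in> ?T" using Suc.prems False by blast
      then have "{up v, flip \<Gamma> (up v)} \<noteq> {h, flip \<Gamma> h}" using h(2) by metis
      moreover have "{flip \<Gamma> h, flip \<Gamma> (flip \<Gamma> h)} = {h, flip \<Gamma> h}" using M(5)[OF h(1)] by auto
      ultimately have "up v \<notin> {h, flip \<Gamma> h}" by (metis insertE singletonD)
      then have "(v, att \<Gamma> (flip \<Gamma> (up v))) \<in> ?A" using adj_withoutI[OF u(1)] u(2) by metis
      moreover have "(att \<Gamma> (flip \<Gamma> (up v)), v0) \<in> ?A ^^ n"
        using Suc.hyps(1)[of "att \<Gamma> (flip \<Gamma> (up v))"] Suc.hyps(2) u M by simp
      ultimately show ?thesis unfolding Suc.hyps(2)[symmetric] by (rule relpow_Suc_I2)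
    qed
  qed
  have dD: "?d v \<le> D" if v: "v \<in> verts \<Gamma>" for v
  proof -
    obtain k where "k \<le> D" "(v0, v) \<in> adj \<Gamma> ^^ k" using D v0 v unfolding diam_le_def by blast
    then show ?thesis using rel_dist_le[of v0 v k "adj \<Gamma>"] by simp
  qed
  show ?thesis
  proof (rule that[OF h(1)])
    fix u v assume uv: "u \<in> verts \<Gamma>" "v \<in> verts \<Gamma>"
    have "(v0, v) \<in> ?A ^^ ?d v" using relpow_sym[OF symA to_root[OF uv(2)]] .
    then have "(u, v) \<in> ?A ^^ (?d u + ?d v)" using to_root[OF uv(1)] by (auto simp: relpow_add)
    moreover have "?d u + ?d v \<le> 2 * D" using dD[OF uv(1)] dD[OF uv(2)] by simp
    ultimately show "\<exists>k\<le>2 * D. (u, v) \<in> ?A ^^ k" by blast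
  qed
qed

text \<open>The invariant of breadth-first growth: the level of a vertex in the tree is its
  distance, so the height is bounded by the distances.\<close>

fun depth_ok :: "(nat \<Rightarrow> nat) \<Rightarrow> nat \<Rightarrow> atree \<Rightarrow> bool" where
  "depth_ok \<delta> i (Tip x) \<longleftrightarrow> True"
| "depth_ok \<delta> i (Fork v p a b) \<longleftrightarrow> \<delta> v = i \<and> depth_ok \<delta> (Suc i) a \<and> depth_ok \<delta> (Suc i) b"

lemma depth_ok_ht:
  "depth_ok \<delta> i t \<Longrightarrow> (\<And>v. v \<in> vset t \<Longrightarrow> \<delta> v \<le> m) \<Longrightarrow> i \<le> Suc m \<Longrightarrow> ht (shape \<kappa> t) + i \<le> Suc m"
proof (induction t arbitrary: i)
  case (Fork v p a b)
  have "i \<le> m" using Fork.prems(1) Fork.prems(2)[of v] by simp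
  then have "ht (shape \<kappa> a) + Suc i \<le> Suc m" "ht (shape \<kappa> b) + Suc i \<le> Suc m"
    using Fork.IH(1)[of "Suc i"] Fork.IH(2)[of "Suc i"] Fork.prems by auto
  then show ?case by simp
qed auto

text \<open>The tip \<open>x\<close> is replaced by a fork at \<open>w\<close>. The level is right
  because it exceeds that of the parent \<open>att \<Gamma> x\<close> by one; when the whole tree is
  the tip, there is no parent inside it and the level is a hypothesis.\<close>

lemma grow_tree:
  assumes w: "halves_at \<Gamma> w = {flip \<Gamma> x, y, z}"
    "card {flip \<Gamma> x, y, z} = 3" and x: "x \<in> halves \<Gamma>" and d: "\<delta> w = Suc (\<delta> (att \<Gamma> x))"
  shows "wf_tree \<Gamma> t \<Longrightarrow> depth_ok \<delta> i t \<Longrightarrow> x \<in> tips t \<Longrightarrow> w \<notin> vset t \<Longrightarrow> (t = Tip x \<Longrightarrow> i = \<delta> w) \<Longrightarrow>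
    \<exists>t'. wf_tree \<Gamma> t' \<and> depth_ok \<delta> i t' \<and> vset t' = insert w (vset t) \<and> dart t' = dart t"
proof (induction t arbitrary: i)
  case (Tip u)
  then show ?case using w x by (intro exI[of _ "Fork w x (Tip y) (Tip z)"]) auto
next
  case (Fork v p a b)
  note F = wf_tree_Fork_att[OF Fork.prems(1)]
  have wf: "wf_tree \<Gamma> a" "wf_tree \<Gamma> b" "depth_ok \<delta> (Suc i) a" "depth_ok \<delta> (Suc i) b"
    "w \<notin> vset a" "w \<notin> vset b" "w \<noteq> v" "\<delta> v = i" using Fork.prems by auto
  consider "x \<in> tips a" | "x \<in> tips b" using Fork.prems(3) by auto
  then show ?case
  proof cases
    case 1
    have "a = Tip x \<Longrightarrow> Suc i = \<delta> w" using d F wf(8) by auto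
    from Fork.IH(1)[OF wf(1,3) 1 wf(5) this] obtain a' where
      "wf_tree \<Gamma> a'" "depth_ok \<delta> (Suc i) a'" "vset a' = insert w (vset a)" "dart a' = dart a" by blast
    then show ?thesis using Fork.prems wf by (intro exI[of _ "Fork v p a' b"]) auto
  next
    case 2
    have "b = Tip x \<Longrightarrow> Suc i = \<delta> w" using d F wf(8) by auto
    from Fork.IH(2)[OF wf(2,4) 2 wf(6) this] obtain b' where
      "wf_tree \<Gamma> b'" "depth_ok \<delta> (Suc i) b'" "vset b' = insert w (vset b)" "dart b' = dart b" by blast
    then show ?thesis using Fork.prems wf by (intro exI[of _ "Fork v p a b'"]) auto
  qed
qed

lemma card_3_obtain:
  assumes "card S = 3" "s \<in> S"
  obtains y z where "S = {s, y, z}" "card {s, y, z} = 3"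
proof -
  have "card (S - {s}) = 2" using assms by (simp add: card_Diff_singleton)
  then obtain y z where "S - {s} = {y, z}" by (auto simp: card_2_iff)
  then have "S = {s, y, z}" using assms(2) by auto
  then show ?thesis using that assms(1) by auto
qed

text \<open>A largest partial breadth-first tree is spanning: the predecessor of a nearest missing
  vertex \<open>w\<close> lies in the tree, and the edge from there to \<open>w\<close> starts at a
  tip, where the tree could be extended.\<close>

lemma spanning_tree_exists:
  assumes m: "multigraph \<Gamma>" and r: "regular 3 \<Gamma>" and ne: "verts \<Gamma> \<noteq> {}" and D: "diam_le \<Gamma> D"
  obtains t where "spanning \<Gamma> t" "ht (shape \<kappa> t) \<le> 2 * D + 1"
proof -
  note M = multigraphD[OF m]
  obtain r where h: "r \<in> halves \<Gamma>" and near: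
    "\<And>u v. u \<in> verts \<Gamma> \<Longrightarrow> v \<in> verts \<Gamma> \<Longrightarrow> \<exists>k\<le>2 * D. (u, v) \<in> adj_without \<Gamma> {r, flip \<Gamma> r} ^^ k"
    using nontree_edge[OF m assms(2) ne D] by metis
  let ?A = "adj_without \<Gamma> {r, flip \<Gamma> r}"
  define v1 where "v1 = att \<Gamma> r"
  let ?d = "rel_dist ?A v1"
  have v1: "v1 \<in> verts \<Gamma>" "r \<in> halves_at \<Gamma> v1" using h M by (auto simp: v1_def halves_at_def)
  have three: "card (halves_at \<Gamma> v) = 3" if "v \<in> verts \<Gamma>" for v using assms(2) that by (simp add: regular_def)
  define I where "I t \<longleftrightarrow> wf_tree \<Gamma> t \<and> depth_ok ?d 0 t \<and> dart t = flip \<Gamma> r \<and> vset t \<subseteq> verts \<Gamma> \<and> v1 \<in> vset t" for t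
  obtain y z where yz: "halves_at \<Gamma> v1 = {r, y, z}" "card {r, y, z} = 3"
    using card_3_obtain[OF three[OF v1(1)] v1(2)] .
  have "?d v1 = 0" using rel_dist_le[of v1 v1 0 ?A] by simp
  then have "I (Fork v1 (flip \<Gamma> r) (Tip y) (Tip z))"
    using yz v1 M(3,5)[OF h] by (simp add: I_def)
  then have ex: "\<exists>t. I t" by blast
  have bd: "\<forall>t. I t \<longrightarrow> card (vset t) < Suc (card (verts \<Gamma>))"
    using M(1) by (auto simp: I_def less_Suc_eq_le intro: card_mono)
  obtain t where t: "I t" and max: "\<And>t'. I t' \<Longrightarrow> card (vset t') \<le> card (vset t)"
    using ex_has_greatest_nat[OF _ bd] ex by metis
  have wf: "wf_tree \<Gamma> t" "depth_ok ?d 0 t" "dart t = flip \<Gamma> r" "vset t \<subseteq> verts \<Gamma>" "v1 \<in> vset t"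
    using t by (auto simp: I_def)
  have "vset t = verts \<Gamma>"
  proof (rule ccontr)
    assume "vset t \<noteq> verts \<Gamma>"
    then have "\<exists>w. w \<in> verts \<Gamma> - vset t" using wf by auto
    then obtain w where w: "w \<in> verts \<Gamma>" "w \<notin> vset t"
      and least: "\<And>u. u \<in> verts \<Gamma> \<Longrightarrow> u \<notin> vset t \<Longrightarrow> ?d w \<le> ?d u"
      using ex_has_least_nat[of "\<lambda>w. w \<in> verts \<Gamma> - vset t" _ ?d] by (metis DiffD1 DiffD2 DiffI)
    obtain n where "(v1, w) \<in> ?A ^^ n" using near[OF v1(1) w(1)] by blast
    moreover have "v1 \<noteq> w" using w wf by auto
    ultimately obtain u where u: "(u, w) \<in> ?A" "?d w = Suc (?d u)" using rel_dist_pred by metis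
    then obtain x where x: "x \<in> halves \<Gamma>" "x \<notin> {r, flip \<Gamma> r}" "u = att \<Gamma> x" "w = att \<Gamma> (flip \<Gamma> x)"
      unfolding adj_without_def by blast
    have "u \<in> vset t"
    proof (rule ccontr)
      assume "u \<notin> vset t"
      then have "?d w \<le> ?d u" using least M(6)[OF x(1)] x(3) by simp
      then show False using u(2) by simp
    qed
    then have xt: "x \<in> pdarts t \<or> x \<in> flip \<Gamma> ` ndarts t"
      using wf_tree_halves_at[OF wf(1)] x by (auto simp: halves_at_def)
    \<comment> \<open>If \<open>x\<close> led upwards, its other end would be the parent and
      \<open>w\<close> would be in the tree. The one upward half without a parent in the tree is the
      root half \<open>r\<close>, which the deleted edge excludes.\<close>
    have "x \<notin> flip \<Gamma> ` ndarts t"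
    proof
      assume "x \<in> flip \<Gamma> ` ndarts t"
      then obtain q where q: "q \<in> ndarts t" "x = flip \<Gamma> q" by auto
      then have fx: "flip \<Gamma> x = q" using wf_tree_ndarts[OF wf(1)] M(5)[of q] by simp
      have "q \<in> darts t" using q darts_eq by auto
      moreover have "q \<noteq> dart t" using x(2) q(2) wf(3) M(5)[OF h] by auto
      ultimately have "att \<Gamma> q \<in> vset t" using wf_tree_pdarts[OF wf(1)] by auto
      then show False using fx x(4) w by simp
    qed
    then have "x \<in> darts t" using xt by auto
    moreover have "x \<notin> ndarts t" using wf_tree_ndarts[OF wf(1), of x] x(4) w(2) by auto
    ultimately have xtip: "x \<in> tips t" using darts_eq by auto
    have "flip \<Gamma> x \<in> halves_at \<Gamma> w" using x M by (auto simp: halves_at_def)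
    then obtain y z where yz: "halves_at \<Gamma> w = {flip \<Gamma> x, y, z}" "card {flip \<Gamma> x, y, z} = 3"
      using card_3_obtain[OF three[OF w(1)]] by metis
    have "t \<noteq> Tip x" using wf(5) by auto
    then obtain t' where t': "wf_tree \<Gamma> t'" "depth_ok ?d 0 t'" "vset t' = insert w (vset t)" "dart t' = dart t"
      using grow_tree[OF yz x(1) _ wf(1,2) xtip w(2)] u(2) x(3) by blast
    then have "I t'" using wf w by (auto simp: I_def)
    then show False using max[of t'] t'(3) w(2) finite_atree by simp
  qed
  then have sp: "spanning \<Gamma> t" using wf m ne by (auto simp: spanning_def)
  have "?d v \<le> 2 * D" if v: "v \<in> vset t" for v
  proof -
    obtain k where "k \<le> 2 * D" "(v1, v) \<in> ?A ^^ k" using near[OF v1(1)] v wf(4) by blast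
    then show ?thesis using rel_dist_le[of v1 v k ?A] by simp
  qed
  then have "ht (shape \<kappa> t) + 0 \<le> Suc (2 * D)" using depth_ok_ht[OF wf(2)] by blast
  then show ?thesis using that sp by simp
qed

section \<open>Expanders have logarithmic diameter\<close>

definition vball :: "mgraph \<Rightarrow> nat \<Rightarrow> nat \<Rightarrow> nat set" where
  "vball \<Gamma> v i = {w \<in> verts \<Gamma>. \<exists>k\<le>i. (v, w) \<in> adj \<Gamma> ^^ k}"

definition induced :: "mgraph \<Rightarrow> nat set \<Rightarrow> mgraph" where
  "induced \<Gamma> B = \<Gamma>\<lparr>verts := B, halves := {h \<in> halves \<Gamma>. att \<Gamma> h \<in> B \<and> att \<Gamma> (flip \<Gamma> h) \<in> B}\<rparr>"

lemma subgraph_induced: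
  assumes "multigraph \<Gamma>" "B \<subseteq> verts \<Gamma>"
  shows "subgraph (induced \<Gamma> B) \<Gamma>"
proof -
  note M = multigraphD[OF assms(1)]
  have "finite B" using M(1) assms(2) finite_subset by blast
  then show ?thesis using M assms(2) by (auto simp: subgraph_def multigraph_def induced_def)
qed

lemma edges_induced: "edges (induced \<Gamma> B) = {e \<in> edges \<Gamma>. ends \<Gamma> e \<subseteq> B}"
  by (auto simp: edges_def induced_def ends_def)

lemma finite_edges: "multigraph \<Gamma> \<Longrightarrow> finite (edges \<Gamma>)"
  by (simp add: edges_def multigraph_def)

lemma edges_subgraph: "subgraph \<Delta> \<Gamma> \<Longrightarrow> edges \<Delta> \<subseteq> edges \<Gamma>"
  by (auto simp: subgraph_def edges_def)

text \<open>There are infinitely many subgraph records, because \<open>flip\<close> and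
  \<open>att\<close> are arbitrary off the half-edges. But the quotients are formed from numbers up
  to |E|, so \<open>Min\<close> ranges over a finite set.\<close>

lemma cheeger_le:
  assumes "multigraph \<Gamma>" "subgraph \<Delta> \<Gamma>" "1 \<le> card (edges \<Delta>)"
    "real (card (edges \<Delta>)) \<le> real (card (edges \<Gamma>)) / 2"
  shows "cheeger \<Gamma> \<le> real (card (boundary \<Gamma> \<Delta>)) / real (card (edges \<Delta>))"
proof -
  let ?N = "card (edges \<Gamma>)"
  let ?S = "{real (card (boundary \<Gamma> \<Delta>)) / real (card (edges \<Delta>)) | \<Delta>.
    subgraph \<Delta> \<Gamma> \<and> 1 \<le> card (edges \<Delta>) \<and> real (card (edges \<Delta>)) \<le> real (card (edges \<Gamma>)) / 2}"
  have "?S \<subseteq> (\<lambda>(a, b). real a / real b) ` ({..?N} \<times> {..?N})"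
  proof
    fix x assume "x \<in> ?S"
    then obtain \<Delta> where D: "subgraph \<Delta> \<Gamma>" "x = real (card (boundary \<Gamma> \<Delta>)) / real (card (edges \<Delta>))" by blast
    have "card (edges \<Delta>) \<le> ?N" using edges_subgraph[OF D(1)] finite_edges[OF assms(1)] by (rule card_mono[rotated])
    moreover have "card (boundary \<Gamma> \<Delta>) \<le> ?N"
      using edges_subgraph[OF D(1)] by (intro card_mono finite_edges[OF assms(1)]) (auto simp: boundary_def)
    ultimately show "x \<in> (\<lambda>(a, b). real a / real b) ` ({..?N} \<times> {..?N})" using D(2) by force
  qed
  then have "finite ?S" by (rule finite_subset) auto
  then show ?thesis unfolding cheeger_def using assms(2-4) by (intro Min_le) auto
qed

text \<open>Each boundary edge of the ball meets an edge \<open>f\<close> leaving it, and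
  \<open>f\<close> is new in the next larger ball. Such an \<open>f\<close> has a single end in the
  ball, where only two other half-edges are attached, so it accounts for at most two boundary
  edges.\<close>

lemma boundary_ball_le:
  assumes m: "multigraph \<Gamma>" and r: "regular 3 \<Gamma>"
  shows "card (boundary \<Gamma> (induced \<Gamma> (vball \<Gamma> v i))) \<le>
    2 * card (edges (induced \<Gamma> (vball \<Gamma> v (Suc i))) - edges (induced \<Gamma> (vball \<Gamma> v i)))"
proof -
  note M = multigraphD[OF m]
  let ?B = "vball \<Gamma> v i" and ?E = "\<lambda>i. edges (induced \<Gamma> (vball \<Gamma> v i))"
  let ?F = "?E (Suc i) - ?E i"
  let ?N = "\<lambda>f. {e \<in> ?E i. ends \<Gamma> e \<inter> ends \<Gamma> f \<noteq> {}}"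
  have step: "w \<in> vball \<Gamma> v (Suc i)" if "u \<in> ?B" "(u, w) \<in> adj \<Gamma>" for u w
  proof -
    obtain k where "k \<le> i" "(v, u) \<in> adj \<Gamma> ^^ k" using \<open>u \<in> ?B\<close> by (auto simp: vball_def)
    then have "Suc k \<le> Suc i" "(v, w) \<in> adj \<Gamma> ^^ Suc k" using that by auto
    then show ?thesis using adj_verts[OF m that(2)] unfolding vball_def by blast
  qed
  have sub: "?B \<subseteq> vball \<Gamma> v (Suc i)" by (auto simp: vball_def intro: le_SucI)
  have exit: "\<exists>k\<in>halves \<Gamma>. f = {k, flip \<Gamma> k} \<and> att \<Gamma> k \<in> ?B \<and> att \<Gamma> (flip \<Gamma> k) \<notin> ?B"
    if f: "f \<in> edges \<Gamma>" "f \<notin> ?E i" "ends \<Gamma> f \<inter> ?B \<noteq> {}" for f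
  proof -
    obtain h where h: "h \<in> halves \<Gamma>" "f = {h, flip \<Gamma> h}" using f(1) by (auto simp: edges_def)
    have fh: "flip \<Gamma> h \<in> halves \<Gamma>" "f = {flip \<Gamma> h, flip \<Gamma> (flip \<Gamma> h)}" using M(3,5)[OF h(1)] h(2) by auto
    have "\<not> (att \<Gamma> h \<in> ?B \<and> att \<Gamma> (flip \<Gamma> h) \<in> ?B)" using f(1,2) h(2) unfolding edges_induced by (auto simp: ends_def)
    moreover have "att \<Gamma> h \<in> ?B \<or> att \<Gamma> (flip \<Gamma> h) \<in> ?B" using f(3) h(2) by (auto simp: ends_def)
    ultimately consider "att \<Gamma> h \<in> ?B" "att \<Gamma> (flip \<Gamma> h) \<notin> ?B" | "att \<Gamma> (flip \<Gamma> h) \<in> ?B" "att \<Gamma> h \<notin> ?B" by blast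
    then show ?thesis
    proof cases
      case 1
      then show ?thesis using h by blast
    next
      case 2
      then show ?thesis using fh M(5)[OF h(1)] by (intro bexI[of _ "flip \<Gamma> h"]) auto
    qed
  qed
  have "boundary \<Gamma> (induced \<Gamma> ?B) \<subseteq> (\<Union>f\<in>?F. ?N f)"
  proof
    fix e assume "e \<in> boundary \<Gamma> (induced \<Gamma> ?B)"
    then obtain f where e: "e \<in> ?E i" and f: "f \<in> edges \<Gamma>" "f \<notin> ?E i" and ef: "ends \<Gamma> e \<inter> ends \<Gamma> f \<noteq> {}"
      unfolding boundary_def by blast
    have "ends \<Gamma> e \<subseteq> ?B" using e unfolding edges_induced by blast
    then have "ends \<Gamma> f \<inter> ?B \<noteq> {}" using ef by blast
    from exit[OF f this] obtain k where k: "k \<in> halves \<Gamma>" "f = {k, flip \<Gamma> k}" "att \<Gamma> k \<in> ?B" by blast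
    have "att \<Gamma> (flip \<Gamma> k) \<in> vball \<Gamma> v (Suc i)" using step[OF k(3)] k(1) by (auto simp: adj_def)
    then have "ends \<Gamma> f \<subseteq> vball \<Gamma> v (Suc i)" using k sub by (auto simp: ends_def)
    then have "f \<in> ?F" using f unfolding edges_induced by blast
    then show "e \<in> (\<Union>f\<in>?F. ?N f)" using e ef by blast
  qed
  moreover have fin: "finite ?F" "finite (?E i)"
    using finite_edges[OF m] unfolding edges_induced by auto
  moreover have N: "card (?N f) \<le> 2" if f: "f \<in> ?F" for f
  proof (cases "?N f = {}")
    case False
    then obtain e where "e \<in> ?E i" "ends \<Gamma> e \<inter> ends \<Gamma> f \<noteq> {}" by blast
    then have "ends \<Gamma> f \<inter> ?B \<noteq> {}" unfolding edges_induced by blast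
    moreover have "f \<in> edges \<Gamma>" "f \<notin> ?E i" using f unfolding edges_induced by auto
    ultimately obtain k where k: "k \<in> halves \<Gamma>" "f = {k, flip \<Gamma> k}" "att \<Gamma> k \<in> ?B" "att \<Gamma> (flip \<Gamma> k) \<notin> ?B"
      using exit by blast
    let ?H = "halves_at \<Gamma> (att \<Gamma> k) - {k}"
    have "?N f \<subseteq> (\<lambda>h. {h, flip \<Gamma> h}) ` ?H"
    proof
      fix e assume "e \<in> ?N f"
      then have e: "e \<in> edges \<Gamma>" "ends \<Gamma> e \<subseteq> ?B" "ends \<Gamma> e \<inter> ends \<Gamma> f \<noteq> {}" unfolding edges_induced by auto
      have "f \<noteq> e" using e(2) k(2,4) by (auto simp: ends_def)
      have "att \<Gamma> k \<in> ends \<Gamma> e" using e(2,3) k(2,4) by (auto simp: ends_def)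
      obtain h where h: "h \<in> halves \<Gamma>" "e = {h, flip \<Gamma> h}" using e(1) by (auto simp: edges_def)
      have fh: "flip \<Gamma> h \<in> halves \<Gamma>" "e = {flip \<Gamma> h, flip \<Gamma> (flip \<Gamma> h)}" using M(3,5)[OF h(1)] h(2) by auto
      from \<open>att \<Gamma> k \<in> ends \<Gamma> e\<close> consider "att \<Gamma> h = att \<Gamma> k" | "att \<Gamma> (flip \<Gamma> h) = att \<Gamma> k"
        using h(2) by (auto simp: ends_def)
      then show "e \<in> (\<lambda>h. {h, flip \<Gamma> h}) ` ?H"
      proof cases
        case 1
        then have "h \<in> ?H" using h \<open>f \<noteq> e\<close> k(2) by (auto simp: halves_at_def)
        then show ?thesis using h(2) by blast
      next
        case 2
        then have "flip \<Gamma> h \<in> ?H" using fh \<open>f \<noteq> e\<close> k(2) by (auto simp: halves_at_def)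
        then show ?thesis using fh(2) by blast
      qed
    qed
    moreover have "card ?H = 2"
    proof -
      have "card (halves_at \<Gamma> (att \<Gamma> k)) = 3" using r M(6)[OF k(1)] by (simp add: regular_def)
      then show ?thesis using k(1) by (simp add: halves_at_def card_Diff_singleton)
    qed
    moreover have "finite ?H" using M(2) by (simp add: halves_at_def)
    ultimately show ?thesis using surj_card_le[of ?H "?N f" "\<lambda>h. {h, flip \<Gamma> h}"] by linarith
  next
    case True
    show ?thesis unfolding True by simp
  qed
  ultimately have "card (boundary \<Gamma> (induced \<Gamma> ?B)) \<le> card (\<Union>f\<in>?F. ?N f)"
    by (intro card_mono) auto
  also have "\<dots> \<le> (\<Sum>f\<in>?F. card (?N f))" by (rule card_UN_le[OF fin(1)])
  also have "\<dots> \<le> (\<Sum>f\<in>?F. 2)" by (rule sum_mono[OF N])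
  finally show ?thesis by simp
qed

text \<open>As long as a ball has at most half of the edges, at least a fraction \<delta> of them is
  boundary, and every new edge accounts for two boundary edges: growth by the factor
  \<open>1 + \<delta> / 2\<close>. The radius is shifted by one because a ball of radius 0 may
  contain no edge.\<close>

lemma expander_ball_growth:
  assumes m: "multigraph \<Gamma>" and r: "regular 3 \<Gamma>" and v: "v \<in> verts \<Gamma>" and \<delta>: "0 < \<delta>" "\<delta> \<le> cheeger \<Gamma>"
  shows "real (card (edges \<Gamma>)) / 2 < real (card (edges (induced \<Gamma> (vball \<Gamma> v (Suc i))))) \<or>
    (1 + \<delta> / 2) ^ i \<le> real (card (edges (induced \<Gamma> (vball \<Gamma> v (Suc i)))))"
proof -
  note M = multigraphD[OF m]
  let ?E = "\<lambda>i. edges (induced \<Gamma> (vball \<Gamma> v i))"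
  have fin: "finite (?E i)" for i using finite_edges[OF m] unfolding edges_induced by auto
  have mono: "?E i \<subseteq> ?E (Suc i)" for i
  proof -
    have "vball \<Gamma> v i \<subseteq> vball \<Gamma> v (Suc i)" by (auto simp: vball_def intro: le_SucI)
    then show ?thesis unfolding edges_induced by blast
  qed
  show ?thesis
  proof (induction i)
    case 0
    have "card (halves_at \<Gamma> v) = 3" using r v by (simp add: regular_def)
    then obtain h where "h \<in> halves_at \<Gamma> v" by fastforce
    then have h: "h \<in> halves \<Gamma>" "att \<Gamma> h = v" by (auto simp: halves_at_def)
    have "(v, att \<Gamma> (flip \<Gamma> h)) \<in> adj \<Gamma>" using h by (auto simp: adj_def)
    then have "(v, att \<Gamma> (flip \<Gamma> h)) \<in> adj \<Gamma> ^^ 1" by simp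
    moreover have "(v, v) \<in> adj \<Gamma> ^^ 0" by simp
    ultimately have "{v, att \<Gamma> (flip \<Gamma> h)} \<subseteq> vball \<Gamma> v (Suc 0)"
      unfolding vball_def using v M(6)[OF M(3)[OF h(1)]]
      by (auto intro: exI[of _ "1::nat"] exI[of _ "0::nat"] simp del: relpow.simps)
    then have "{h, flip \<Gamma> h} \<in> ?E (Suc 0)" unfolding edges_induced using h by (auto simp: edges_def ends_def)
    then have "0 < card (?E (Suc 0))" using fin card_gt_0_iff by blast
    then show ?case by simp
  next
    case (Suc i)
    have le: "card (?E (Suc i)) \<le> card (?E (Suc (Suc i)))" using card_mono[OF fin mono] .
    show ?case
    proof (cases "real (card (edges \<Gamma>)) / 2 < real (card (?E (Suc i)))")
      case True
      then show ?thesis using le by linarith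
    next
      case False
      then have g: "(1 + \<delta> / 2) ^ i \<le> real (card (?E (Suc i)))" using Suc.IH by blast
      have "1 \<le> (1 + \<delta> / 2) ^ i" using \<delta> by simp
      then have pos: "1 \<le> card (?E (Suc i))" using g by simp
      let ?D = "induced \<Gamma> (vball \<Gamma> v (Suc i))"
      have "subgraph ?D \<Gamma>" using subgraph_induced[OF m] by (auto simp: vball_def)
      then have "\<delta> \<le> real (card (boundary \<Gamma> ?D)) / real (card (?E (Suc i)))"
        using cheeger_le[OF m _ pos] False \<delta> by simp
      then have "\<delta> * real (card (?E (Suc i))) \<le> real (card (boundary \<Gamma> ?D))"
        using pos by (simp add: le_divide_eq)
      also have "\<dots> \<le> real (2 * card (?E (Suc (Suc i)) - ?E (Suc i)))"
        using boundary_ball_le[OF m r] of_nat_le_iff by blast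
      also have "\<dots> = 2 * (real (card (?E (Suc (Suc i)))) - real (card (?E (Suc i))))"
        using mono[of "Suc i"] fin le by (simp add: card_Diff_subset of_nat_diff)
      finally have "(1 + \<delta> / 2) * real (card (?E (Suc i))) \<le> real (card (?E (Suc (Suc i))))"
        by (simp add: field_simps)
      moreover have "(1 + \<delta> / 2) ^ Suc i \<le> (1 + \<delta> / 2) * real (card (?E (Suc i)))"
        using g \<delta> by simp
      ultimately show ?thesis by linarith
    qed
  qed
qed

text \<open>Balls around \<open>u\<close> and \<open>v\<close> with more than half of the edges each
  have an edge in common.\<close>

lemma expander_diam:
  assumes m: "multigraph \<Gamma>" and r: "regular 3 \<Gamma>" and \<delta>: "0 < \<delta>" "\<delta> \<le> cheeger \<Gamma>"
    and i: "real (card (edges \<Gamma>)) / 2 < (1 + \<delta> / 2) ^ i"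
  shows "diam_le \<Gamma> (2 * Suc i)"
  unfolding diam_le_def
proof (intro ballI)
  note M = multigraphD[OF m]
  fix u v assume uv: "u \<in> verts \<Gamma>" "v \<in> verts \<Gamma>"
  let ?E = "\<lambda>v. edges (induced \<Gamma> (vball \<Gamma> v (Suc i)))"
  have half: "real (card (edges \<Gamma>)) / 2 < real (card (?E w))" if "w \<in> verts \<Gamma>" for w
    using expander_ball_growth[OF m r that \<delta>, of i] i by linarith
  have sub: "?E w \<subseteq> edges \<Gamma>" for w unfolding edges_induced by auto
  have "?E u \<inter> ?E v \<noteq> {}"
  proof
    assume "?E u \<inter> ?E v = {}"
    then have "card (?E u) + card (?E v) = card (?E u \<union> ?E v)"
      using finite_edges[OF m] sub finite_subset by (metis card_Un_disjoint)
    also have "\<dots> \<le> card (edges \<Gamma>)" using finite_edges[OF m] sub by (intro card_mono) auto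
    finally show False using half[OF uv(1)] half[OF uv(2)] by linarith
  qed
  then obtain h where h: "ends \<Gamma> {h, flip \<Gamma> h} \<subseteq> vball \<Gamma> u (Suc i)" "ends \<Gamma> {h, flip \<Gamma> h} \<subseteq> vball \<Gamma> v (Suc i)"
    unfolding edges_induced by (auto simp: edges_def)
  then have "att \<Gamma> h \<in> vball \<Gamma> u (Suc i)" "att \<Gamma> h \<in> vball \<Gamma> v (Suc i)" by (auto simp: ends_def)
  then obtain j k where jk: "j \<le> Suc i" "(u, att \<Gamma> h) \<in> adj \<Gamma> ^^ j" "k \<le> Suc i" "(v, att \<Gamma> h) \<in> adj \<Gamma> ^^ k"
    unfolding vball_def by blast
  have "(att \<Gamma> h, v) \<in> adj \<Gamma> ^^ k" using relpow_sym[OF _ jk(4)] adj_sym[OF m] by blast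
  then have "(u, v) \<in> adj \<Gamma> ^^ (j + k)" using jk(2) by (auto simp: relpow_add)
  moreover have "j + k \<le> 2 * Suc i" using jk by simp
  ultimately show "\<exists>k\<le>2 * Suc i. (u, v) \<in> adj \<Gamma> ^^ k" by blast
qed

text \<open>The exponent is the rounded-up logarithm of \<open>3 * g\<close>. For
  \<open>g \<ge> 3\<close> both 1 and \<open>ln 3\<close> are at most \<open>ln g\<close>, which
  absorbs the factor 3 and the rounding.\<close>

lemma power_ge_linear:
  fixes c :: real
  assumes "1 < c" "3 \<le> g"
  obtains i where "3 * real g \<le> c ^ i" "real i \<le> (3 / ln c + 1) * ln (real g)"
proof -
  define i where "i = nat \<lceil>ln (3 * real g) / ln c\<rceil>"
  have l: "0 < ln c" using assms(1) by simp
  have g1: "1 \<le> ln (real g)"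
  proof -
    have "exp (1::real) \<le> real g" using exp_le assms(2) by linarith
    then show ?thesis using ln_ge_iff[of "real g" 1] assms(2) by simp
  qed
  have "0 \<le> ln (3 * real g) / ln c" using l assms(2) by simp
  then have i: "ln (3 * real g) / ln c \<le> real i" "real i \<le> ln (3 * real g) / ln c + 1"
    unfolding i_def by linarith+
  have "ln (3 * real g) \<le> real i * ln c" using i(1) l by (simp add: divide_le_eq)
  also have "\<dots> = ln (c ^ i)" using assms(1) by (simp add: ln_realpow)
  finally have 1: "3 * real g \<le> c ^ i" using assms by simp
  have "ln (3::real) \<le> ln (real g)" using assms(2) by simp
  moreover have "ln (3 * real g) = ln 3 + ln (real g)" using assms(2) by (simp add: ln_mult)
  ultimately have "ln (3 * real g) \<le> 3 * ln (real g)" using g1 by linarith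
  then have "ln (3 * real g) / ln c \<le> 3 * ln (real g) / ln c" using l by (simp add: divide_right_mono)
  then have "real i \<le> (3 / ln c + 1) * ln (real g)" using i(2) g1 by (simp add: algebra_simps)
  then show ?thesis using that 1 by blast
qed

section \<open>A graph of linear diameter\<close>

text \<open>
  A path on \<open>2 * m\<close> vertices in which every second edge is doubled, with a loop at both ends.
\<close>

definition chain :: "nat \<Rightarrow> mgraph" where
  "chain m = \<lparr>verts = {..<2 * m}, halves = {..<6 * m},
     flip = (\<lambda>h. if h = 0 then 1 else if h = 1 then 0
       else if h = 6 * m - 2 then 6 * m - 1 else if h = 6 * m - 1 then 6 * m - 2
       else if h mod 6 = 2 then h + 1 else if h mod 6 = 3 then h - 1
       else if h mod 6 < 2 then h - 2 else h + 2),
     att = (\<lambda>h. h div 3)\<rparr>"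

lemma chain_sel [simp]:
  "verts (chain m) = {..<2 * m}" "halves (chain m) = {..<6 * m}" "att (chain m) h = h div 3"
  by (simp_all add: chain_def)

text \<open>Vertex \<open>v\<close> carries the half-edges \<open>3v\<close>, \<open>3v + 1\<close>,
  \<open>3v + 2\<close>. In each block of six, residues 2 and 3 form the single edge, and residues 4
  and 5 are joined to residues 0 and 1 of the next block, giving the double edge; the leftover pairs
  at both ends are the loops. The last conjunct says that an edge raises the vertex number by at
  most one.\<close>

lemma chain_flip:
  assumes "h < 6 * m"
  shows "flip (chain m) h < 6 * m \<and> flip (chain m) h \<noteq> h \<and> flip (chain m) (flip (chain m) h) = h \<and>
    flip (chain m) h div 3 \<le> h div 3 + 1"
proof -
  define a b where "a = h div 6" and "b = h mod 6"
  have h: "h = 6 * a + b" "b < 6" by (simp_all add: a_def b_def)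
  have a: "a < m" using assms by (simp add: a_def)
  consider "b = 0" | "b = 1" | "b = 2" | "b = 3" | "b = 4" | "b = 5" using h(2) by linarith
  then show ?thesis
  proof cases
    case 1
    show ?thesis
    proof (cases a)
      case (Suc a')
      then show ?thesis using h 1 a by (auto simp: chain_def mod_Suc)
    qed (use h 1 a in \<open>auto simp: chain_def\<close>)
  next
    case 2
    show ?thesis
    proof (cases a)
      case (Suc a')
      then show ?thesis using h 2 a by (auto simp: chain_def mod_Suc)
    qed (use h 2 a in \<open>auto simp: chain_def\<close>)
  next
    case 3
    then show ?thesis using h a by (auto simp: chain_def mod_Suc)
  next
    case 4
    then show ?thesis using h a by (auto simp: chain_def mod_Suc)
  next
    case 5
    then show ?thesis using h a by (cases "Suc a = m") (auto simp: chain_def mod_Suc)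
  next
    case 6
    then show ?thesis using h a by (cases "Suc a = m") (auto simp: chain_def mod_Suc)
  qed
qed

lemma chain_multigraph: "multigraph (chain m)"
  using chain_flip[of _ m] by (auto simp: multigraph_def)

lemma chain_regular: "regular 3 (chain m)"
proof -
  have "halves_at (chain m) v = {3 * v, 3 * v + 1, 3 * v + 2}" if "v < 2 * m" for v
    using that by (auto simp: halves_at_def)
  then show ?thesis by (simp add: regular_def)
qed

lemma chain_adj_Suc:
  assumes "Suc v < 2 * m"
  shows "(v, Suc v) \<in> adj (chain m)"
proof -
  define a b where "a = v div 2" and "b = v mod 2"
  have v: "v = 2 * a + b" "b < 2" by (simp_all add: a_def b_def)
  consider "b = 0" | "b = 1" using v(2) by linarith
  then show ?thesis
  proof cases
    case 1
    have "(6 * a + 2) mod 6 = 2" by presburger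
    then have "flip (chain m) (6 * a + 2) = 6 * a + 3" using 1 v assms by (auto simp: chain_def)
    moreover have "v = (6 * a + 2) div 3" "Suc v = (6 * a + 3) div 3" "6 * a + 2 < 6 * m" using v assms 1 by auto
    ultimately show ?thesis unfolding adj_def by (auto intro!: exI[of _ "6 * a + 2"])
  next
    case 2
    have "(6 * a + 4) mod 6 = 4" by presburger
    then have "flip (chain m) (6 * a + 4) = 6 * a + 6" using 2 v assms by (auto simp: chain_def)
    moreover have "v = (6 * a + 4) div 3" "Suc v = (6 * a + 6) div 3" "6 * a + 4 < 6 * m" using v assms 2 by auto
    ultimately show ?thesis unfolding adj_def by (auto intro!: exI[of _ "6 * a + 4"])
  qed
qed

lemma chain_connected:
  assumes "0 < m"
  shows "graph_connected (chain m)"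
proof -
  have r: "(0, v) \<in> (adj (chain m))\<^sup>*" if "v < 2 * m" for v
    using that
  proof (induction v)
    case (Suc v)
    then show ?case using chain_adj_Suc[of v m] by (auto intro: rtrancl_into_rtrancl)
  qed simp
  have "sym ((adj (chain m))\<^sup>*)" using adj_sym[OF chain_multigraph] by (intro sym_rtrancl symI)
  then have "(u, v) \<in> (adj (chain m))\<^sup>*" if "u < 2 * m" "v < 2 * m" for u v
    using rtrancl_trans[OF symD[OF _ r[OF that(1)]] r[OF that(2)]] by blast
  moreover have "0 \<in> verts (chain m)" using assms by simp
  then have "verts (chain m) \<noteq> {}" by blast
  ultimately show ?thesis unfolding graph_connected_def by auto
qed

lemma chain_cubic: "2 \<le> g \<Longrightarrow> chain (g - 1) \<in> cubic_graphs g"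
  using chain_multigraph chain_regular chain_connected[of "g - 1"] by (auto simp: cubic_graphs_iff)

lemma chain_diam:
  assumes "diam_le (chain m) D" "0 < m"
  shows "2 * m \<le> D + 1"
proof -
  have step: "v \<le> u + 1" if "(u, v) \<in> adj (chain m)" for u v
    using that chain_flip[of _ m] by (auto simp: adj_def)
  have far: "(u, v) \<in> adj (chain m) ^^ k \<Longrightarrow> v \<le> u + k" for u v k
  proof (induction k arbitrary: v)
    case (Suc k)
    then obtain w where "(u, w) \<in> adj (chain m) ^^ k" "(w, v) \<in> adj (chain m)" by auto
    then show ?case using Suc.IH[of w] step[of w v] by simp
  qed simp
  have "0 \<in> verts (chain m)" "2 * m - 1 \<in> verts (chain m)" using assms(2) by auto
  then obtain k where "k \<le> D" "(0, 2 * m - 1) \<in> adj (chain m) ^^ k" using assms(1) unfolding diam_le_def by blast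
  then show ?thesis using far[of 0 "2 * m - 1" k] by simp
qed

section \<open>Balls without expanders\<close>

lemma d_S_eq:
  assumes "(X, Y) \<in> simul_rel g ^^ n"
  shows "d_S g X Y = enat (rel_dist (simul_rel g) X Y)"
proof (rule antisym)
  show "d_S g X Y \<le> enat (rel_dist (simul_rel g) X Y)"
    unfolding d_S_def using rel_dist_relpow[OF assms] by (intro INF_lower) simp
  show "enat (rel_dist (simul_rel g) X Y) \<le> d_S g X Y"
    unfolding d_S_def by (rule INF_greatest) (auto intro: rel_dist_le)
qed

text \<open>A crude bound by the number of adjacent pairs. Its purpose is to make all distances to
  the base graph finite and bounded.\<close>

lemma cubic_diam_le:
  assumes "\<Gamma> \<in> cubic_graphs g"
  shows "diam_le \<Gamma> (6 * g)"
  unfolding diam_le_def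
proof (intro ballI)
  fix u v assume uv: "u \<in> verts \<Gamma>" "v \<in> verts \<Gamma>"
  have G: "multigraph \<Gamma>" "graph_connected \<Gamma>" "regular 3 \<Gamma>" "card (verts \<Gamma>) + 2 = 2 * g"
    using assms by (auto simp: cubic_graphs_iff)
  note M = multigraphD[OF G(1)]
  have A: "adj \<Gamma> = (\<lambda>h. (att \<Gamma> h, att \<Gamma> (flip \<Gamma> h))) ` halves \<Gamma>" by (auto simp: adj_def)
  have "finite (adj \<Gamma>)" "card (adj \<Gamma>) \<le> card (halves \<Gamma>)" unfolding A using M(2) by (auto intro: card_image_le)
  moreover have "card (halves \<Gamma>) \<le> 6 * g" using card_halves_regular[OF G(1,3)] G(4) by simp
  moreover have "(u, v) \<in> (adj \<Gamma>)\<^sup>*" using G(2) uv by (auto simp: graph_connected_def)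
  ultimately obtain n where "n \<le> card (adj \<Gamma>)" "(u, v) \<in> adj \<Gamma> ^^ n"
    using rtrancl_finite_eq_relpow[of "adj \<Gamma>"] by auto
  then show "\<exists>k\<le>6 * g. (u, v) \<in> adj \<Gamma> ^^ k"
    using \<open>card (adj \<Gamma>) \<le> card (halves \<Gamma>)\<close> \<open>card (halves \<Gamma>) \<le> 6 * g\<close> by (intro exI[of _ n]) auto
qed

text \<open>The base graph is obtained by sorting the chain, but any other start would do: sorted
  graphs with the same number of vertices are isomorphic.\<close>

lemma base_exists:
  assumes "2 \<le> g" "2 * g \<le> 2 ^ k"
  shows "\<exists>B\<in>Graph g. \<forall>X\<in>Graph g. \<forall>\<Gamma>\<in>X. \<forall>D. diam_le \<Gamma> D \<longrightarrow>
    (X, B) \<in> simul_rel g ^^ rel_dist (simul_rel g) X B \<and> rel_dist (simul_rel g) X B \<le> 3 * (k + 2 * D + 1)"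
proof -
  have sort: "\<exists>\<Gamma>' n. sorted_graph \<Gamma>' \<and> (iso_class \<Gamma>, iso_class \<Gamma>') \<in> simul_rel g ^^ n \<and>
      n \<le> 3 * (k + 2 * D + 1) \<and> \<Gamma>' \<in> cubic_graphs g" if \<Gamma>: "\<Gamma> \<in> cubic_graphs g" and D: "diam_le \<Gamma> D" for \<Gamma> D
  proof -
    have G: "multigraph \<Gamma>" "regular 3 \<Gamma>" "verts \<Gamma> \<noteq> {}" "card (verts \<Gamma>) + 2 = 2 * g"
      using \<Gamma> by (auto simp: cubic_graphs_iff graph_connected_def)
    obtain t where t: "spanning \<Gamma> t" "ht (shape id t) \<le> 2 * D + 1" using spanning_tree_exists[OF G(1-3) D] .
    from sort_graph[OF t(1) G(4) assms(2)] obtain \<Gamma>' where "sorted_graph \<Gamma>'"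
      "(iso_class \<Gamma>, iso_class \<Gamma>') \<in> simul_rel g ^^ (3 * (k + ht (shape id t)))" "\<Gamma>' \<in> cubic_graphs g" by metis
    then show ?thesis using t(2) by (intro exI[of _ \<Gamma>'] exI[of _ "3 * (k + ht (shape id t))"]) simp
  qed
  obtain \<Gamma>0 where \<Gamma>0: "sorted_graph \<Gamma>0" "\<Gamma>0 \<in> cubic_graphs g"
    using sort[OF chain_cubic[OF assms(1)] cubic_diam_le[OF chain_cubic[OF assms(1)]]] by blast
  show ?thesis
  proof (intro bexI[OF _ iso_class_Graph[OF \<Gamma>0(2)]] ballI allI impI)
    fix X \<Gamma> D assume X: "X \<in> Graph g" "\<Gamma> \<in> X" and D: "diam_le \<Gamma> D"
    note m = Graph_memD[OF X]
    obtain \<Gamma>' n where *: "sorted_graph \<Gamma>'" "(iso_class \<Gamma>, iso_class \<Gamma>') \<in> simul_rel g ^^ n"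
      "n \<le> 3 * (k + 2 * D + 1)" "\<Gamma>' \<in> cubic_graphs g" using sort[OF m(1) D] by blast
    have "card (verts \<Gamma>') = card (verts \<Gamma>0)" using *(4) \<Gamma>0(2) by (simp add: cubic_graphs_iff)
    then have "iso_class \<Gamma>' = iso_class \<Gamma>0" using sorted_graph_unique[OF *(1) \<Gamma>0(1)] by simp
    then have r: "(X, iso_class \<Gamma>0) \<in> simul_rel g ^^ n" using *(2) m(2) by simp
    show "(X, iso_class \<Gamma>0) \<in> simul_rel g ^^ rel_dist (simul_rel g) X (iso_class \<Gamma>0) \<and>
      rel_dist (simul_rel g) X (iso_class \<Gamma>0) \<le> 3 * (k + 2 * D + 1)"
      using rel_dist_relpow[OF r] rel_dist_le[OF r] *(3) by linarith
  qed
qed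

text \<open>Substituting the square root for \<open>x\<close> reduces this to
  \<open>ln x / x\<close> tending to 0. It will turn the comparison of the linear diameter of the
  chain with the logarithmic one of an expander into \<open>3 ^ n > sqrt g\<close>.\<close>

lemma ln_sqrt_less_linear:
  fixes C :: real
  assumes "0 < C"
  shows "\<exists>g0::nat. \<forall>g\<ge>g0. C * ln (real g) * sqrt (real g) < 2 * real g - 3"
proof -
  have "\<forall>\<^sub>F x::real in at_top. ln x / x < 1 / (2 * C)"
    using order_tendstoD(2)[OF ln_x_over_x_tendsto_0] assms by simp
  then obtain s where s: "\<And>x. s \<le> x \<Longrightarrow> ln x / x < 1 / (2 * C)"
    unfolding eventually_at_top_linorder by blast
  have "C * ln (real g) * sqrt (real g) < 2 * real g - 3" if "nat \<lceil>s\<^sup>2\<rceil> + 4 \<le> g" for g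
  proof -
    have g: "s\<^sup>2 \<le> real g" "4 \<le> g" using that by linarith+
    let ?x = "sqrt (real g)"
    have x: "0 < ?x" "?x * ?x = real g" using g(2) by auto
    have "s \<le> ?x" using g(1) by (rule real_le_rsqrt)
    then have "ln ?x / ?x < 1 / (2 * C)" by (rule s)
    then have "2 * C * ln ?x < ?x" using x(1) assms by (simp add: field_simps)
    then have "2 * C * ln ?x * ?x < ?x * ?x" using x(1) by (rule mult_strict_right_mono)
    moreover have "ln (real g) = 2 * ln ?x" using g(2) by (simp add: ln_sqrt)
    ultimately have "C * ln (real g) * ?x < real g" using x(2) by (simp add: mult_ac)
    then show ?thesis using g(2) by linarith
  qed
  then show ?thesis by blast
qed

theorem corollary6:
  fixes \<delta> :: real and F :: "mgraph set set"
  assumes "\<delta> > 0"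
    and "expander_family 3 \<delta> F"
  shows "\<exists>K>0. \<exists>g0::nat. \<forall>g\<ge>g0. \<exists>X\<in>Graph g. \<exists>r::real.
           on_the_order_of K r (diameter_S g) \<and> ball_S g X r \<inter> F = {}"
proof -
  \<comment> \<open>Expanders have diameter at most \<open>C * ln g\<close>: twice
    \<open>Suc i\<close>, with \<open>i\<close> from \<open>power_ge_linear\<close>.\<close>
  define C where "C = 2 * (3 / ln (1 + \<delta> / 2) + 2)"
  \<comment> \<open>Bounds \<open>3 * (k + 2 * D + 1)\<close>, the number of moves to the base
    graph, by \<open>A * ln g\<close> for \<open>D \<le> C * ln g\<close> and logarithmic
    \<open>k\<close>.\<close>
  define A where "A = 3 * ((3 / ln 2 + 1) + 2 * C + 1)"
  \<comment> \<open>The radius will be \<open>d / K\<close> for the diameter \<open>d\<close>. The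
    summand 5 keeps it below half the maximal distance from the base graph, the summand
    \<open>16 * A\<close> keeps it below \<open>ln g / 4\<close> when the diameter is small.\<close>
  define K where "K = 16 * A + 5"
  have C0: "0 < C" using assms(1) by (simp add: C_def add_pos_pos)
  have A0: "0 < A" using C0 by (simp add: A_def add_pos_pos)
  obtain g1 where g1: "\<And>g. g1 \<le> g \<Longrightarrow> C * ln (real g) * sqrt (real g) < 2 * real g - 3"
    using ln_sqrt_less_linear[OF C0] by blast
  have "\<exists>X\<in>Graph g. \<exists>r::real. on_the_order_of K r (diameter_S g) \<and> ball_S g X r \<inter> F = {}"
    if g: "max 3 g1 \<le> g" for g
  proof -
    have g3: "3 \<le> g" and gC: "C * ln (real g) * sqrt (real g) < 2 * real g - 3" using g g1 by auto
    have lg: "1 \<le> ln (real g)"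
    proof -
      have "exp (1::real) \<le> real g" using exp_le g3 by linarith
      then show ?thesis using ln_ge_iff[of "real g" 1] g3 by simp
    qed
    let ?R = "simul_rel g"
    let ?\<rho> = "rel_dist ?R"
    have diam: "\<exists>D. diam_le \<Gamma> D \<and> real D \<le> C * ln (real g)" if Y: "Y \<in> Graph g" "Y \<in> F" "\<Gamma> \<in> Y" for Y \<Gamma>
    proof -
      have G: "multigraph \<Gamma>" "regular 3 \<Gamma>" "card (verts \<Gamma>) + 2 = 2 * g"
        using Graph_memD(1)[OF Y(1,3)] by (auto simp: cubic_graphs_iff)
      have ch: "\<delta> \<le> cheeger \<Gamma>" using assms(2) Y by (auto simp: expander_family_def)
      obtain i where i: "3 * real g \<le> (1 + \<delta> / 2) ^ i" "real i \<le> (3 / ln (1 + \<delta> / 2) + 1) * ln (real g)"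
        using power_ge_linear[of "1 + \<delta> / 2" g] assms(1) g3 by auto
      have "2 * card (edges \<Gamma>) = 3 * card (verts \<Gamma>)"
        using card_halves_eq_edges[OF G(1)] card_halves_regular[OF G(1,2)] by simp
      then have "card (edges \<Gamma>) < 6 * g" using G(3) g3 by linarith
      then have "real (card (edges \<Gamma>)) / 2 < 3 * real g" by linarith
      then have "diam_le \<Gamma> (2 * Suc i)" using expander_diam[OF G(1,2) assms(1) ch] i(1) by fastforce
      moreover have "C * ln (real g) = 2 * ((3 / ln (1 + \<delta> / 2) + 1) * ln (real g)) + 2 * ln (real g)"
        by (simp add: C_def algebra_simps)
      then have "real (2 * Suc i) \<le> C * ln (real g)" using i(2) lg by simp
      ultimately show ?thesis by blast
    qed
    obtain k where k: "3 * real g \<le> 2 ^ k" "real k \<le> (3 / ln 2 + 1) * ln (real g)"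
      using power_ge_linear[of 2 g] g3 by auto
    have "real (2 * g) \<le> real (2 ^ k)" using k(1) by simp
    then have k2: "2 * g \<le> 2 ^ k" by (simp only: of_nat_le_iff)
    have g2: "2 \<le> g" using g3 by simp
    obtain B where B: "B \<in> Graph g" and base: "\<And>X \<Gamma> D. X \<in> Graph g \<Longrightarrow> \<Gamma> \<in> X \<Longrightarrow> diam_le \<Gamma> D \<Longrightarrow>
      (X, B) \<in> ?R ^^ ?\<rho> X B \<and> ?\<rho> X B \<le> 3 * (k + 2 * D + 1)"
      using base_exists[OF g2 k2] by blast
    have toB: "(X, B) \<in> ?R ^^ ?\<rho> X B" "?\<rho> X B \<le> 3 * (k + 12 * g + 1)" if "X \<in> Graph g" for X
    proof -
      obtain \<Gamma> where "\<Gamma> \<in> cubic_graphs g" "\<Gamma> \<in> X" using Graph_repr[OF \<open>X \<in> Graph g\<close>] by blast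
      then show "(X, B) \<in> ?R ^^ ?\<rho> X B" "?\<rho> X B \<le> 3 * (k + 12 * g + 1)"
        using base[OF that _ cubic_diam_le] by fastforce+
    qed
    have fromB: "(B, X) \<in> ?R ^^ ?\<rho> X B" if "X \<in> Graph g" for X
      using relpow_sym[OF simul_rel_sym toB(1)[OF that]] .
    have conn: "(X, Y) \<in> ?R ^^ (?\<rho> X B + ?\<rho> Y B)" if "X \<in> Graph g" "Y \<in> Graph g" for X Y
      using toB(1)[OF that(1)] fromB[OF that(2)] by (auto simp: relpow_add)
    have dS: "d_S g X Y = enat (?\<rho> X Y)" if "X \<in> Graph g" "Y \<in> Graph g" for X Y
      using d_S_eq[OF conn[OF that]] .
    have expander_base: "real (?\<rho> Y B) \<le> A * ln (real g)" if Y: "Y \<in> Graph g" "Y \<in> F" for Y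
    proof -
      obtain \<Gamma> where "\<Gamma> \<in> Y" using Graph_repr[OF Y(1)] by blast
      then obtain D where D: "diam_le \<Gamma> D" "real D \<le> C * ln (real g)" using diam Y by blast
      have "?\<rho> Y B \<le> 3 * (k + 2 * D + 1)" using base[OF Y(1) \<open>\<Gamma> \<in> Y\<close> D(1)] by simp
      then have "real (?\<rho> Y B) \<le> real (3 * (k + 2 * D + 1))" by (simp only: of_nat_le_iff)
      also have "\<dots> = 3 * (real k + 2 * real D + 1)" by simp
      also have "\<dots> \<le> 3 * ((3 / ln 2 + 1) * ln (real g) + 2 * (C * ln (real g)) + ln (real g))"
        using k(2) D(2) lg by (intro mult_left_mono add_mono) simp_all
      also have "\<dots> = A * ln (real g)" by (simp add: A_def algebra_simps)
      finally show ?thesis .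
    qed
    \<comment> \<open>A graph farthest from the base; it exists because the distances to
      \<open>B\<close> are bounded by \<open>toB\<close>.\<close>
    obtain X where X: "X \<in> Graph g" and X_max: "\<And>Y. Y \<in> Graph g \<Longrightarrow> ?\<rho> Y B \<le> ?\<rho> X B"
    proof -
      have "\<forall>X. X \<in> Graph g \<longrightarrow> ?\<rho> X B < Suc (3 * (k + 12 * g + 1))" using toB(2) by (auto simp only: less_Suc_eq_le)
      from ex_has_greatest_nat[of "\<lambda>X. X \<in> Graph g", OF B this] show ?thesis using that by blast
    qed
    let ?m = "?\<rho> X B"
    have upper: "diameter_S g \<le> enat (2 * ?m)"
      unfolding diameter_S_def
    proof (intro SUP_least)
      fix Y Z assume YZ: "Y \<in> Graph g" "Z \<in> Graph g"
      have "?\<rho> Y Z \<le> ?\<rho> Y B + ?\<rho> Z B" using rel_dist_le[OF conn[OF YZ]] .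
      also have "\<dots> \<le> 2 * ?m" using X_max[OF YZ(1)] X_max[OF YZ(2)] by simp
      finally show "d_S g Y Z \<le> enat (2 * ?m)" using dS[OF YZ] by simp
    qed
    have "d_S g X B \<le> diameter_S g"
      unfolding diameter_S_def by (rule SUP_upper2[OF X], rule SUP_upper[OF B])
    then have lower: "enat ?m \<le> diameter_S g" using dS[OF X B] by simp
    obtain d where d: "diameter_S g = enat d" using upper by (cases "diameter_S g") auto
    have md: "?m \<le> d" "d \<le> 2 * ?m" using upper lower d by auto
    define r where "r = real d / K"
    have K5: "5 \<le> K" using A0 by (simp add: K_def)
    have order: "on_the_order_of K r (diameter_S g)"
    proof -
      have "1 * 1 \<le> K * K" using K5 by (intro mult_mono) auto
      then have "real d * 1 \<le> real d * (K * K)" by (intro mult_left_mono) auto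
      then have "r \<le> K * real d" using K5 by (simp add: r_def divide_le_eq mult.assoc mult.left_commute)
      then show ?thesis unfolding on_the_order_of_def d r_def using K5 by simp
    qed
    have ball: "real (?\<rho> Z Y) \<le> r" if "Y \<in> ball_S g Z r" "Z \<in> Graph g" for Y Z
      using that dS[of Z Y] by (simp add: ball_S_def)
    show ?thesis
    proof (cases "2 * A * ln (real g) \<le> real ?m")
      case True
      have "Y \<notin> F" if Y: "Y \<in> ball_S g X r" for Y
      proof
        assume "Y \<in> F"
        have YG: "Y \<in> Graph g" using Y by (simp add: ball_S_def)
        have "(X, Y) \<in> ?R ^^ ?\<rho> X Y" using rel_dist_relpow[OF conn[OF X YG]] .
        then have "(X, B) \<in> ?R ^^ (?\<rho> X Y + ?\<rho> Y B)" using toB(1)[OF YG] by (auto simp: relpow_add)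
        then have "?m \<le> ?\<rho> X Y + ?\<rho> Y B" by (rule rel_dist_le)
        moreover have "real (?\<rho> Y B) \<le> real ?m / 2" using expander_base[OF YG \<open>Y \<in> F\<close>] True by simp
        \<comment> \<open>With \<open>d \<le> 2 * ?m\<close> the radius is at most
          \<open>2/5\<close> of \<open>?m\<close>, while the triangle inequality puts every expander
          at distance at least \<open>?m / 2\<close> from \<open>X\<close>.\<close>
        moreover have "r \<le> real d / 5" unfolding r_def using K5 by (intro divide_left_mono) auto
        moreover have "0 < A * ln (real g)" using A0 lg by simp
        ultimately show False using ball[OF Y X] md True by linarith
      qed
      then show ?thesis using X order by blast
    next
      case False
      let ?X = "iso_class (chain (g - 1))"
      have cX: "?X \<in> Graph g" "chain (g - 1) \<in> ?X"
        using iso_class_Graph[OF chain_cubic[OF g2]] in_iso_class[OF chain_multigraph] by auto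
      have "real d < 4 * A * ln (real g)" using False md by linarith
      then have "r < 4 * A * ln (real g) / K" unfolding r_def using K5 by (simp add: divide_strict_right_mono)
      also have "\<dots> \<le> ln (real g) / 4"
      proof -
        have "16 * A * ln (real g) \<le> K * ln (real g)" using lg by (simp add: K_def)
        then show ?thesis using K5 by (simp add: field_simps)
      qed
      finally have r4: "r < ln (real g) / 4" .
      have "Y \<notin> F" if Y: "Y \<in> ball_S g ?X r" for Y
      proof
        assume "Y \<in> F"
        have YG: "Y \<in> Graph g" using Y by (simp add: ball_S_def)
        let ?n = "?\<rho> ?X Y"
        have n: "(?X, Y) \<in> ?R ^^ ?n" using rel_dist_relpow[OF conn[OF cX(1) YG]] .
        obtain \<Gamma> where "\<Gamma> \<in> Y" using Graph_repr[OF YG] by blast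
        then obtain D where D: "diam_le \<Gamma> D" "real D \<le> C * ln (real g)" using diam YG \<open>Y \<in> F\<close> by blast
        \<comment> \<open>An expander within \<open>?n\<close> moves would give the chain a diameter
          of at most \<open>3 ^ ?n * D\<close>, but that diameter is linear in
          \<open>g\<close>.\<close>
        have "diam_le (chain (g - 1)) (3 ^ ?n * D)" using simul_relpow_diam[OF n cX(1) \<open>\<Gamma> \<in> Y\<close> D(1) cX(2)] .
        then have "2 * (g - 1) \<le> 3 ^ ?n * D + 1" using chain_diam g3 by simp
        then have "real (2 * (g - 1)) \<le> real (3 ^ ?n * D + 1)" by (simp only: of_nat_le_iff)
        then have "2 * real g - 3 \<le> 3 ^ ?n * real D" using g3 by (simp add: of_nat_diff)
        also have "\<dots> \<le> 3 ^ ?n * (C * ln (real g))" using D(2) by simp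
        finally have "C * ln (real g) * sqrt (real g) < C * ln (real g) * 3 ^ ?n" using gC by (simp add: mult.commute)
        then have s: "sqrt (real g) < 3 ^ ?n" using C0 lg by (simp add: mult_less_cancel_left_pos)
        have "ln (sqrt (real g)) < ln (3 ^ ?n :: real)" using s g3 by (intro ln_less_cancel_iff[THEN iffD2]) auto
        then have "ln (real g) / 2 < real ?n * ln 3" using g3 by (simp add: ln_sqrt ln_realpow)
        \<comment> \<open>The rough estimate \<open>ln 3 \<le> 2\<close> is what makes the threshold
          \<open>ln g / 4\<close>.\<close>
        also have "\<dots> \<le> real ?n * 2" using ln_le_minus_one[of "3::real"] by (intro mult_left_mono) auto
        finally have "ln (real g) / 4 < real ?n" by simp
        then show False using ball[OF Y cX(1)] r4 by linarith
      qed
      then show ?thesis using cX(1) order by blast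
    qed
  qed
  moreover have "0 < K" using A0 by (simp add: K_def)
  ultimately show ?thesis by blast
qed

end
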